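(* Let $M$ be a smooth manifold and let $0\le\lambda\le r$ be integers. The degrees of the lifts of tensors from $M$ to $T^rM$, with respect to the canonical homogeneity structure on $T^rM$, are the following: (a) For any covariant tensor $\omega=\alpha_1\otimes\cdots\otimes\alpha_p$ on $M$ (with $\alpha_i$ one-forms), $\deg(\omega^{(\lambda)})=\lambda$. (b) For any contravariant tensor $X=X_1\otimes\cdots\otimes X_q$ on $M$ (with $X_i$ vector fields), $\deg(X^{(\lambda)})=\lambda-qr$. (c) For any $(q,p)$-tensor $K=\alpha_1\otimes\cdots\otimes\alpha_p\otimes X_1\otimes\cdots\otimes X_q$ on $M$, $\deg(K^{(\lambda)})=\lambda-qr$. (d) Permutations of factors in a homogeneous tensor product do not change the degree; thus the degrees of wedge products are the same as those of tensor products. In particular, for one-forms $\omega_1,\dots,\omega_p$ and vector fields $X_1,\dots,X_q$ on $M$, $$\deg\left((\omega_1\wedge\dots\wedge\omega_p\otimes X_1\wedge\dots\wedge X_q)^{(c)}\right)=-(q-1)r,$$ and complete lifts of vector fields commute with the weight vector field $\nabla_{T^rM}$.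
   Context: $T^rM=J^r_0(\mathbb{R},M)$ is the bundle of $r$-jets $[\phi]_r$ at $0$ of smooth curves $\phi:\mathbb{R}\to M$. Its canonical homogeneity structure is $h_s([\phi]_r)=[\phi_s]_r$ with $\phi_s(t)=\phi(st)$; in the coordinates $x^i_\mu=(x^i)^{(\mu)}$, $0\le\mu\le r$, induced from coordinates $(x^i)$ on $M$, its weight vector field is $\nabla_{T^rM}=\sum_i\sum_{\mu=1}^r\mu\,x^i_\mu\partial_{x^i_\mu}$. The statement $\deg(K)=w$ for a tensor field $K$ on $T^rM$ means $\mathcal{L}_{\nabla_{T^rM}}K=wK$. Lifts: for $f\in C^\infty(M)$ and $0\le\lambda\le r$, $f^{(\lambda)}([\phi]_r)=\frac1{\lambda!}\frac{d^\lambda (f\circ\phi)}{dt^\lambda}\big|_{t=0}$. The lift of one-forms is the unique $\mathbb{R}$-linear map with $(f\,dg)^{(\lambda)}=\sum_{\mu=0}^\lambda f^{(\mu)}dg^{(\lambda-\mu)}$. For a vector field $X$ on $M$, $X^{(\lambda)}$ is the unique vector field on $T^rM$ with $X^{(\lambda)}f^{(\mu)}=(Xf)^{(\lambda+\mu-r)}$ for all $f\in C^\infty(M)$, $0\le\mu\le r$. Lifts with superscript $<0$ or $>r$ are zero by convention. Lifts of arbitrary tensor fields are $\mathbb{R}$-linear and determined by $(T\otimes S)^{(\lambda)}=\sum_{\mu=0}^\lambda T^{(\mu)}\otimes S^{(\lambda-\mu)}$ (and similarly for wedge products). The complete lift is $K^{(c)}=K^{(r)}$. *)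

theory Defs
  imports "HOL-Analysis.Analysis" "HOL-Combinatorics.Permutations"
begin

section \<open>Smooth manifolds\<close>

text \<open>
  The model space is the library's \<^const>\<open>Euclidean_space\<close> \<open>n\<close> (sequences vanishing from
  index \<open>n\<close> on), because the dimension \<open>n * (r + 1)\<close> of the jet bundle depends on \<open>r\<close>.
\<close>

definition partial_deriv :: "nat \<Rightarrow> ((nat \<Rightarrow> real) \<Rightarrow> real) \<Rightarrow> (nat \<Rightarrow> real) \<Rightarrow> real" where
  "partial_deriv i f x = deriv (\<lambda>t. f (x(i := t))) (x i)"

text \<open>All iterated partial derivatives exist and are continuous (\<open>U\<close> is meant to be open).\<close>

definition smooth_on :: "nat \<Rightarrow> (nat \<Rightarrow> real) set \<Rightarrow> ((nat \<Rightarrow> real) \<Rightarrow> real) \<Rightarrow> bool" where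
  "smooth_on n U f \<longleftrightarrow>
    (\<forall>is. set is \<subseteq> {..<n} \<longrightarrow>
      continuous_map (subtopology (Euclidean_space n) U) euclideanreal (foldr partial_deriv is f) \<and>
      (\<forall>x\<in>U. \<forall>i<n. (\<lambda>t. foldr partial_deriv is f (x(i := t))) differentiable (at (x i))))"

type_synonym 'a chart = "'a set \<times> ('a \<Rightarrow> nat \<Rightarrow> real)"

record 'a manifold =
  mtop :: "'a topology"
  mdim :: nat
  matlas :: "'a chart set"

abbreviation points :: "'a manifold \<Rightarrow> 'a set" where
  "points M \<equiv> topspace (mtop M)"

definition smooth_manifold :: "'a manifold \<Rightarrow> bool" where
  "smooth_manifold M \<longleftrightarrow>
    Hausdorff_space (mtop M) \<and> second_countable (mtop M) \<and>
    points M = (\<Union>(U, \<phi>)\<in>matlas M. U) \<and>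
    (\<forall>(U, \<phi>)\<in>matlas M.
      openin (mtop M) U \<and> openin (Euclidean_space (mdim M)) (\<phi> ` U) \<and>
      homeomorphic_map (subtopology (mtop M) U)
        (subtopology (Euclidean_space (mdim M)) (\<phi> ` U)) \<phi>) \<and>
    (\<forall>(U, \<phi>)\<in>matlas M. \<forall>(V, \<psi>)\<in>matlas M. \<forall>i<mdim M.
      smooth_on (mdim M) (\<phi> ` (U \<inter> V)) (\<lambda>y. \<psi> (inv_into U \<phi> y) i))"

section \<open>Functions, vector fields and one-forms\<close>

text \<open>
  Functions on \<open>M\<close> are extended by \<open>0\<close> outside the carrier, and operators on smooth functions,
  vector fields, etc. by \<open>0\<close> outside their domain, so that HOL equality is equality on \<open>M\<close>.
\<close>

definition smooth_functions :: "'a manifold \<Rightarrow> ('a \<Rightarrow> real) set" where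
  "smooth_functions M =
    {f. (\<forall>x. x \<notin> points M \<longrightarrow> f x = 0) \<and>
        (\<forall>(U, \<phi>)\<in>matlas M. smooth_on (mdim M) (\<phi> ` U) (\<lambda>y. f (inv_into U \<phi> y)))}"

type_synonym 'a vfield = "('a \<Rightarrow> real) \<Rightarrow> 'a \<Rightarrow> real"
type_synonym 'a oneform = "'a vfield \<Rightarrow> 'a \<Rightarrow> real"

text \<open>Vector fields are the derivations of the algebra of smooth functions.\<close>

definition vector_fields :: "'a manifold \<Rightarrow> 'a vfield set" where
  "vector_fields M =
    {X. (\<forall>f\<in>smooth_functions M. X f \<in> smooth_functions M) \<and>
        (\<forall>f. f \<notin> smooth_functions M \<longrightarrow> X f = (\<lambda>x. 0)) \<and>
        (\<forall>f\<in>smooth_functions M. \<forall>g\<in>smooth_functions M.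
          (\<forall>a b. X (\<lambda>x. a * f x + b * g x) = (\<lambda>x. a * X f x + b * X g x)) \<and>
          X (\<lambda>x. f x * g x) = (\<lambda>x. X f x * g x + f x * X g x))}"

text \<open>One-forms are the functionals on vector fields linear over smooth functions.\<close>

definition one_forms :: "'a manifold \<Rightarrow> 'a oneform set" where
  "one_forms M =
    {\<alpha>. (\<forall>X\<in>vector_fields M. \<alpha> X \<in> smooth_functions M) \<and>
        (\<forall>X. X \<notin> vector_fields M \<longrightarrow> \<alpha> X = (\<lambda>x. 0)) \<and>
        (\<forall>X\<in>vector_fields M. \<forall>Y\<in>vector_fields M.
          \<forall>f\<in>smooth_functions M. \<forall>g\<in>smooth_functions M.
            \<alpha> (\<lambda>h x. f x * X h x + g x * Y h x) = (\<lambda>x. f x * \<alpha> X x + g x * \<alpha> Y x))}"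

text \<open>The one-form \<open>f dg\<close>.\<close>

definition fdg :: "'a manifold \<Rightarrow> ('a \<Rightarrow> real) \<Rightarrow> ('a \<Rightarrow> real) \<Rightarrow> 'a oneform" where
  "fdg M f g = (\<lambda>X x. if X \<in> vector_fields M then f x * X g x else 0)"

definition lie_bracket :: "'a vfield \<Rightarrow> 'a vfield \<Rightarrow> 'a vfield" where
  "lie_bracket X Y = (\<lambda>f x. X (Y f) x - Y (X f) x)"

section \<open>Tensor fields\<close>

text \<open>
  A tensor field is a multilinear map over smooth functions. Its signature lists its slots in
  order: a covariant slot takes a vector field, a contravariant slot takes a one-form. Keeping
  the order makes, e.g., \<open>\<alpha> \<otimes> X\<close> and \<open>X \<otimes> \<alpha>\<close> different.
\<close>

datatype slot = Cov | Con

datatype 'a arg = Vec "'a vfield" | Form "'a oneform"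

datatype 'a tensor = Tensor (sig: "slot list") (app: "'a arg list \<Rightarrow> 'a \<Rightarrow> real")

fun arg_ok :: "'a manifold \<Rightarrow> slot \<Rightarrow> 'a arg \<Rightarrow> bool" where
  "arg_ok M Cov (Vec X) = (X \<in> vector_fields M)"
| "arg_ok M Con (Form \<alpha>) = (\<alpha> \<in> one_forms M)"
| "arg_ok M _ _ = False"

definition args_ok :: "'a manifold \<Rightarrow> slot list \<Rightarrow> 'a arg list \<Rightarrow> bool" where
  "args_ok M \<sigma> as = list_all2 (arg_ok M) \<sigma> as"

text \<open>\<open>f a + g b\<close> for functions \<open>f\<close>, \<open>g\<close> and arguments \<open>a\<close>, \<open>b\<close> of the same kind.\<close>

fun arg_comb :: "('a \<Rightarrow> real) \<Rightarrow> 'a arg \<Rightarrow> ('a \<Rightarrow> real) \<Rightarrow> 'a arg \<Rightarrow> 'a arg" where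
  "arg_comb f (Vec X) g (Vec Y) = Vec (\<lambda>h x. f x * X h x + g x * Y h x)"
| "arg_comb f (Form \<alpha>) g (Form \<beta>) = Form (\<lambda>X x. f x * \<alpha> X x + g x * \<beta> X x)"
| "arg_comb f a g b = a"

definition tensor_fields :: "'a manifold \<Rightarrow> 'a tensor set" where
  "tensor_fields M =
    {T. (\<forall>as. args_ok M (sig T) as \<longrightarrow> app T as \<in> smooth_functions M) \<and>
        (\<forall>as. \<not> args_ok M (sig T) as \<longrightarrow> app T as = (\<lambda>x. 0)) \<and>
        (\<forall>as b i. args_ok M (sig T) as \<and> i < length (sig T) \<and> arg_ok M (sig T ! i) b \<longrightarrow>
          (\<forall>f\<in>smooth_functions M. \<forall>g\<in>smooth_functions M.
            app T (as[i := arg_comb f (as ! i) g b]) =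
              (\<lambda>x. f x * app T as x + g x * app T (as[i := b]) x)))}"

definition fun_tensor :: "('a \<Rightarrow> real) \<Rightarrow> 'a tensor" where
  "fun_tensor f = Tensor [] (\<lambda>as. if as = [] then f else (\<lambda>x. 0))"

definition form_tensor :: "'a oneform \<Rightarrow> 'a tensor" where
  "form_tensor \<alpha> = Tensor [Cov] (\<lambda>as. case as of [Vec X] \<Rightarrow> \<alpha> X | _ \<Rightarrow> (\<lambda>x. 0))"

definition vec_tensor :: "'a manifold \<Rightarrow> 'a vfield \<Rightarrow> 'a tensor" where
  "vec_tensor M X = Tensor [Con]
    (\<lambda>as. case as of [Form \<alpha>] \<Rightarrow> (if \<alpha> \<in> one_forms M then \<alpha> X else (\<lambda>x. 0)) | _ \<Rightarrow> (\<lambda>x. 0))"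

text \<open>\<open>tensor_add\<close> and \<open>tensor_sum\<close> are meant for tensors of equal signature.\<close>

definition tensor_add :: "'a tensor \<Rightarrow> 'a tensor \<Rightarrow> 'a tensor" where
  "tensor_add T S = Tensor (sig T) (\<lambda>as x. app T as x + app S as x)"

definition tensor_scale :: "real \<Rightarrow> 'a tensor \<Rightarrow> 'a tensor" where
  "tensor_scale c T = Tensor (sig T) (\<lambda>as x. c * app T as x)"

definition tensor_sum :: "slot list \<Rightarrow> ('i \<Rightarrow> 'a tensor) \<Rightarrow> 'i set \<Rightarrow> 'a tensor" where
  "tensor_sum \<sigma> T I = Tensor \<sigma> (\<lambda>as x. \<Sum>i\<in>I. app (T i) as x)"

definition tensor_prod :: "'a tensor \<Rightarrow> 'a tensor \<Rightarrow> 'a tensor" where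
  "tensor_prod T S = Tensor (sig T @ sig S)
    (\<lambda>as x. app T (take (length (sig T)) as) x * app S (drop (length (sig T)) as) x)"

definition tensor_prods :: "'a manifold \<Rightarrow> 'a tensor list \<Rightarrow> 'a tensor" where
  "tensor_prods M Ts = foldr tensor_prod Ts (fun_tensor (indicator (points M)))"

text \<open>
  \<open>wedge M [T\<^sub>0, \<dots>, T\<^sub>k\<^sub>-\<^sub>1]\<close> is \<open>\<Sum>\<pi>. sgn \<pi> T\<^bsub>\<pi> 0\<^esub> \<otimes> \<dots> \<otimes> T\<^bsub>\<pi> (k-1)\<^esub>\<close>; it is used only for lists
  consisting of one-forms or consisting of vector fields.
\<close>

definition wedge :: "'a manifold \<Rightarrow> 'a tensor list \<Rightarrow> 'a tensor" where
  "wedge M Ts = tensor_sum (concat (map sig Ts))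
    (\<lambda>\<pi>. tensor_scale (of_int (sign \<pi>))
      (tensor_prods M (map (\<lambda>i. Ts ! \<pi> i) [0..<length Ts])))
    {\<pi>. \<pi> permutes {..<length Ts}}"

text \<open>
  The Lie derivative along a vector field \<open>D\<close>, extended from functions (where it is \<open>D\<close>) and
  vector fields (where it is the bracket) to one-forms and tensor fields by the Leibniz rule
  for the evaluation on arguments.
\<close>

fun lie_arg :: "'a manifold \<Rightarrow> 'a vfield \<Rightarrow> 'a arg \<Rightarrow> 'a arg" where
  "lie_arg M D (Vec Y) = Vec (lie_bracket D Y)"
| "lie_arg M D (Form \<alpha>) =
    Form (\<lambda>Y x. if Y \<in> vector_fields M then D (\<alpha> Y) x - \<alpha> (lie_bracket D Y) x else 0)"

definition lie_derivative :: "'a manifold \<Rightarrow> 'a vfield \<Rightarrow> 'a tensor \<Rightarrow> 'a tensor" where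
  "lie_derivative M D T = Tensor (sig T)
    (\<lambda>as x. if args_ok M (sig T) as
      then D (app T as) x - (\<Sum>i<length as. app T (as[i := lie_arg M D (as ! i)]) x)
      else 0)"

section \<open>The bundle of \<open>r\<close>-jets of curves\<close>

definition smooth_curve :: "'a manifold \<Rightarrow> (real \<Rightarrow> 'a) \<Rightarrow> bool" where
  "smooth_curve M \<gamma> \<longleftrightarrow>
    continuous_map euclideanreal (mtop M) \<gamma> \<and>
    (\<forall>(U, \<phi>)\<in>matlas M. \<forall>i<mdim M. \<forall>t k. \<gamma> t \<in> U \<longrightarrow>
      ((deriv ^^ k) (\<lambda>s. \<phi> (\<gamma> s) i)) differentiable (at t))"

definition jet_equiv :: "'a manifold \<Rightarrow> nat \<Rightarrow> (real \<Rightarrow> 'a) \<Rightarrow> (real \<Rightarrow> 'a) \<Rightarrow> bool" where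
  "jet_equiv M r \<gamma> \<eta> \<longleftrightarrow>
    \<gamma> 0 = \<eta> 0 \<and>
    (\<forall>(U, \<phi>)\<in>matlas M. \<gamma> 0 \<in> U \<longrightarrow> (\<forall>i<mdim M. \<forall>k\<le>r.
      (deriv ^^ k) (\<lambda>t. \<phi> (\<gamma> t) i) 0 = (deriv ^^ k) (\<lambda>t. \<phi> (\<eta> t) i) 0))"

type_synonym 'a jet = "(real \<Rightarrow> 'a) set"

definition jet_of :: "'a manifold \<Rightarrow> nat \<Rightarrow> (real \<Rightarrow> 'a) \<Rightarrow> 'a jet" where
  "jet_of M r \<gamma> = {\<eta>. smooth_curve M \<eta> \<and> jet_equiv M r \<gamma> \<eta>}"

definition jets :: "'a manifold \<Rightarrow> nat \<Rightarrow> 'a jet set" where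
  "jets M r = jet_of M r ` {\<gamma>. smooth_curve M \<gamma>}"

definition jet_rep :: "'a jet \<Rightarrow> real \<Rightarrow> 'a" where
  "jet_rep j = (SOME \<gamma>. \<gamma> \<in> j)"

text \<open>
  The chart of the jet bundle induced by the chart \<open>(U, \<phi>)\<close>: the coordinate \<open>x\<^sup>i\<^sub>\<mu>\<close>, which is the
  \<open>\<mu>\<close>-th derivative divided by \<open>\<mu>!\<close> (as for the lifts of functions below), sits at position
  \<open>\<mu> * n + i\<close>, where \<open>n\<close> is the dimension of \<open>M\<close>.
\<close>

definition jet_chart :: "'a manifold \<Rightarrow> nat \<Rightarrow> 'a chart \<Rightarrow> 'a jet chart" where
  "jet_chart M r = (\<lambda>(U, \<phi>).
    ({j \<in> jets M r. jet_rep j 0 \<in> U},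
     \<lambda>j k. if k < mdim M * Suc r
       then (deriv ^^ (k div mdim M)) (\<lambda>t. \<phi> (jet_rep j t) (k mod mdim M)) 0 / fact (k div mdim M)
       else 0))"

definition jet_bundle :: "'a manifold \<Rightarrow> nat \<Rightarrow> 'a jet manifold" where
  "jet_bundle M r =
    \<lparr>mtop = topology_generated_by
       {{j \<in> V. \<Phi> j \<in> W} | V \<Phi> W.
         (V, \<Phi>) \<in> jet_chart M r ` matlas M \<and> openin (Euclidean_space (mdim M * Suc r)) W},
     mdim = mdim M * Suc r,
     matlas = jet_chart M r ` matlas M\<rparr>"

text \<open>
  The weight vector field \<open>\<Sum>\<^sub>i \<Sum>\<^sub>\<mu> \<mu> x\<^sup>i\<^sub>\<mu> \<partial>/\<partial>x\<^sup>i\<^sub>\<mu>\<close> of the canonical homogeneity structure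
  \<open>h\<^sub>s [\<gamma>] = [t \<mapsto> \<gamma> (s t)]\<close>, which acts on the coordinates by \<open>x\<^sup>i\<^sub>\<mu> \<mapsto> s\<^sup>\<mu> x\<^sup>i\<^sub>\<mu>\<close>. The value at \<open>j\<close> does
  not depend on the induced chart around \<open>j\<close> that is chosen.
\<close>

definition weight_field :: "'a manifold \<Rightarrow> nat \<Rightarrow> 'a jet vfield" where
  "weight_field M r = (\<lambda>F j.
    if F \<in> smooth_functions (jet_bundle M r) \<and> j \<in> points (jet_bundle M r)
    then let (V, \<Phi>) = (SOME c. c \<in> matlas (jet_bundle M r) \<and> j \<in> fst c) in
      \<Sum>i<mdim M. \<Sum>\<mu>=1..r. real \<mu> * \<Phi> j (\<mu> * mdim M + i) *
        partial_deriv (\<mu> * mdim M + i) (\<lambda>y. F (inv_into V \<Phi> y)) (\<Phi> j)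
    else 0)"

definition has_degree :: "'a manifold \<Rightarrow> nat \<Rightarrow> 'a jet tensor \<Rightarrow> real \<Rightarrow> bool" where
  "has_degree M r K w \<longleftrightarrow>
    lie_derivative (jet_bundle M r) (weight_field M r) K = tensor_scale w K"

section \<open>Lifts\<close>

definition fun_lift :: "'a manifold \<Rightarrow> nat \<Rightarrow> int \<Rightarrow> ('a \<Rightarrow> real) \<Rightarrow> 'a jet \<Rightarrow> real" where
  "fun_lift M r k f = (\<lambda>j.
    if 0 \<le> k \<and> k \<le> int r \<and> j \<in> points (jet_bundle M r)
    then (deriv ^^ nat k) (\<lambda>t. f (jet_rep j t)) 0 / fact (nat k) else 0)"

text \<open>
  \<open>is_lift M r L\<close> says that \<open>L k K\<close> is the \<open>k\<close>-lift of \<open>K\<close>, for all tensor fields \<open>K\<close> on \<open>M\<close> and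
  all integers \<open>k\<close>. The clauses determine \<open>L\<close> on tensor fields: the product rule with a function
  as a factor, applied to bump functions, makes \<open>L\<close> local.
\<close>

definition is_lift :: "'a manifold \<Rightarrow> nat \<Rightarrow> (int \<Rightarrow> 'a tensor \<Rightarrow> 'a jet tensor) \<Rightarrow> bool" where
  "is_lift M r L \<longleftrightarrow>
    (\<forall>k. \<forall>K\<in>tensor_fields M. L k K \<in> tensor_fields (jet_bundle M r) \<and> sig (L k K) = sig K) \<and>
    (\<forall>k. \<forall>K\<in>tensor_fields M. k < 0 \<or> k > int r \<longrightarrow> L k K = Tensor (sig K) (\<lambda>as x. 0)) \<and>
    (\<forall>k c. \<forall>K\<in>tensor_fields M. L k (tensor_scale c K) = tensor_scale c (L k K)) \<and>
    (\<forall>k. \<forall>K\<in>tensor_fields M. \<forall>K'\<in>tensor_fields M. sig K = sig K' \<longrightarrow>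
      L k (tensor_add K K') = tensor_add (L k K) (L k K')) \<and>
    (\<forall>k. \<forall>f\<in>smooth_functions M. L k (fun_tensor f) = fun_tensor (fun_lift M r k f)) \<and>
    (\<forall>k\<in>{0..int r}. \<forall>f\<in>smooth_functions M. \<forall>g\<in>smooth_functions M.
      L k (form_tensor (fdg M f g)) =
        tensor_sum [Cov]
          (\<lambda>m. form_tensor (fdg (jet_bundle M r) (fun_lift M r m f) (fun_lift M r (k - m) g)))
          {0..k}) \<and>
    (\<forall>k\<in>{0..int r}. \<forall>X\<in>vector_fields M. \<exists>Y\<in>vector_fields (jet_bundle M r).
      L k (vec_tensor M X) = vec_tensor (jet_bundle M r) Y \<and>
      (\<forall>f\<in>smooth_functions M. \<forall>m\<in>{0..int r}.
        Y (fun_lift M r m f) = fun_lift M r (k + m - int r) (X f))) \<and>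
    (\<forall>k\<in>{0..int r}. \<forall>T\<in>tensor_fields M. \<forall>S\<in>tensor_fields M.
      L k (tensor_prod T S) =
        tensor_sum (sig T @ sig S) (\<lambda>m. tensor_prod (L m T) (L (k - m) S)) {0..k})"

end

theory Submission
  imports Defs
begin

text \<open>
  Since \<open>F (h\<^sub>s j)\<close> can be differentiated in any induced chart, the weight vector field is
  \<open>\<Delta> F (j) = d/ds F (h\<^sub>s j)\<close> at \<open>s = 1\<close>; hence it does not depend on the chart, it is a derivation,
  and \<open>\<Delta> f\<^sup>(\<^sup>k\<^sup>) = k f\<^sup>(\<^sup>k\<^sup>)\<close> because \<open>f\<^sup>(\<^sup>k\<^sup>) (h\<^sub>s j) = s\<^sup>k f\<^sup>(\<^sup>k\<^sup>) (j)\<close>.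
  Consequently \<open>(f dg)\<^sup>(\<^sup>k\<^sup>)\<close> has degree \<open>k\<close>, and so has \<open>\<alpha>\<^sup>(\<^sup>k\<^sup>)\<close> for every one-form \<open>\<alpha>\<close>, because
  lifting is local and \<open>\<alpha>\<close> is locally a sum of forms \<open>f dg\<close>. For a vector field \<open>X\<close>, the derivation
  \<open>[\<Delta>, X\<^sup>(\<^sup>k\<^sup>)] - (k - r) X\<^sup>(\<^sup>k\<^sup>)\<close> annihilates all lifted functions, among them local coordinates,
  and therefore vanishes by Hadamard's lemma. Tensor products follow from the Leibniz rule, and
  permutations of factors from the commutativity of the product of the values of the factors.
\<close>

section \<open>Smooth functions of several variables\<close>

text \<open>\<open>L\<close> is known only through the clauses of \<open>is_lift\<close>, and vector
  fields are abstract derivations, so arguments in coordinates have to be run with globally defined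
  functions that agree with coordinates near a given point. On \<open>M\<close> such functions come
  from bump functions, and this is where the Hausdorff property enters. The jet bundle needs no bump
  functions of its own: the image of an induced chart is a cylinder over the image of the base
  chart, with whole fibres, so a bump function pulled back from \<open>M\<close> localizes enough,
  and star-shapedness is inherited from the base. The calculus of derivations and tensors is
  therefore developed for a bare atlas (\<open>smooth_atlas\<close>), of which \<open>M\<close> and
  the jet bundle are both instances.

  Degrees are tracked as an offset \<open>d\<close> in \<open>k + d\<close>, for all upper indices
  \<open>k\<close> at once: the product rule splits \<open>k\<close> into \<open>m\<close> and
  \<open>k - m\<close>, so offsets simply add. A one-form has offset 0 and a vector field offset
  \<open>- r\<close>.\<close>

definition rvec :: "nat \<Rightarrow> (nat \<Rightarrow> real) set" where
  "rvec n = {x. \<forall>i\<ge>n. x i = 0}"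

lemma topspace_Euclidean_rvec: "topspace (Euclidean_space n) = rvec n"
  by (simp add: topspace_Euclidean_space rvec_def)

lemma open_rvec: "openin (Euclidean_space n) (rvec n)"
  by (metis openin_topspace topspace_Euclidean_rvec)

lemma rvec_0: "x \<in> rvec n \<Longrightarrow> \<not> i < n \<Longrightarrow> x i = 0"
  by (simp add: rvec_def)

text \<open>Passes from the abstract topology to the type-class topology of
  \<open>nat \<Rightarrow> real\<close>, which makes \<open>continuous_on\<close> and its rules
  available.\<close>

lemma Euclidean_space_eq_top_of_set: "Euclidean_space n = top_of_set (rvec n)"
  by (simp add: Euclidean_space_def euclidean_product_topology rvec_def)

lemma openin_Euclidean_subset: "openin (Euclidean_space n) U \<Longrightarrow> U \<subseteq> rvec n"
  using openin_subset topspace_Euclidean_rvec by metis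

lemma rvec_upd: "x \<in> rvec n \<Longrightarrow> i < n \<Longrightarrow> x(i := t) \<in> rvec n"
  by (auto simp: rvec_def)

text \<open>On \<open>rvec n\<close> the coordinates from \<open>n\<close> on vanish, so only the
  first \<open>n\<close> factors of a basic open set matter, and one radius serves them all.\<close>

lemma openin_Euclidean_box:
  assumes "openin (Euclidean_space n) U" "p \<in> U"
  obtains d where "d > 0" "\<And>x. x \<in> rvec n \<Longrightarrow> (\<And>i. i < n \<Longrightarrow> \<bar>x i - p i\<bar> < d) \<Longrightarrow> x \<in> U"
proof -
  obtain S where S: "openin (powertop_real UNIV) S" "U = S \<inter> rvec n"
    using assms(1) unfolding Euclidean_space_def openin_subtopology rvec_def by blast
  have "p \<in> S" using S(2) assms(2) by simp
  from product_topology_open_contains_basis[OF S(1) this]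
  obtain X where X: "p \<in> Pi\<^sub>E UNIV X" "\<forall>i. openin euclideanreal (X i)" "Pi\<^sub>E UNIV X \<subseteq> S"
    by (elim exE conjE) (rule that)
  have "\<exists>e>0. \<forall>y. \<bar>y - p i\<bar> < e \<longrightarrow> y \<in> X i" for i
  proof -
    have "p i \<in> X i" by (rule PiE_mem[OF X(1)]) simp
    moreover have "open (X i)" using X(2) by simp
    ultimately
    show ?thesis
      by (metis dist_real_def open_dist)
  qed
  then obtain e where e: "\<And>i. e i > 0" "\<And>i y. \<bar>y - p i\<bar> < e i \<Longrightarrow> y \<in> X i" by metis
  \<comment> \<open>The 1 keeps the set nonempty for \<open>n = 0\<close>.\<close>
  define d where "d = Min (insert 1 (e ` {..<n}))"
  have d: "d > 0" "\<And>i. i < n \<Longrightarrow> d \<le> e i"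
    using e(1) by (auto simp: d_def)
  have "x \<in> U" if x: "x \<in> rvec n" "\<And>i. i < n \<Longrightarrow> \<bar>x i - p i\<bar> < d" for x
  proof -
    have "x i \<in> X i" for i
    proof (cases "i < n")
      case True
      then show ?thesis using e(2) d(2) x(2) by (meson less_le_trans)
    next
      case False
      then have "x i = 0" "p i = 0" using x(1) assms(2) S(2) by (auto intro: rvec_0)
      then show ?thesis using e by simp
    qed
    then have "x \<in> Pi\<^sub>E UNIV X" by auto
    then show ?thesis using X(3) S(2) x(1) by auto
  qed
  then show ?thesis using that d(1) by blast
qed

lemma openin_Euclidean_Collect:
  assumes "openin (Euclidean_space n) U" "continuous_on U f" "open T"
  shows "openin (Euclidean_space n) {x \<in> U. f x \<in> T}"
proof -
  have "openin (top_of_set U) (U \<inter> f -` T)"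
    by (rule continuous_openin_preimage_gen[OF assms(2,3)])
  then have "openin (Euclidean_space n) (U \<inter> f -` T)"
    using assms(1) unfolding Euclidean_space_eq_top_of_set by (rule openin_trans)
  also have "U \<inter> f -` T = {x \<in> U. f x \<in> T}" by auto
  finally show ?thesis .
qed

lemma continuous_on_coord: "continuous_on U (\<lambda>x::nat \<Rightarrow> real. x i)"
  by (rule continuous_on_subset[OF continuous_on_product_coordinates]) simp

lemma continuous_on_rvec:
  assumes "\<And>i. i < m \<Longrightarrow> continuous_on U (\<lambda>x. h x i)" "\<And>x. x \<in> U \<Longrightarrow> h x \<in> rvec m"
  shows "continuous_on U h"
proof (rule continuous_on_coordinatewise_then_product)
  show "continuous_on U (\<lambda>x. h x i)" for i
  proof (cases "i < m")
    case True then show ?thesis by (rule assms(1))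
  next
    case False
    have "h x i = 0" if "x \<in> U" for x using rvec_0[OF assms(2)[OF that] False] .
    then show ?thesis by (subst continuous_on_cong[OF refl, where g = "\<lambda>x. 0"]) auto
  qed
qed

lemma openin_Euclidean_finite_Collect:
  assumes "openin (Euclidean_space n) U" "\<And>i. i < (m::nat) \<Longrightarrow> openin (Euclidean_space n) {x \<in> U. P i x}"
  shows "openin (Euclidean_space n) {x \<in> U. \<forall>i<m. P i x}"
  using assms(2)
proof (induction m)
  case 0
  then show ?case using assms(1) by simp
next
  case (Suc m)
  have "{x \<in> U. \<forall>i<Suc m. P i x} = {x \<in> U. \<forall>i<m. P i x} \<inter> {x \<in> U. P m x}"
    by (auto simp: less_Suc_eq)
  moreover have "openin (Euclidean_space n) ({x \<in> U. \<forall>i<m. P i x} \<inter> {x \<in> U. P m x})"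
    using Suc by (intro openin_Int) auto
  ultimately show ?case by simp
qed

lemma eventually_in_open:
  assumes "openin (Euclidean_space n) U" "p \<in> U" "eventually (\<lambda>t. c t \<in> rvec n) F"
    and "\<And>i. i < n \<Longrightarrow> ((\<lambda>t. c t i) \<longlongrightarrow> p i) F"
  shows "eventually (\<lambda>t. c t \<in> U) F"
proof -
  obtain d where d: "d > 0" "\<And>x. x \<in> rvec n \<Longrightarrow> (\<And>i. i < n \<Longrightarrow> \<bar>x i - p i\<bar> < d) \<Longrightarrow> x \<in> U"
    using openin_Euclidean_box assms(1,2) by blast
  have "eventually (\<lambda>t. \<bar>c t i - p i\<bar> < d) F" if "i < n" for i
    using tendstoD[OF assms(4)[OF that] d(1)] by (simp add: dist_real_def)
  then have "eventually (\<lambda>t. \<forall>i\<in>{..<n}. \<bar>c t i - p i\<bar> < d) F"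
    by (intro eventually_ball_finite) auto
  with assms(3) show ?thesis
    by eventually_elim (auto intro!: d(2))
qed

lemma eventually_upd_in_open:
  assumes "openin (Euclidean_space n) U" "x \<in> U" "i < n"
  shows "eventually (\<lambda>t. x(i := t) \<in> U) (nhds (x i))"
proof (rule eventually_in_open[OF assms(1,2)])
  show "eventually (\<lambda>t. x(i := t) \<in> rvec n) (nhds (x i))"
    using assms(2,3) openin_Euclidean_subset[OF assms(1)] by (intro always_eventually allI rvec_upd) auto
  show "((\<lambda>t. (x(i := t)) j) \<longlongrightarrow> x j) (nhds (x i))" for j
    by (cases "j = i") (auto simp: filterlim_ident)
qed

section \<open>Smoothness as stability under partial differentiation\<close>

definition part_diff :: "nat \<Rightarrow> (nat \<Rightarrow> real) set \<Rightarrow> ((nat \<Rightarrow> real) \<Rightarrow> real) \<Rightarrow> bool" where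
  "part_diff n U f \<longleftrightarrow> continuous_on U f \<and>
    (\<forall>x\<in>U. \<forall>i<n. (\<lambda>t. f (x(i := t))) differentiable (at (x i)))"

text \<open>Splits \<open>smooth_on\<close> into one condition per iterated derivative, the form in
  which smoothness can be proved by coinduction.\<close>

lemma smooth_on_iff_part_diff:
  assumes "openin (Euclidean_space n) U"
  shows "smooth_on n U f \<longleftrightarrow>
    (\<forall>is. set is \<subseteq> {..<n} \<longrightarrow> part_diff n U (foldr partial_deriv is f))"
proof -
  have "subtopology (Euclidean_space n) U = top_of_set U"
    using openin_Euclidean_subset[OF assms]
    by (simp add: Euclidean_space_eq_top_of_set subtopology_subtopology Int_absorb1)
  then show ?thesis unfolding smooth_on_def part_diff_def by simp
qed

lemma part_diff_DERIV:
  assumes "part_diff n U f" "x \<in> U" "i < n"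
  shows "((\<lambda>t. f (x(i := t))) has_real_derivative partial_deriv i f x) (at (x i))"
  using assms unfolding part_diff_def partial_deriv_def
  by (metis DERIV_deriv_iff_real_differentiable)

text \<open>For \<open>t\<close> near \<open>x i\<close> the point \<open>x(i := t)\<close> stays in
  the open set \<open>U\<close>, so values outside \<open>U\<close>, where chart expressions are
  arbitrary, never matter.\<close>

lemma part_diff_cong:
  assumes "openin (Euclidean_space n) U" "\<And>x. x \<in> U \<Longrightarrow> f x = g x" "part_diff n U f"
  shows "part_diff n U g"
proof -
  have "(\<lambda>t. g (x(i := t))) differentiable (at (x i))" if "x \<in> U" "i < n" for x i
  proof -
    have "((\<lambda>t. f (x(i := t))) has_real_derivative partial_deriv i f x) (at (x i))"
      using part_diff_DERIV assms(3) that by blast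
    moreover have "\<forall>\<^sub>F t in nhds (x i). f (x(i := t)) = g (x(i := t))"
      using eventually_upd_in_open[OF assms(1) that] by eventually_elim (simp add: assms(2))
    ultimately have "((\<lambda>t. g (x(i := t))) has_real_derivative partial_deriv i f x) (at (x i))"
      using DERIV_cong_ev[OF refl _ refl] by metis
    then show ?thesis by (auto simp: real_differentiable_def)
  qed
  moreover have "continuous_on U g"
    using assms(2,3) continuous_on_cong[of U U f g] unfolding part_diff_def by blast
  ultimately show ?thesis unfolding part_diff_def by blast
qed

lemma partial_deriv_cong:
  assumes "openin (Euclidean_space n) U" "\<And>x. x \<in> U \<Longrightarrow> f x = g x" "x \<in> U" "i < n"
  shows "partial_deriv i f x = partial_deriv i g x"
  unfolding partial_deriv_def
proof (rule deriv_cong_ev)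
  show "\<forall>\<^sub>F t in nhds (x i). f (x(i := t)) = g (x(i := t))"
    using eventually_upd_in_open[OF assms(1,3,4)] by eventually_elim (simp add: assms(2))
qed simp

text \<open>\<open>F\<close> is stable under partial derivatives up to equality on \<open>U\<close>,
  so every iterated derivative agrees on \<open>U\<close> with a member of \<open>F\<close>.
  Equality is asked on \<open>U\<close> only, because formulas for derivatives hold only
  there.\<close>

lemma smooth_on_coinduct:
  assumes U: "openin (Euclidean_space n) U" and f: "f \<in> F"
    and pd: "\<And>f. f \<in> F \<Longrightarrow> part_diff n U f"
    and step: "\<And>f i. f \<in> F \<Longrightarrow> i < n \<Longrightarrow> \<exists>g\<in>F. \<forall>x\<in>U. partial_deriv i f x = g x"
  shows "smooth_on n U f"
proof -
  have "\<exists>g\<in>F. \<forall>x\<in>U. foldr partial_deriv is f x = g x" if "set is \<subseteq> {..<n}" for "is"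
    using that
  proof (induction "is")
    case Nil
    then show ?case using f by auto
  next
    case (Cons i "is")
    then obtain g where g: "g \<in> F" "\<And>x. x \<in> U \<Longrightarrow> foldr partial_deriv is f x = g x" by auto
    obtain h where "h \<in> F" "\<And>x. x \<in> U \<Longrightarrow> partial_deriv i g x = h x"
      using step[OF g(1), of i] Cons.prems by auto
    moreover have "partial_deriv i (foldr partial_deriv is f) x = partial_deriv i g x" if "x \<in> U" for x
      using partial_deriv_cong[OF U g(2) that] Cons.prems by simp
    ultimately show ?case by auto
  qed
  then show ?thesis
    unfolding smooth_on_iff_part_diff[OF U] by (metis pd part_diff_cong[OF U])
qed

lemma smooth_on_part_diff:
  assumes "openin (Euclidean_space n) U" "smooth_on n U f"
  shows "part_diff n U f"
  using assms(2) unfolding smooth_on_iff_part_diff[OF assms(1)]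
  by (metis empty_set empty_subsetI foldr.simps(1) id_apply)

lemma smooth_on_partial_deriv:
  assumes "openin (Euclidean_space n) U" "smooth_on n U f" "i < n"
  shows "smooth_on n U (partial_deriv i f)"
  unfolding smooth_on_iff_part_diff[OF assms(1)]
proof (intro allI impI)
  fix "is" assume "set is \<subseteq> {..<n}"
  \<comment> \<open>\<open>foldr\<close> applies the last index first, so differentiating by
    \<open>i\<close> beforehand means appending \<open>i\<close>.\<close>
  then have "part_diff n U (foldr partial_deriv (is @ [i]) f)"
    using assms(2,3) \<open>set is \<subseteq> {..<n}\<close> unfolding smooth_on_iff_part_diff[OF assms(1)]
    by (metis Un_least lessThan_iff set_append set_simps(1,2) insert_subset empty_subsetI)
  then show "part_diff n U (foldr partial_deriv is (partial_deriv i f))" by simp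
qed

lemma smooth_on_cong:
  assumes "openin (Euclidean_space n) U" "\<And>x. x \<in> U \<Longrightarrow> f x = g x" "smooth_on n U f"
  shows "smooth_on n U g"
proof (rule smooth_on_coinduct[where F = "{h. \<exists>f. smooth_on n U f \<and> (\<forall>x\<in>U. f x = h x)}"])
  show "part_diff n U h" if "h \<in> {h. \<exists>f. smooth_on n U f \<and> (\<forall>x\<in>U. f x = h x)}" for h
    using that part_diff_cong[OF assms(1)] smooth_on_part_diff[OF assms(1)] by blast
  show "\<exists>g\<in>{h. \<exists>f. smooth_on n U f \<and> (\<forall>x\<in>U. f x = h x)}. \<forall>x\<in>U. partial_deriv i h x = g x"
    if h: "h \<in> {h. \<exists>f. smooth_on n U f \<and> (\<forall>x\<in>U. f x = h x)}" and i: "i < n" for h i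
  proof -
    obtain f where f: "smooth_on n U f" "\<forall>x\<in>U. f x = h x" using h by blast
    have "smooth_on n U (partial_deriv i f)"
      using smooth_on_partial_deriv[OF assms(1) f(1) i] .
    moreover have "\<forall>x\<in>U. partial_deriv i f x = partial_deriv i h x"
      using partial_deriv_cong[OF assms(1) _ _ i] f(2) by metis
    ultimately show ?thesis by blast
  qed
qed (use assms in auto)

lemma smooth_on_continuous: "openin (Euclidean_space n) U \<Longrightarrow> smooth_on n U f \<Longrightarrow> continuous_on U f"
  using smooth_on_part_diff part_diff_def by blast

lemma part_diff_const: "part_diff n U (\<lambda>x. c)"
  by (simp add: part_diff_def)

lemma part_diff_add: "part_diff n U f \<Longrightarrow> part_diff n U g \<Longrightarrow> part_diff n U (\<lambda>x. f x + g x)"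
  unfolding part_diff_def by (auto intro!: continuous_intros derivative_intros)

lemma part_diff_mult: "part_diff n U f \<Longrightarrow> part_diff n U g \<Longrightarrow> part_diff n U (\<lambda>x. f x * g x)"
  unfolding part_diff_def by (auto intro!: continuous_intros derivative_intros)

lemma partial_deriv_const [simp]: "partial_deriv i (\<lambda>x. c) = (\<lambda>x. 0)"
  by (simp add: partial_deriv_def fun_eq_iff)

lemma partial_deriv_add:
  assumes "part_diff n U f" "part_diff n U g" "x \<in> U" "i < n"
  shows "partial_deriv i (\<lambda>x. f x + g x) x = partial_deriv i f x + partial_deriv i g x"
proof -
  have "((\<lambda>t. f (x(i := t)) + g (x(i := t))) has_real_derivative
      partial_deriv i f x + partial_deriv i g x) (at (x i))"
    using assms by (intro derivative_intros part_diff_DERIV[where n=n and U=U])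
  then show ?thesis unfolding partial_deriv_def by (simp add: DERIV_imp_deriv)
qed

lemma partial_deriv_mult:
  assumes "part_diff n U f" "part_diff n U g" "x \<in> U" "i < n"
  shows "partial_deriv i (\<lambda>x. f x * g x) x = partial_deriv i f x * g x + f x * partial_deriv i g x"
proof -
  have "((\<lambda>t. f (x(i := t)) * g (x(i := t))) has_real_derivative
      partial_deriv i f x * g (x(i := x i)) + partial_deriv i g x * f (x(i := x i))) (at (x i))"
    using assms by (intro DERIV_mult part_diff_DERIV[where n=n and U=U])
  then show ?thesis unfolding partial_deriv_def by (simp add: DERIV_imp_deriv mult.commute)
qed

text \<open>The algebra of polynomials, with real coefficients, in the functions of
  \<open>B\<close>.\<close>

inductive_set poly_closure :: "((nat \<Rightarrow> real) \<Rightarrow> real) set \<Rightarrow> ((nat \<Rightarrow> real) \<Rightarrow> real) set"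
  for B where
  base: "f \<in> B \<Longrightarrow> f \<in> poly_closure B"
| const: "(\<lambda>x. c) \<in> poly_closure B"
| add: "f \<in> poly_closure B \<Longrightarrow> g \<in> poly_closure B \<Longrightarrow> (\<lambda>x. f x + g x) \<in> poly_closure B"
| mult: "f \<in> poly_closure B \<Longrightarrow> g \<in> poly_closure B \<Longrightarrow> (\<lambda>x. f x * g x) \<in> poly_closure B"

lemma poly_closure_sum:
  "finite I \<Longrightarrow> (\<And>i. i \<in> I \<Longrightarrow> f i \<in> poly_closure B) \<Longrightarrow> (\<lambda>x. \<Sum>i\<in>I. f i x) \<in> poly_closure B"
  by (induction I rule: finite_induct) (auto intro: poly_closure.const poly_closure.add)

text \<open>With a suitable set \<open>B\<close> of generators this replaces, for products, compositions, reciprocals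
  and the like, an induction on the order of differentiation.\<close>

lemma smooth_on_poly_closure:
  assumes U: "openin (Euclidean_space n) U"
    and pd: "\<And>b. b \<in> B \<Longrightarrow> part_diff n U b"
    and step: "\<And>b i. b \<in> B \<Longrightarrow> i < n \<Longrightarrow> \<exists>g\<in>poly_closure B. \<forall>x\<in>U. partial_deriv i b x = g x"
    and f: "f \<in> poly_closure B"
  shows "smooth_on n U f"
proof (rule smooth_on_coinduct[OF U f])
  show pd': "part_diff n U f" if "f \<in> poly_closure B" for f
    using that by induction (auto intro: pd part_diff_const part_diff_add part_diff_mult)
  show "\<exists>g\<in>poly_closure B. \<forall>x\<in>U. partial_deriv i f x = g x" if "f \<in> poly_closure B" "i < n" for f i
    using that
  proof (induction)
    case (base f)
    then show ?case using step by blast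
  next
    case (const c)
    then show ?case using poly_closure.const[of 0] by auto
  next
    case (add f g)
    then obtain f' g' where "f' \<in> poly_closure B" "g' \<in> poly_closure B"
      "\<forall>x\<in>U. partial_deriv i f x = f' x" "\<forall>x\<in>U. partial_deriv i g x = g' x" by blast
    then show ?case
      using partial_deriv_add[OF pd' pd'] add.hyps add.prems
      by (intro bexI[of _ "\<lambda>x. f' x + g' x"]) (auto intro: poly_closure.add)
  next
    case (mult f g)
    then obtain f' g' where "f' \<in> poly_closure B" "g' \<in> poly_closure B"
      "\<forall>x\<in>U. partial_deriv i f x = f' x" "\<forall>x\<in>U. partial_deriv i g x = g' x" by blast
    then show ?case
      using partial_deriv_mult[OF pd' pd'] mult.hyps mult.prems
      by (intro bexI[of _ "\<lambda>x. f' x * g x + f x * g' x"])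
        (auto intro: poly_closure.add poly_closure.mult)
  qed
qed

lemma smooth_on_poly_closure_smooth:
  assumes "openin (Euclidean_space n) U" "f \<in> poly_closure {f. smooth_on n U f}"
  shows "smooth_on n U f"
proof (rule smooth_on_poly_closure[OF assms(1) _ _ assms(2)])
  show "\<exists>g\<in>poly_closure {f. smooth_on n U f}. \<forall>x\<in>U. partial_deriv i b x = g x"
    if "b \<in> {f. smooth_on n U f}" "i < n" for b i
    using smooth_on_partial_deriv[OF assms(1)] that by (blast intro: poly_closure.base)
qed (use smooth_on_part_diff[OF assms(1)] in blast)

section \<open>Closure properties of smooth functions on an open set\<close>

context
  fixes n U assumes U: "openin (Euclidean_space n) U"
begin

lemma smooth_on_const: "smooth_on n U (\<lambda>x. c)"
  using smooth_on_poly_closure_smooth[OF U] poly_closure.const by blast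

lemma smooth_on_add: "smooth_on n U f \<Longrightarrow> smooth_on n U g \<Longrightarrow> smooth_on n U (\<lambda>x. f x + g x)"
  by (rule smooth_on_poly_closure_smooth[OF U])
    (auto intro: poly_closure.base poly_closure.add)

lemma smooth_on_mult: "smooth_on n U f \<Longrightarrow> smooth_on n U g \<Longrightarrow> smooth_on n U (\<lambda>x. f x * g x)"
  by (rule smooth_on_poly_closure_smooth[OF U])
    (auto intro: poly_closure.base poly_closure.mult)

lemma smooth_on_sum:
  "finite I \<Longrightarrow> (\<And>i. i \<in> I \<Longrightarrow> smooth_on n U (f i)) \<Longrightarrow> smooth_on n U (\<lambda>x. \<Sum>i\<in>I. f i x)"
  by (induction I rule: finite_induct) (auto intro: smooth_on_const smooth_on_add)

lemma smooth_on_prod: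
  "finite I \<Longrightarrow> (\<And>i. i \<in> I \<Longrightarrow> smooth_on n U (f i)) \<Longrightarrow> smooth_on n U (\<lambda>x. \<Prod>i\<in>I. f i x)"
  by (induction I rule: finite_induct) (auto intro: smooth_on_const smooth_on_mult)

lemma smooth_on_minus: "smooth_on n U f \<Longrightarrow> smooth_on n U (\<lambda>x. - f x)"
  using smooth_on_mult[OF smooth_on_const[of "-1"], of f] by simp

lemma smooth_on_diff: "smooth_on n U f \<Longrightarrow> smooth_on n U g \<Longrightarrow> smooth_on n U (\<lambda>x. f x - g x)"
  using smooth_on_add[of f, OF _ smooth_on_minus, of g] by simp

lemma smooth_on_power: "smooth_on n U f \<Longrightarrow> smooth_on n U (\<lambda>x. f x ^ m)"
  by (induction m) (auto intro: smooth_on_const smooth_on_mult)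

lemma partial_deriv_coord: "partial_deriv i (\<lambda>x. x j) x = (if i = j then 1 else 0)"
  by (simp add: partial_deriv_def)

lemma smooth_on_coord: "smooth_on n U (\<lambda>x. x j)"
proof (rule smooth_on_poly_closure[OF U, where B = "{\<lambda>x. x j}"])
  have "(\<lambda>t. (x(i := t)) j) differentiable (at (x i))" for x :: "nat \<Rightarrow> real" and i
    by (cases "i = j") auto
  then show "part_diff n U b" if "b \<in> {\<lambda>x. x j}" for b
    using that by (simp add: part_diff_def continuous_on_coord del: fun_upd_apply)
  show "\<exists>g\<in>poly_closure {\<lambda>x. x j}. \<forall>x\<in>U. partial_deriv i b x = g x" if "b \<in> {\<lambda>x. x j}" for b i
    using that poly_closure.const
    by (intro bexI[of _ "\<lambda>x. if i = j then 1 else 0"]) (auto simp: partial_deriv_coord)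
qed (auto intro: poly_closure.base)

lemma partial_deriv_inverse:
  assumes "part_diff n U f" "x \<in> U" "f x \<noteq> 0" "i < n"
  shows "((\<lambda>t. inverse (f (x(i := t)))) has_real_derivative
    - (partial_deriv i f x * inverse (f x) * inverse (f x))) (at (x i))"
proof -
  have "((\<lambda>t. inverse (f (x(i := t)))) has_real_derivative
      - (inverse (f (x(i := x i))) * partial_deriv i f x * inverse (f (x(i := x i))))) (at (x i))"
    using assms by (intro DERIV_inverse' part_diff_DERIV) auto
  then show ?thesis by (simp add: mult_ac)
qed

text \<open>With \<open>1/f\<close> as the only new generator beside the smooth functions, its
  derivative \<open>- f' (1/f)^2\<close> is again a polynomial in the generators.\<close>

lemma smooth_on_inverse:
  assumes f: "smooth_on n U f" "\<And>x. x \<in> U \<Longrightarrow> f x \<noteq> 0"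
  shows "smooth_on n U (\<lambda>x. inverse (f x))"
proof (rule smooth_on_poly_closure[OF U, where B = "insert (\<lambda>x. inverse (f x)) {g. smooth_on n U g}"])
  let ?B = "insert (\<lambda>x. inverse (f x)) {g. smooth_on n U g}"
  have inv: "((\<lambda>t. inverse (f (x(i := t)))) has_real_derivative
    - (partial_deriv i f x * inverse (f x) * inverse (f x))) (at (x i))" if "x \<in> U" "i < n" for x i
    using that assms by (intro partial_deriv_inverse smooth_on_part_diff[OF U]) auto
  have "part_diff n U (\<lambda>x. inverse (f x))"
    using f smooth_on_continuous[OF U f(1)] inv
    unfolding part_diff_def by (auto intro!: continuous_intros simp: real_differentiable_def)
  then show "part_diff n U b" if "b \<in> ?B" for b
    using that smooth_on_part_diff[OF U] by auto
  show "\<exists>g\<in>poly_closure ?B. \<forall>x\<in>U. partial_deriv i b x = g x" if "b \<in> ?B" "i < n" for b i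
  proof (cases "smooth_on n U b")
    case True
    then show ?thesis using smooth_on_partial_deriv[OF U True that(2)] by (auto intro: poly_closure.base)
  next
    case False
    then have b: "b = (\<lambda>x. inverse (f x))" using that by auto
    have "partial_deriv i f \<in> ?B" using smooth_on_partial_deriv[OF U f(1) that(2)] by auto
    then have "(\<lambda>x. (-1) * (partial_deriv i f x * inverse (f x) * inverse (f x))) \<in> poly_closure ?B"
      by (intro poly_closure.mult poly_closure.const) (auto intro: poly_closure.base)
    then show ?thesis
      using inv that(2) unfolding b
      by (intro bexI[of _ "\<lambda>x. (-1) * (partial_deriv i f x * inverse (f x) * inverse (f x))"])
        (auto simp: partial_deriv_def intro!: DERIV_imp_deriv)
  qed
qed (auto intro: poly_closure.base)

end

lemma smooth_on_subset:
  assumes "openin (Euclidean_space n) U" "openin (Euclidean_space n) V" "V \<subseteq> U" "smooth_on n U f"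
  shows "smooth_on n V f"
  using assms(4) smooth_on_iff_part_diff[OF assms(1)] smooth_on_iff_part_diff[OF assms(2)] assms(3)
  unfolding part_diff_def by (meson continuous_on_subset subsetD)

text \<open>Partial differentiability is a pointwise matter, so it is continuity that has to be
  glued from the neighbourhoods \<open>V p\<close>.\<close>

lemma smooth_on_local:
  assumes U: "openin (Euclidean_space n) U"
    and loc: "\<And>p. p \<in> U \<Longrightarrow> \<exists>V g. openin (Euclidean_space n) V \<and> p \<in> V \<and> smooth_on n V g \<and> (\<forall>x\<in>V. f x = g x)"
  shows "smooth_on n U f"
  unfolding smooth_on_iff_part_diff[OF U]
proof (intro allI impI)
  fix "is" assume "is": "set is \<subseteq> {..<n}"
  have *: "\<exists>V. openin (Euclidean_space n) V \<and> p \<in> V \<and> part_diff n V (foldr partial_deriv is f)" if "p \<in> U" for p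
  proof -
    obtain V g where V: "openin (Euclidean_space n) V" "p \<in> V" "smooth_on n V g" "\<forall>x\<in>V. f x = g x"
      using loc \<open>p \<in> U\<close> by blast
    then have "smooth_on n V f" using smooth_on_cong by (metis (no_types, lifting))
    then show ?thesis using V "is" smooth_on_iff_part_diff[OF V(1)] by blast
  qed
  then obtain V where V: "\<And>p. p \<in> U \<Longrightarrow> openin (Euclidean_space n) (V p)" "\<And>p. p \<in> U \<Longrightarrow> p \<in> V p"
    "\<And>p. p \<in> U \<Longrightarrow> part_diff n (V p) (foldr partial_deriv is f)" by metis
  have "continuous_on U (foldr partial_deriv is f)"
    unfolding continuous_on_eq_continuous_within
  proof
    fix p assume p: "p \<in> U"
    obtain S where S: "open S" "V p = rvec n \<inter> S"
      using V(1)[OF p] unfolding Euclidean_space_eq_top_of_set openin_open by blast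
    \<comment> \<open>\<open>U\<close> lies in \<open>rvec n\<close>, so inside the open set
      \<open>S\<close> the sets \<open>U\<close> and \<open>U \<inter> V p\<close> coincide.\<close>
    have "at p within U = at p within U \<inter> V p"
      by (rule at_within_nhd[of _ "S"]) (use S openin_Euclidean_subset[OF U] V(2)[OF p] in auto)
    moreover have "continuous_on (U \<inter> V p) (foldr partial_deriv is f)"
      using V(3)[OF p] unfolding part_diff_def by (meson Int_lower2 continuous_on_subset)
    ultimately show "continuous (at p within U) (foldr partial_deriv is f)"
      using p V(2)[OF p] unfolding continuous_on_eq_continuous_within by simp
  qed
  then show "part_diff n U (foldr partial_deriv is f)"
    using V unfolding part_diff_def by metis
qed

section \<open>Chain rule, plateau functions and Hadamard's lemma\<close>

text \<open>Continuous partial derivatives imply total differentiability: walk from \<open>p\<close>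
  to \<open>x\<close> parallel to the axes and apply the mean value inequality on each segment. The
  telescoping sum yields an error in the l1 norm.\<close>

lemma partial_derivs_linear_approx:
  assumes U: "openin (Euclidean_space n) U" and G: "part_diff n U G"
    and cont: "\<And>i. i < n \<Longrightarrow> continuous_on U (partial_deriv i G)"
    and p: "p \<in> U" and e: "e > 0"
  obtains d where "d > 0"
    "\<And>x. x \<in> rvec n \<Longrightarrow> (\<And>i. i < n \<Longrightarrow> \<bar>x i - p i\<bar> < d) \<Longrightarrow>
      \<bar>G x - G p - (\<Sum>i<n. partial_deriv i G p * (x i - p i))\<bar> \<le> e * (\<Sum>i<n. \<bar>x i - p i\<bar>)"
proof -
  define V where "V = {x \<in> U. \<forall>i<n. partial_deriv i G x \<in> ball (partial_deriv i G p) e}"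
  have "openin (Euclidean_space n) V"
    unfolding V_def by (intro openin_Euclidean_finite_Collect U openin_Euclidean_Collect cont) auto
  moreover have "p \<in> V" using p e by (simp add: V_def)
  ultimately obtain d where d: "d > 0"
    "\<And>x. x \<in> rvec n \<Longrightarrow> (\<And>i. i < n \<Longrightarrow> \<bar>x i - p i\<bar> < d) \<Longrightarrow> x \<in> V"
    using openin_Euclidean_box by blast
  have "\<bar>G x - G p - (\<Sum>i<n. partial_deriv i G p * (x i - p i))\<bar> \<le> e * (\<Sum>i<n. \<bar>x i - p i\<bar>)"
    if x: "x \<in> rvec n" "\<And>i. i < n \<Longrightarrow> \<bar>x i - p i\<bar> < d" for x
  proof -
    \<comment> \<open>\<open>z k\<close> has the first \<open>k\<close> coordinates of
      \<open>x\<close> and the remaining ones of \<open>p\<close>, so consecutive points differ in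
      coordinate \<open>k\<close> only.\<close>
    define z where "z k = (\<lambda>i. if i < k then x i else p i)" for k :: nat
    have pn: "p \<in> rvec n" using p U openin_Euclidean_subset by blast
    have z0: "z 0 = p" by (simp add: z_def)
    have zn: "z n = x" using x(1) pn by (auto simp: z_def fun_eq_iff rvec_def)
    have step: "\<bar>G (z (Suc k)) - G (z k) - partial_deriv k G p * (x k - p k)\<bar> \<le> e * \<bar>x k - p k\<bar>"
      if k: "k < n" for k
    proof -
      let ?S = "closed_segment (p k) (x k)"
      have zV: "(z k)(k := t) \<in> V" if "t \<in> ?S" for t
      proof (rule d(2))
        show "(z k)(k := t) \<in> rvec n" using x(1) pn k by (auto simp: z_def rvec_def)
        have "\<bar>t - p k\<bar> \<le> \<bar>x k - p k\<bar>"
          using that by (auto simp: closed_segment_eq_real_ivl split: if_splits)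
        then show "\<bar>((z k)(k := t)) i - p i\<bar> < d" if "i < n" for i
          using x(2)[OF that] x(2)[OF k] d(1) by (auto simp: z_def)
      qed
      \<comment> \<open>Subtracting the linear part leaves a function whose derivative is the
        deviation of \<open>partial_deriv k G\<close> from its value at \<open>p\<close>, at most
        \<open>e\<close> on \<open>V\<close>.\<close>
      define h where "h t = G ((z k)(k := t)) - partial_deriv k G p * t" for t
      have "norm (h (x k) - h (p k)) \<le> e * norm (x k - p k)"
      proof (rule field_differentiable_bound[where S = ?S])
        fix t assume t: "t \<in> ?S"
        have "(z k)(k := t) \<in> U" using zV[OF t] by (simp add: V_def)
        then have "((\<lambda>s. G (((z k)(k := t))(k := s))) has_real_derivative
            partial_deriv k G ((z k)(k := t))) (at (((z k)(k := t)) k))"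
          using part_diff_DERIV[OF G] k by blast
        then have "(h has_real_derivative partial_deriv k G ((z k)(k := t)) - partial_deriv k G p) (at t)"
          unfolding h_def by (auto intro!: derivative_eq_intros)
        then show "(h has_real_derivative partial_deriv k G ((z k)(k := t)) - partial_deriv k G p) (at t within ?S)"
          by (rule has_field_derivative_at_within)
        show "norm (partial_deriv k G ((z k)(k := t)) - partial_deriv k G p) \<le> e"
          using zV[OF t] k by (auto simp: V_def dist_real_def abs_minus_commute)
      qed auto
      moreover have "(z k)(k := x k) = z (Suc k)" "(z k)(k := p k) = z k"
        by (auto simp: z_def fun_eq_iff)
      ultimately show ?thesis by (simp add: h_def algebra_simps)
    qed
    have "G x - G p = (\<Sum>k<n. G (z (Suc k)) - G (z k))"
      using sum_lessThan_telescope[of "\<lambda>k. G (z k)" n] by (simp add: z0 zn)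
    then have "\<bar>G x - G p - (\<Sum>i<n. partial_deriv i G p * (x i - p i))\<bar> =
        \<bar>\<Sum>k<n. G (z (Suc k)) - G (z k) - partial_deriv k G p * (x k - p k)\<bar>"
      by (simp add: sum_subtractf)
    also have "\<dots> \<le> (\<Sum>k<n. e * \<bar>x k - p k\<bar>)"
      by (rule order_trans[OF sum_abs sum_mono]) (use step in auto)
    finally show ?thesis by (simp add: sum_distrib_left)
  qed
  then show ?thesis using that d(1) by blast
qed

text \<open>Divide the linear approximation of \<open>G\<close> by \<open>t - t0\<close>: the
  remainder \<open>R\<close> tends to zero because the difference quotients \<open>q\<close> of the
  curve stay bounded.\<close>

lemma has_real_derivative_compose_partial:
  assumes U: "openin (Euclidean_space n) U" and G: "smooth_on n U G"
    and c: "eventually (\<lambda>t. c t \<in> rvec n) (nhds t0)" "c t0 \<in> U"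
    and c': "\<And>i. i < n \<Longrightarrow> ((\<lambda>t. c t i) has_real_derivative c' i) (at t0)"
  shows "((\<lambda>t. G (c t)) has_real_derivative (\<Sum>i<n. partial_deriv i G (c t0) * c' i)) (at t0)"
proof -
  let ?D = "\<Sum>i<n. partial_deriv i G (c t0) * c' i"
  define q where "q t i = (c t i - c t0 i) / (t - t0)" for t i
  have q: "((\<lambda>t. q t i) \<longlongrightarrow> c' i) (at t0)" if "i < n" for i
    using c'[OF that] by (simp add: q_def has_field_derivative_iff)
  define R where "R t = G (c t) - G (c t0) - (\<Sum>i<n. partial_deriv i G (c t0) * (c t i - c t0 i))" for t
  have R: "((\<lambda>t. R t / (t - t0)) \<longlongrightarrow> 0) (at t0)"
  proof (rule tendstoI)
    fix e :: real assume e: "e > 0"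
    \<comment> \<open>A strict bound for the l1 norm of the difference quotients near
      \<open>t0\<close>, so that the tolerance \<open>e / K\<close> leaves an error below
      \<open>e\<close>. The added 1 makes \<open>K\<close> positive and the bound strict.\<close>
    define K where "K = (\<Sum>i<n. \<bar>c' i\<bar>) + 1"
    have K: "K > 0" by (simp add: K_def add_nonneg_pos sum_nonneg)
    obtain d where d: "d > 0" "\<And>x. x \<in> rvec n \<Longrightarrow> (\<And>i. i < n \<Longrightarrow> \<bar>x i - c t0 i\<bar> < d) \<Longrightarrow>
      \<bar>G x - G (c t0) - (\<Sum>i<n. partial_deriv i G (c t0) * (x i - c t0 i))\<bar>
        \<le> e / K * (\<Sum>i<n. \<bar>x i - c t0 i\<bar>)"
      by (rule partial_derivs_linear_approx[OF U smooth_on_part_diff[OF U G] _ c(2), of "e / K"])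
        (use e K U G smooth_on_partial_deriv smooth_on_continuous in auto)
    have "((\<lambda>t. \<Sum>i<n. \<bar>q t i\<bar>) \<longlongrightarrow> (\<Sum>i<n. \<bar>c' i\<bar>)) (at t0)"
      using q by (intro tendsto_sum tendsto_rabs) auto
    then have ev1: "eventually (\<lambda>t. (\<Sum>i<n. \<bar>q t i\<bar>) < K) (at t0)"
      by (rule order_tendstoD) (simp add: K_def)
    have "((\<lambda>t. c t i) \<longlongrightarrow> c t0 i) (at t0)" if "i < n" for i
      using DERIV_isCont[OF c'[OF that]] by (simp add: isCont_def)
    then have "eventually (\<lambda>t. \<bar>c t i - c t0 i\<bar> < d) (at t0)" if "i < n" for i
      using tendstoD d(1) that by (fastforce simp: dist_real_def)
    then have ev2: "eventually (\<lambda>t. \<forall>i\<in>{..<n}. \<bar>c t i - c t0 i\<bar> < d) (at t0)"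
      by (intro eventually_ball_finite) auto
    have ev3: "eventually (\<lambda>t. c t \<in> rvec n) (at t0)" "eventually (\<lambda>t. t \<noteq> t0) (at t0)"
      using c(1) by (auto simp: eventually_at_filter elim: eventually_mono)
    from ev1 ev2 ev3 show "eventually (\<lambda>t. dist (R t / (t - t0)) 0 < e) (at t0)"
    proof eventually_elim
      case (elim t)
      have "\<bar>R t\<bar> \<le> e / K * (\<Sum>i<n. \<bar>c t i - c t0 i\<bar>)"
        unfolding R_def using elim by (intro d(2)) auto
      then have "\<bar>R t\<bar> / \<bar>t - t0\<bar> \<le> e / K * (\<Sum>i<n. \<bar>c t i - c t0 i\<bar>) / \<bar>t - t0\<bar>"
        by (intro divide_right_mono) auto
      also have "\<dots> = e / K * (\<Sum>i<n. \<bar>q t i\<bar>)"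
        by (simp add: q_def abs_divide flip: sum_divide_distrib)
      also have "\<dots> < e / K * K"
        using elim e K by (intro mult_strict_left_mono) auto
      finally show ?case using K by (simp add: dist_real_def abs_divide)
    qed
  qed
  have "((\<lambda>t. R t / (t - t0) + (\<Sum>i<n. partial_deriv i G (c t0) * q t i)) \<longlongrightarrow> 0 + ?D) (at t0)"
    using R q by (intro tendsto_add tendsto_sum tendsto_mult tendsto_const) auto
  moreover have "R t / (t - t0) + (\<Sum>i<n. partial_deriv i G (c t0) * q t i) = (G (c t) - G (c t0)) / (t - t0)" for t
  proof -
    have "(\<Sum>i<n. partial_deriv i G (c t0) * q t i) =
        (\<Sum>i<n. partial_deriv i G (c t0) * (c t i - c t0 i)) / (t - t0)"
      unfolding sum_divide_distrib by (rule sum.cong) (simp_all add: q_def)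
    then show ?thesis by (simp add: R_def diff_divide_distrib)
  qed
  ultimately show ?thesis by (simp add: has_field_derivative_iff)
qed

text \<open>The generators are all \<open>g \<circ> h\<close> with \<open>g\<close> smooth on
  \<open>W\<close>, together with the smooth functions on \<open>U\<close>. By the chain rule the
  derivative of \<open>g \<circ> h\<close> is a sum of products of generators.\<close>

lemma smooth_on_compose:
  assumes U: "openin (Euclidean_space n) U" and W: "openin (Euclidean_space m) W"
    and g: "smooth_on m W g" and h: "\<And>i. i < m \<Longrightarrow> smooth_on n U (\<lambda>x. h x i)"
    and hW: "\<And>x. x \<in> U \<Longrightarrow> h x \<in> W"
  shows "smooth_on n U (\<lambda>x. g (h x))"
proof (rule smooth_on_poly_closure[OF U])
  let ?B = "{\<lambda>x. g (h x) |g. smooth_on m W g} \<union> {f. smooth_on n U f}"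
  have ch: "continuous_on U h"
    by (rule continuous_on_rvec[OF smooth_on_continuous[OF U h]]) (use hW openin_Euclidean_subset[OF W] in auto)
  have D: "((\<lambda>t. g (h (x(j := t)))) has_real_derivative
      (\<Sum>i<m. partial_deriv i g (h x) * partial_deriv j (\<lambda>x. h x i) x)) (at (x j))"
    if "smooth_on m W g" "x \<in> U" "j < n" for g x j
  proof -
    have "((\<lambda>t. g (h (x(j := t)))) has_real_derivative
      (\<Sum>i<m. partial_deriv i g (h (x(j := x j))) * partial_deriv j (\<lambda>x. h x i) x)) (at (x j))"
    proof (rule has_real_derivative_compose_partial[OF W that(1)])
      show "\<forall>\<^sub>F t in nhds (x j). h (x(j := t)) \<in> rvec m"
        using eventually_upd_in_open[OF U that(2,3)] openin_Euclidean_subset[OF W] hW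
        by (auto elim!: eventually_mono)
      show "h (x(j := x j)) \<in> W" using hW that by simp
      show "((\<lambda>t. h (x(j := t)) i) has_real_derivative partial_deriv j (\<lambda>x. h x i) x) (at (x j))" if "i < m" for i
        by (rule part_diff_DERIV[OF smooth_on_part_diff[OF U h[OF that]] \<open>x \<in> U\<close> \<open>j < n\<close>])
    qed
    then show ?thesis by simp
  qed
  have "part_diff n U (\<lambda>x. g (h x))" if "smooth_on m W g" for g
    using D[OF that] continuous_on_compose2[OF smooth_on_continuous[OF W that] ch] hW
    unfolding part_diff_def real_differentiable_def by blast
  then show "part_diff n U b" if "b \<in> ?B" for b
    using that smooth_on_part_diff[OF U] by auto
  show "\<exists>f\<in>poly_closure ?B. \<forall>x\<in>U. partial_deriv j b x = f x" if b: "b \<in> ?B" and j: "j < n" for b j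
  proof (cases "smooth_on n U b")
    case True
    then show ?thesis using smooth_on_partial_deriv[OF U True j] by (auto intro: poly_closure.base)
  next
    case False
    then obtain g where g: "b = (\<lambda>x. g (h x))" "smooth_on m W g" using b by auto
    have "(\<lambda>x. \<Sum>i<m. partial_deriv i g (h x) * partial_deriv j (\<lambda>x. h x i) x) \<in> poly_closure ?B"
    proof (intro poly_closure_sum poly_closure.mult poly_closure.base)
      fix i assume "i \<in> {..<m}"
      then show "(\<lambda>x. partial_deriv i g (h x)) \<in> ?B" "partial_deriv j (\<lambda>x. h x i) \<in> ?B"
        using smooth_on_partial_deriv[OF W g(2)] smooth_on_partial_deriv[OF U h j] by auto
    qed simp
    then show ?thesis
      using D[OF g(2)] j unfolding g(1)
      by (intro bexI[of _ "\<lambda>x. \<Sum>i<m. partial_deriv i g (h x) * partial_deriv j (\<lambda>x. h x i) x"])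
        (auto simp: partial_deriv_def intro!: DERIV_imp_deriv)
  qed
  show "(\<lambda>x. g (h x)) \<in> poly_closure ?B" using g by (auto intro: poly_closure.base)
qed

text \<open>A function of one real variable is viewed as a function on the line \<open>Euclidean_space 1\<close>.\<close>

definition line :: "real set \<Rightarrow> (nat \<Rightarrow> real) set" where
  "line T = {x \<in> rvec 1. x 0 \<in> T}"

lemma openin_line: "open T \<Longrightarrow> openin (Euclidean_space 1) (line T)"
  unfolding line_def by (intro openin_Euclidean_Collect continuous_on_coord open_rvec)

lemma foldr_partial_deriv_line:
  "set is \<subseteq> {..<1} \<Longrightarrow> foldr partial_deriv is (\<lambda>x. u (x 0)) = (\<lambda>x. (deriv ^^ length is) u (x 0))"
  by (induction "is") (auto simp: partial_deriv_def fun_eq_iff)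

text \<open>On the line every list of indices is a repetition of 0, so iterated partial derivatives
  are iterated \<open>deriv\<close>. This hands the closure properties above to functions of one
  variable.\<close>

lemma smooth_on_line_iff:
  assumes "open T"
  shows "smooth_on 1 (line T) (\<lambda>x. u (x 0)) \<longleftrightarrow> (\<forall>k. \<forall>t\<in>T. (deriv ^^ k) u differentiable (at t))"
    (is "?L \<longleftrightarrow> ?R")
proof
  assume L: ?L
  show ?R
  proof (intro allI ballI)
    fix k t assume t: "t \<in> T"
    have z: "set (replicate k 0) \<subseteq> {..<1::nat}" by auto
    then have "part_diff 1 (line T) (foldr partial_deriv (replicate k 0) (\<lambda>x. u (x 0)))"
      using L unfolding smooth_on_iff_part_diff[OF openin_line[OF assms]] by blast
    then have "part_diff 1 (line T) (\<lambda>x. (deriv ^^ k) u (x 0))"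
      unfolding foldr_partial_deriv_line[OF z] by simp
    moreover have "(\<lambda>i. if i = 0 then t else 0) \<in> line T" using t by (auto simp: line_def rvec_def)
    ultimately show "(deriv ^^ k) u differentiable (at t)"
      unfolding part_diff_def by fastforce
  qed
next
  assume R: ?R
  show ?L
    unfolding smooth_on_iff_part_diff[OF openin_line[OF assms]]
  proof (intro allI impI)
    fix "is" :: "nat list" assume "is": "set is \<subseteq> {..<1}"
    have "part_diff 1 (line T) (\<lambda>x. (deriv ^^ k) u (x 0))" for k
    proof -
      have "continuous_on T ((deriv ^^ k) u)"
        using R by (intro continuous_at_imp_continuous_on) (simp add: differentiable_imp_continuous_within)
      then have "continuous_on (line T) (\<lambda>x. (deriv ^^ k) u (x 0))"
        by (rule continuous_on_compose2[OF _ continuous_on_coord]) (auto simp: line_def)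
      then show ?thesis using R by (auto simp: part_diff_def line_def)
    qed
    then show "part_diff 1 (line T) (foldr partial_deriv is (\<lambda>x. u (x 0)))"
      by (simp only: foldr_partial_deriv_line[OF "is"])
  qed
qed

text \<open>\<open>flat 0\<close> is the classical \<open>exp (-1/t)\<close> extended by zero;
  powers of \<open>1/t\<close> are what its derivatives produce, and with them the family is closed
  under differentiation up to linear combinations.\<close>

definition flat :: "nat \<Rightarrow> real \<Rightarrow> real" where
  "flat m t = (if t > 0 then exp (- inverse t) * inverse t ^ m else 0)"

text \<open>Away from 0 this is computation. At 0 the right-hand difference quotient is
  \<open>exp (-1/s) / s^(m+1)\<close>, and the exponential beats every power.\<close>

lemma flat_DERIV: "(flat m has_real_derivative flat (m + 2) t - real m * flat (m + 1) t) (at t)"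
proof -
  consider "t > 0" | "t < 0" | "t = 0" by linarith
  then show ?thesis
  proof cases
    case 1
    have "((\<lambda>t. inverse t ^ m) has_real_derivative
        real m * (- (inverse t ^ 2) * inverse t ^ (m - Suc 0))) (at t)"
      using 1 by (auto intro!: derivative_eq_intros simp: power2_eq_square)
    then have pw: "((\<lambda>t. inverse t ^ m) has_real_derivative - (real m * inverse t ^ (m + 1))) (at t)"
      by (cases m) (auto simp: power2_eq_square mult_ac)
    have ex: "((\<lambda>t. exp (- inverse t)) has_real_derivative exp (- inverse t) * (inverse t * inverse t)) (at t)"
      using 1 by (auto intro!: derivative_eq_intros)
    have "((\<lambda>t. exp (- inverse t) * inverse t ^ m) has_real_derivative flat (m + 2) t - real m * flat (m + 1) t) (at t)"
      by (rule DERIV_cong[OF DERIV_mult[OF ex pw]]) (use 1 in \<open>simp add: flat_def power_add power2_eq_square mult_ac\<close>)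
    moreover have "\<forall>\<^sub>F s in nhds t. flat m s = exp (- inverse s) * inverse s ^ m"
      using eventually_nhds_in_open[of "{0<..}" t] 1 by (auto simp: flat_def elim!: eventually_mono)
    ultimately show ?thesis using DERIV_cong_ev[OF refl _ refl] by metis
  next
    case 2
    have "\<forall>\<^sub>F s in nhds t. flat m s = 0"
      using eventually_nhds_in_open[of "{..<0}" t] 2 by (auto simp: flat_def elim!: eventually_mono)
    moreover have "flat (m + 2) t - real m * flat (m + 1) t = 0" using 2 by (simp add: flat_def)
    ultimately show ?thesis using DERIV_cong_ev[of t t "flat m" "\<lambda>_. 0" 0] by simp
  next
    case 3
    \<comment> \<open>The difference quotient, written as the reciprocal of
      \<open>exp x / x^(m+1)\<close> at \<open>x = 1/s\<close>, which tends to infinity.\<close>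
    have lim: "((\<lambda>s. inverse (exp (inverse s) / inverse s ^ (m + 1))) \<longlongrightarrow> 0) (at_right (0::real))"
    proof (rule tendsto_inverse_0_at_top)
      have "filterlim (\<lambda>x::real. x ^ (m + 1) / exp x) (at_right 0) at_top"
        by (rule tendsto_imp_filterlim_at_right[OF tendsto_power_div_exp_0])
          (auto intro!: eventually_at_top_linorderI[of 1])
      then have "filterlim (\<lambda>x::real. inverse (x ^ (m + 1) / exp x)) at_top at_top"
        by (rule filterlim_compose[OF filterlim_inverse_at_top_right])
      then have "filterlim (\<lambda>x::real. exp x / x ^ (m + 1)) at_top at_top"
        by (simp add: inverse_divide)
      then show "filterlim (\<lambda>s::real. exp (inverse s) / inverse s ^ (m + 1)) at_top (at_right 0)"
        by (rule filterlim_compose[OF _ filterlim_inverse_at_top_right])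
    qed
    have "((\<lambda>s. flat m s / s) \<longlongrightarrow> 0) (at 0)"
    proof (rule filterlim_split_at)
      have "\<forall>\<^sub>F s in at_left 0. flat m s / s = 0"
        by (auto simp: eventually_at_filter flat_def)
      then show "((\<lambda>s. flat m s / s) \<longlongrightarrow> 0) (at_left 0)" by (rule tendsto_eventually)
      have "\<forall>\<^sub>F s in at_right 0. inverse (exp (inverse s) / inverse s ^ (m + 1)) = flat m s / s"
        unfolding eventually_at_filter
        by (intro always_eventually allI impI)
          (simp add: flat_def exp_minus divide_inverse inverse_mult_distrib power_inverse mult_ac)
      then show "((\<lambda>s. flat m s / s) \<longlongrightarrow> 0) (at_right 0)"
        by (rule Lim_transform_eventually[OF lim])
    qed
    then show ?thesis using 3 by (simp add: has_field_derivative_iff flat_def)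
  qed
qed

lemma smooth_on_flat: "smooth_on 1 (rvec 1) (\<lambda>x. flat 0 (x 0))"
proof -
  let ?B = "{\<lambda>x. flat m (x 0) |m. True}"
  have cont: "continuous_on UNIV (flat m)" for m
    by (rule DERIV_continuous_on) (rule has_field_derivative_at_within[OF flat_DERIV])
  have dif: "flat m differentiable (at t)" for m t
    using flat_DERIV unfolding real_differentiable_def by blast
  show ?thesis
  proof (rule smooth_on_poly_closure[OF open_rvec, of ?B])
    show "part_diff 1 (rvec 1) b" if "b \<in> ?B" for b
      using that dif unfolding part_diff_def
      by (auto intro!: continuous_on_compose2[OF cont continuous_on_coord])
    show "\<exists>g\<in>poly_closure ?B. \<forall>x\<in>rvec 1. partial_deriv i b x = g x" if b: "b \<in> ?B" "i < 1" for b i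
    proof -
      obtain m where m: "b = (\<lambda>x. flat m (x 0))" using b by auto
      have "partial_deriv i b x = flat (m + 2) (x 0) + (- real m) * flat (m + 1) (x 0)" for x
        using DERIV_imp_deriv[OF flat_DERIV[of m "x 0"]] b(2) by (simp add: m partial_deriv_def)
      moreover have "(\<lambda>x. flat (m + 2) (x 0) + (- real m) * flat (m + 1) (x 0)) \<in> poly_closure ?B"
        by (intro poly_closure.add poly_closure.mult poly_closure.const poly_closure.base) blast+
      ultimately show ?thesis by (metis (no_types, lifting))
    qed
    show "(\<lambda>x. flat 0 (x 0)) \<in> poly_closure ?B" by (auto intro: poly_closure.base)
  qed
qed

lemma smooth_on_compose_line:
  assumes "openin (Euclidean_space n) U" "open T" "smooth_on 1 (line T) (\<lambda>x. u (x 0))"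
    and "smooth_on n U f" "\<And>x. x \<in> U \<Longrightarrow> f x \<in> T"
  shows "smooth_on n U (\<lambda>x. u (f x))"
  using smooth_on_compose[OF assms(1) openin_line[OF assms(2)] assms(3),
      of "\<lambda>x i. if i = 0 then f x else 0"] assms(4,5)
  by (simp add: line_def rvec_def)

text \<open>A quotient \<open>a / (a + b)\<close> with \<open>a > 0\<close> exactly for
  \<open>\<bar>t\<bar> < 2\<close> and \<open>b > 0\<close> exactly for
  \<open>\<bar>t\<bar> > 1\<close>. These sets cover the line, so the denominator is positive; the
  function is 1 on [-1, 1] and 0 where \<open>\<bar>t\<bar> \<ge> 2\<close>. Squares replace the
  absolute value, which is not smooth.\<close>

definition plateau :: "real \<Rightarrow> real" where
  "plateau t = flat 0 (4 - t\<^sup>2) * inverse (flat 0 (4 - t\<^sup>2) + flat 0 (t\<^sup>2 - 1))"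

lemma flat_0: "flat 0 t \<ge> 0" "flat 0 t = 0 \<longleftrightarrow> t \<le> 0" "flat 0 t > 0 \<longleftrightarrow> t > 0"
  by (auto simp: flat_def)

lemma plateau_denominator: "flat 0 (4 - t\<^sup>2) + flat 0 (t\<^sup>2 - 1) > 0"
proof (cases "t\<^sup>2 < 4")
  case True
  then show ?thesis using flat_0 by (simp add: add_pos_nonneg)
next
  case False
  then show ?thesis using flat_0 by (simp add: add_nonneg_pos)
qed

lemma plateau_eq_1: "\<bar>t\<bar> \<le> 1 \<Longrightarrow> plateau t = 1"
  using plateau_denominator[of t] flat_0(2)[of "t\<^sup>2 - 1"]
  by (simp add: plateau_def abs_square_le_1[symmetric])

lemma plateau_eq_0: "\<bar>t\<bar> \<ge> 2 \<Longrightarrow> plateau t = 0"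
  using flat_0(2)[of "4 - t\<^sup>2"] abs_le_square_iff[of 2 t] by (simp add: plateau_def)

lemma plateau_bounds: "0 \<le> plateau t" "plateau t \<le> 1"
  using plateau_denominator[of t] flat_0(1)[of "4 - t\<^sup>2"] flat_0(1)[of "t\<^sup>2 - 1"]
  by (auto simp: plateau_def field_simps)

lemma line_UNIV: "line UNIV = rvec 1"
  by (simp add: line_def)

lemma smooth_on_plateau: "smooth_on 1 (line UNIV) (\<lambda>x. plateau (x 0))"
proof -
  note o = open_rvec[of 1]
  have f: "smooth_on 1 (rvec 1) (\<lambda>x. flat 0 (4 - (x 0)\<^sup>2))" "smooth_on 1 (rvec 1) (\<lambda>x. flat 0 ((x 0)\<^sup>2 - 1))"
    using smooth_on_flat
    by (intro smooth_on_compose_line[of 1 "rvec 1" UNIV "flat 0"] o smooth_on_diff smooth_on_power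
        smooth_on_coord smooth_on_const; simp add: line_UNIV)+
  have "flat 0 (4 - (x 0)\<^sup>2) + flat 0 ((x 0)\<^sup>2 - 1) \<noteq> 0" for x :: "nat \<Rightarrow> real"
    using plateau_denominator[of "x 0"] by simp
  then show ?thesis unfolding plateau_def line_UNIV
    by (intro smooth_on_mult smooth_on_inverse smooth_on_add o f)
qed

section \<open>Hadamard's lemma by integration along rays\<close>

definition star_set :: "(nat \<Rightarrow> real) \<Rightarrow> (nat \<Rightarrow> real) set \<Rightarrow> bool" where
  "star_set p W \<longleftrightarrow> (\<forall>x\<in>W. \<forall>t\<in>{0..1}. (\<lambda>i. p i + t * (x i - p i)) \<in> W)"

text \<open>For \<open>m = 0\<close> these are the coefficients in Hadamard's lemma; differentiating under the
  integral sign increases \<open>m\<close>.\<close>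

definition ray_integral :: "(nat \<Rightarrow> real) \<Rightarrow> nat \<Rightarrow> ((nat \<Rightarrow> real) \<Rightarrow> real) \<Rightarrow> (nat \<Rightarrow> real) \<Rightarrow> real" where
  "ray_integral p m G x = integral {0..1::real} (\<lambda>t. t ^ m * G (\<lambda>i. p i + t * (x i - p i)))"

lemma continuous_on_ray:
  fixes p :: "nat \<Rightarrow> real"
  shows "continuous_on S (\<lambda>z. \<lambda>i. p i + snd z * (fst z i - p i))"
proof (rule continuous_on_coordinatewise_then_product)
  fix i
  have "continuous_on S (\<lambda>z. fst z i)"
    by (rule continuous_on_compose2[OF continuous_on_coord[of UNIV] continuous_on_fst[OF continuous_on_id]]) auto
  then show "continuous_on S (\<lambda>z. p i + snd z * (fst z i - p i))"
    by (intro continuous_intros)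
qed

lemma ray_integrand_continuous:
  assumes "openin (Euclidean_space n) W" "star_set p W" "smooth_on n W G"
  shows "continuous_on (W \<times> {0..1}) (\<lambda>(x, t). t ^ m * G (\<lambda>i. p i + t * (x i - p i)))"
proof -
  have "continuous_on (W \<times> {0..1}) (\<lambda>z. G (\<lambda>i. p i + snd z * (fst z i - p i)))"
    by (rule continuous_on_compose2[OF smooth_on_continuous[OF assms(1,3)] continuous_on_ray])
      (use assms(2) in \<open>auto simp: star_set_def\<close>)
  then show ?thesis
    by (auto simp: case_prod_unfold intro!: continuous_intros)
qed

lemma ray_integral_DERIV:
  assumes W: "openin (Euclidean_space n) W" "star_set p W" and G: "smooth_on n W G"
    and x: "x \<in> W" and j: "j < n"
  shows "((\<lambda>s. ray_integral p m G (x(j := s))) has_real_derivative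
    ray_integral p (Suc m) (partial_deriv j G) x) (at (x j))"
proof -
  obtain d where d: "d > 0" "\<And>y. y \<in> rvec n \<Longrightarrow> (\<And>i. i < n \<Longrightarrow> \<bar>y i - x i\<bar> < d) \<Longrightarrow> y \<in> W"
    using openin_Euclidean_box[OF W(1) x] by blast
  have xr: "x \<in> rvec n" using W(1) x openin_Euclidean_subset by blast
  \<comment> \<open>A ball is convex, as the Leibniz rule requires, and this one is small enough
    that moving coordinate \<open>j\<close> stays in \<open>W\<close>.\<close>
  let ?I = "ball (x j) d"
  have upd: "x(j := s) \<in> W" if "s \<in> ?I" for s
    using that xr j d(1) by (intro d(2) rvec_upd) (auto simp: dist_real_def abs_minus_commute)
  let ?r = "\<lambda>s t. (\<lambda>i. p i + t * ((x(j := s)) i - p i))"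
  have ray: "?r s t \<in> W" if "s \<in> ?I" "t \<in> {0..1}" for s t
    using W(2) upd[OF that(1)] that(2) unfolding star_set_def by blast
  have "((\<lambda>s. integral (cbox 0 1) (\<lambda>t. t ^ m * G (?r s t))) has_field_derivative
      integral (cbox 0 1) (\<lambda>t. t ^ Suc m * partial_deriv j G (?r (x j) t))) (at (x j) within ?I)"
  proof (rule leibniz_rule_field_derivative)
    fix s t :: real assume s: "s \<in> ?I" and t: "t \<in> cbox 0 1"
    then have t': "t \<in> {0..1}" by simp
    have "((\<lambda>u. G ((?r s t)(j := u))) has_real_derivative partial_deriv j G (?r s t)) (at (?r s t j))"
      by (rule part_diff_DERIV[OF smooth_on_part_diff[OF W(1) G] ray[OF s t'] j])
    then have D: "((\<lambda>u. G ((?r s t)(j := u))) has_real_derivative partial_deriv j G (?r s t)) (at (p j + t * (s - p j)))"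
      by simp
    \<comment> \<open>The point at parameter \<open>t\<close> of the ray moves with \<open>t\<close>
      times the speed of the endpoint; this is the extra power of \<open>t\<close>.\<close>
    have "((\<lambda>s. p j + t * (s - p j)) has_real_derivative t) (at s within ?I)"
      by (auto intro!: derivative_eq_intros)
    from DERIV_chain2[OF D this]
    have "((\<lambda>s'. G ((?r s t)(j := p j + t * (s' - p j)))) has_real_derivative
      partial_deriv j G (?r s t) * t) (at s within ?I)" .
    moreover have "(?r s t)(j := p j + t * (s' - p j)) = ?r s' t" for s' by auto
    ultimately have "((\<lambda>s'. G (?r s' t)) has_real_derivative
      partial_deriv j G (?r s t) * t) (at s within ?I)" by simp
    from DERIV_cmult[OF this, of "t ^ m"]
    show "((\<lambda>s. t ^ m * G (?r s t)) has_field_derivative t ^ Suc m * partial_deriv j G (?r s t)) (at s within ?I)"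
      by (simp add: mult_ac)
  next
    fix s assume s: "s \<in> ?I"
    have "continuous_on {0..1} (\<lambda>t. (x(j := s), t))" by (intro continuous_intros)
    then have "continuous_on {0..1} (\<lambda>t. t ^ m * G (?r s t))"
      using continuous_on_compose2[OF ray_integrand_continuous[OF W G, of m], of "{0..1}" "\<lambda>t. (x(j := s), t)"]
        upd[OF s] by auto
    then show "(\<lambda>t. t ^ m * G (?r s t)) integrable_on cbox 0 1"
      unfolding cbox_interval by (rule integrable_continuous_interval)
  next
    have "continuous_on (?I \<times> {0..1}) (\<lambda>z. (x(j := fst z), snd z))"
    proof (intro continuous_on_Pair continuous_on_coordinatewise_then_product continuous_on_snd continuous_on_id)
      show "continuous_on (?I \<times> {0..1}) (\<lambda>z. (x(j := fst z)) i)" for i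
        by (cases "i = j") (auto intro!: continuous_intros)
    qed
    then have "continuous_on (?I \<times> {0..1}) (\<lambda>z. (case (x(j := fst z), snd z) of (x, t) \<Rightarrow>
        t ^ Suc m * partial_deriv j G (\<lambda>i. p i + t * (x i - p i))))"
      using upd
      by (intro continuous_on_compose2[OF ray_integrand_continuous[OF W smooth_on_partial_deriv[OF W(1) G j], of "Suc m"]]) auto
    then show "continuous_on (?I \<times> cbox 0 1) (\<lambda>(s, t). t ^ Suc m * partial_deriv j G (?r s t))"
      by (simp add: case_prod_unfold)
  qed (use d(1) in auto)
  then have "((\<lambda>s. integral (cbox 0 1) (\<lambda>t. t ^ m * G (?r s t))) has_field_derivative
      integral (cbox 0 1) (\<lambda>t. t ^ Suc m * partial_deriv j G (?r (x j) t))) (at (x j))"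
    by (subst (asm) at_within_open) (use d(1) in auto)
  then show ?thesis unfolding ray_integral_def by (simp add: fun_upd_idem)
qed

text \<open>Coinduction over all \<open>ray_integral p m G\<close> at once, since a partial
  derivative is again a ray integral, with \<open>m\<close> raised by one.\<close>

lemma smooth_on_ray_integral:
  assumes W: "openin (Euclidean_space n) W" "star_set p W" and G: "smooth_on n W G"
  shows "smooth_on n W (ray_integral p m G)"
proof (rule smooth_on_coinduct[OF W(1), where F = "{ray_integral p m G |m G. smooth_on n W G}"])
  show "part_diff n W f" if f: "f \<in> {ray_integral p m G |m G. smooth_on n W G}" for f
  proof -
    obtain m G where mG: "f = ray_integral p m G" "smooth_on n W G" using f by auto
    have "continuous_on (W \<times> cbox 0 1) (\<lambda>(x, t). t ^ m * G (\<lambda>i. p i + t * (x i - p i)))"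
      using ray_integrand_continuous[OF W mG(2)] by simp
    from integral_continuous_on_param[OF this] have "continuous_on W f"
      unfolding mG(1) ray_integral_def[abs_def] by simp
    then show ?thesis
      using ray_integral_DERIV[OF W mG(2)] unfolding part_diff_def mG(1) real_differentiable_def by blast
  qed
  show "\<exists>g\<in>{ray_integral p m G |m G. smooth_on n W G}. \<forall>x\<in>W. partial_deriv i f x = g x"
    if f: "f \<in> {ray_integral p m G |m G. smooth_on n W G}" "i < n" for f i
  proof -
    obtain m G where mG: "f = ray_integral p m G" "smooth_on n W G" using f by auto
    show ?thesis
      using ray_integral_DERIV[OF W mG(2) _ f(2)] smooth_on_partial_deriv[OF W(1) mG(2) f(2)]
      by (intro bexI[of _ "ray_integral p (Suc m) (partial_deriv i G)"])
        (auto simp: mG(1) partial_deriv_def intro!: DERIV_imp_deriv)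
  qed
qed (use G in blast)

text \<open>The fundamental theorem of calculus for \<open>F\<close> along the segment from
  \<open>p\<close> to \<open>x\<close>: by the chain rule the integrand is a sum over
  \<open>i\<close> in which the constant factor \<open>x i - p i\<close> can be pulled out of the
  integral.\<close>

lemma Hadamard:
  assumes W: "openin (Euclidean_space n) W" "star_set p W" and p: "p \<in> W" and F: "smooth_on n W F"
  obtains g where "\<And>i. i < n \<Longrightarrow> smooth_on n W (g i)" "\<And>i. i < n \<Longrightarrow> g i p = partial_deriv i F p"
    "\<And>x. x \<in> W \<Longrightarrow> F x = F p + (\<Sum>i<n. (x i - p i) * g i x)"
proof -
  define g where "g i = ray_integral p 0 (partial_deriv i F)" for i
  have 1: "smooth_on n W (g i)" if "i < n" for i
    unfolding g_def by (intro smooth_on_ray_integral W smooth_on_partial_deriv F that)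
  \<comment> \<open>For \<open>x = p\<close> the ray stays at \<open>p\<close>, so a constant is
    integrated over an interval of length 1.\<close>
  have 2: "g i p = partial_deriv i F p" for i by (simp add: g_def ray_integral_def)
  have 3: "F x = F p + (\<Sum>i<n. (x i - p i) * g i x)" if x: "x \<in> W" for x
  proof -
    let ?c = "\<lambda>t i. p i + t * (x i - p i)"
    have xr: "x \<in> rvec n" "p \<in> rvec n" using W(1) x p openin_Euclidean_subset by blast+
    have D: "((\<lambda>t. F (?c t)) has_real_derivative (\<Sum>i<n. partial_deriv i F (?c t) * (x i - p i))) (at t)"
      if "t \<in> {0..1}" for t
    proof (rule has_real_derivative_compose_partial[OF W(1) F])
      show "\<forall>\<^sub>F t in nhds t. ?c t \<in> rvec n" using xr by (intro always_eventually) (auto simp: rvec_def)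
      show "?c t \<in> W" using W(2) x that by (simp add: star_set_def)
    qed (auto intro!: derivative_eq_intros)
    have "((\<lambda>t. \<Sum>i<n. partial_deriv i F (?c t) * (x i - p i)) has_integral F (?c 1) - F (?c 0)) {0..1}"
      using D by (intro fundamental_theorem_of_calculus)
        (auto simp: has_real_derivative_iff_has_vector_derivative[symmetric] has_field_derivative_at_within)
    moreover have "((\<lambda>t. \<Sum>i<n. partial_deriv i F (?c t) * (x i - p i)) has_integral
        (\<Sum>i<n. g i x * (x i - p i))) {0..1}"
    proof (intro has_integral_sum has_integral_mult_left)
      fix i assume i: "i \<in> {..<n}"
      have "continuous_on {0..1} (\<lambda>t. (x, t))" by (intro continuous_intros)
      then have "continuous_on {0..1} (\<lambda>t. partial_deriv i F (?c t))"
        using continuous_on_compose2[OF ray_integrand_continuous[OF W smooth_on_partial_deriv[OF W(1) F], of i 0], of "{0..1}" "\<lambda>t. (x, t)"]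
          i x by auto
      then show "((\<lambda>t. partial_deriv i F (?c t)) has_integral g i x) {0..1}"
        unfolding g_def ray_integral_def by (simp add: integrable_integral integrable_continuous_interval)
    qed simp
    ultimately have "F (?c 1) - F (?c 0) = (\<Sum>i<n. g i x * (x i - p i))"
      by (rule has_integral_unique)
    then show ?thesis by (simp add: mult.commute)
  qed
  show ?thesis using that 1 2 3 by blast
qed

section \<open>Vector fields and one-forms in an atlas\<close>

lemma openin_Euclidean_preimage:
  assumes U: "openin (Euclidean_space n) U" and W: "openin (Euclidean_space m) W"
    and h: "\<And>i. i < m \<Longrightarrow> continuous_on U (\<lambda>x. h x i)" "\<And>x. x \<in> U \<Longrightarrow> h x \<in> rvec m"
  shows "openin (Euclidean_space n) {x \<in> U. h x \<in> W}"
proof -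
  obtain S where S: "open S" "W = rvec m \<inter> S"
    using W unfolding Euclidean_space_eq_top_of_set openin_open by blast
  have "continuous_on U h" by (rule continuous_on_rvec[OF h])
  from openin_Euclidean_Collect[OF U this S(1)] show ?thesis
    using h(2) S(2) by (auto elim!: back_subst[of "openin _"])
qed

text \<open>What remains of \<open>smooth_manifold\<close> when only the carrier is kept of the
  topology: enough for derivations, one-forms and tensors, and provable for the jet bundle directly
  from its charts.\<close>

locale smooth_atlas =
  fixes N :: "'a manifold"
  assumes chart_inj: "(U, \<phi>) \<in> matlas N \<Longrightarrow> inj_on \<phi> U"
    and chart_open: "(U, \<phi>) \<in> matlas N \<Longrightarrow> openin (Euclidean_space (mdim N)) (\<phi> ` U)"
    and points_eq: "points N = (\<Union>(U, \<phi>)\<in>matlas N. U)"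
    and overlap_open: "(U, \<phi>) \<in> matlas N \<Longrightarrow> (V, \<psi>) \<in> matlas N \<Longrightarrow>
      openin (Euclidean_space (mdim N)) (\<phi> ` (U \<inter> V))"
    and transition: "(U, \<phi>) \<in> matlas N \<Longrightarrow> (V, \<psi>) \<in> matlas N \<Longrightarrow> i < mdim N \<Longrightarrow>
      smooth_on (mdim N) (\<phi> ` (U \<inter> V)) (\<lambda>y. \<psi> (inv_into U \<phi> y) i)"
begin

abbreviation "sf \<equiv> smooth_functions N"
abbreviation "vf \<equiv> vector_fields N"
abbreviation "of1 \<equiv> one_forms N"
text \<open>The unit of the algebra \<open>sf\<close>: its members vanish off the carrier, so the
  constant \<open>c\<close> is represented by \<open>c * one\<close>.\<close>

abbreviation "one \<equiv> indicator (points N) :: 'a \<Rightarrow> real"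

lemma chart_rvec: "(U, \<phi>) \<in> matlas N \<Longrightarrow> x \<in> U \<Longrightarrow> \<phi> x \<in> rvec (mdim N)"
  using openin_Euclidean_subset[OF chart_open] by blast

lemma sf_iff: "f \<in> sf \<longleftrightarrow> (\<forall>x. x \<notin> points N \<longrightarrow> f x = 0) \<and>
   (\<forall>U \<phi>. (U, \<phi>) \<in> matlas N \<longrightarrow> smooth_on (mdim N) (\<phi> ` U) (\<lambda>y. f (inv_into U \<phi> y)))"
  unfolding smooth_functions_def by auto

lemma sf_chart: "f \<in> sf \<Longrightarrow> (U, \<phi>) \<in> matlas N \<Longrightarrow> smooth_on (mdim N) (\<phi> ` U) (\<lambda>y. f (inv_into U \<phi> y))"
  unfolding sf_iff by blast

lemma sf_off: "f \<in> sf \<Longrightarrow> x \<notin> points N \<Longrightarrow> f x = 0"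
  unfolding sf_iff by blast

lemma sf_add: "f \<in> sf \<Longrightarrow> g \<in> sf \<Longrightarrow> (\<lambda>x. f x + g x) \<in> sf"
  unfolding sf_iff using smooth_on_add[OF chart_open] by auto

lemma sf_mult: "f \<in> sf \<Longrightarrow> g \<in> sf \<Longrightarrow> (\<lambda>x. f x * g x) \<in> sf"
  unfolding sf_iff using smooth_on_mult[OF chart_open] by auto

lemma sf_cmult: "f \<in> sf \<Longrightarrow> (\<lambda>x. c * f x) \<in> sf"
  unfolding sf_iff using smooth_on_mult[OF chart_open smooth_on_const[OF chart_open]] by auto

lemma chart_subset_points: "(U, \<phi>) \<in> matlas N \<Longrightarrow> U \<subseteq> points N"
  unfolding points_eq by auto

lemma sf_one: "one \<in> sf"
proof -
  have "smooth_on (mdim N) (\<phi> ` U) (\<lambda>y. one (inv_into U \<phi> y))" if "(U, \<phi>) \<in> matlas N" for U \<phi>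
  proof (rule smooth_on_cong[OF chart_open[OF that] _ smooth_on_const[OF chart_open[OF that], of 1]])
    fix y assume "y \<in> \<phi> ` U"
    then have "inv_into U \<phi> y \<in> points N" using chart_subset_points[OF that] inv_into_into[of y \<phi> U] by blast
    then show "1 = one (inv_into U \<phi> y)" by simp
  qed
  then show ?thesis unfolding sf_iff by simp
qed

lemma sf_zero: "(\<lambda>x. 0) \<in> sf"
  using sf_cmult[OF sf_one, of 0] by simp

lemma sf_const: "(\<lambda>x. c * one x) \<in> sf"
  by (rule sf_cmult[OF sf_one])

lemma sf_diff: "f \<in> sf \<Longrightarrow> g \<in> sf \<Longrightarrow> (\<lambda>x. f x - g x) \<in> sf"
  using sf_add[of f "\<lambda>x. (-1) * g x"] sf_cmult[of g "-1"] by simp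

lemma sf_sum: "finite I \<Longrightarrow> (\<And>i. i \<in> I \<Longrightarrow> f i \<in> sf) \<Longrightarrow> (\<lambda>x. \<Sum>i\<in>I. f i x) \<in> sf"
  by (induction I rule: finite_induct) (auto intro: sf_zero sf_add)

lemma sf_one_mult: "f \<in> sf \<Longrightarrow> one x * f x = f x"
  using sf_off by (cases "x \<in> points N") auto

section \<open>Vector fields as derivations and as a module over the smooth functions\<close>

lemma vf_sf: "X \<in> vf \<Longrightarrow> X f \<in> sf"
  unfolding vector_fields_def using sf_zero by (cases "f \<in> sf") auto

lemma vf_lincomb: "X \<in> vf \<Longrightarrow> f \<in> sf \<Longrightarrow> g \<in> sf \<Longrightarrow> X (\<lambda>x. a * f x + b * g x) = (\<lambda>x. a * X f x + b * X g x)"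
  unfolding vector_fields_def by blast

lemma vf_mult: "X \<in> vf \<Longrightarrow> f \<in> sf \<Longrightarrow> g \<in> sf \<Longrightarrow> X (\<lambda>x. f x * g x) = (\<lambda>x. X f x * g x + f x * X g x)"
  unfolding vector_fields_def by blast

lemma vf_nonsmooth: "X \<in> vf \<Longrightarrow> f \<notin> sf \<Longrightarrow> X f = (\<lambda>x. 0)"
  unfolding vector_fields_def by blast

lemma vfI:
  assumes "\<And>f. f \<in> sf \<Longrightarrow> X f \<in> sf" "\<And>f. f \<notin> sf \<Longrightarrow> X f = (\<lambda>x. 0)"
    and "\<And>f g a b x. f \<in> sf \<Longrightarrow> g \<in> sf \<Longrightarrow> X (\<lambda>x. a * f x + b * g x) x = a * X f x + b * X g x"
    and "\<And>f g x. f \<in> sf \<Longrightarrow> g \<in> sf \<Longrightarrow> X (\<lambda>x. f x * g x) x = X f x * g x + f x * X g x"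
  shows "X \<in> vf"
  unfolding vector_fields_def using assms by (auto simp: fun_eq_iff)

lemma vf_add: "X \<in> vf \<Longrightarrow> f \<in> sf \<Longrightarrow> g \<in> sf \<Longrightarrow> X (\<lambda>x. f x + g x) = (\<lambda>x. X f x + X g x)"
  using vf_lincomb[of X f g 1 1] by simp

lemma vf_diff: "X \<in> vf \<Longrightarrow> f \<in> sf \<Longrightarrow> g \<in> sf \<Longrightarrow> X (\<lambda>x. f x - g x) = (\<lambda>x. X f x - X g x)"
  using vf_lincomb[of X f g 1 "-1"] by simp

lemma vf_cmult: "X \<in> vf \<Longrightarrow> f \<in> sf \<Longrightarrow> X (\<lambda>x. c * f x) = (\<lambda>x. c * X f x)"
  using vf_lincomb[of X f f c 0] by simp

lemma vf_zero: "X \<in> vf \<Longrightarrow> X (\<lambda>x. 0) = (\<lambda>x. 0)"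
  using vf_cmult[OF _ sf_zero, of X 0] by simp

lemma vf_sum: "finite I \<Longrightarrow> X \<in> vf \<Longrightarrow> (\<And>i. i \<in> I \<Longrightarrow> f i \<in> sf) \<Longrightarrow>
    X (\<lambda>x. \<Sum>i\<in>I. f i x) = (\<lambda>x. \<Sum>i\<in>I. X (f i) x)"
proof (induction I rule: finite_induct)
  case empty
  then show ?case by (simp add: vf_zero)
next
  case (insert i I)
  then show ?case using vf_add[of X "f i" "\<lambda>x. \<Sum>i\<in>I. f i x"] sf_sum[of I f] by simp
qed

text \<open>The unit is idempotent, so the product rule gives \<open>X one = 2 X one\<close> on the
  carrier.\<close>

lemma vf_one: "X \<in> vf \<Longrightarrow> X one = (\<lambda>x. 0)"
proof
  fix x assume X: "X \<in> vf"
  have "(\<lambda>x. one x * one x) = one" by (auto simp: indicator_def)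
  then have "X one x = X one x * one x + one x * X one x"
    using vf_mult[OF X sf_one sf_one] by (metis (no_types, lifting))
  then show "X one x = 0" using sf_off[OF vf_sf[OF X]] by (cases "x \<in> points N") auto
qed

lemma vf_off: "X \<in> vf \<Longrightarrow> x \<notin> points N \<Longrightarrow> X f x = 0"
  using sf_off vf_sf by blast

lemma vf_comb:
  assumes X: "X \<in> vf" and Y: "Y \<in> vf" and f: "f \<in> sf" and g: "g \<in> sf"
  shows "(\<lambda>h x. f x * X h x + g x * Y h x) \<in> vf"
proof (rule vfI)
  show "(\<lambda>x. f x * X h x + g x * Y h x) \<in> sf" for h
    by (intro sf_add sf_mult f g vf_sf X Y)
qed (simp_all add: vf_lincomb[OF X] vf_mult[OF X] vf_nonsmooth[OF X]
    vf_lincomb[OF Y] vf_mult[OF Y] vf_nonsmooth[OF Y] algebra_simps)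

lemma vf_scale: "X \<in> vf \<Longrightarrow> f \<in> sf \<Longrightarrow> (\<lambda>h x. f x * X h x) \<in> vf"
  using vf_comb[of X X f "\<lambda>x. 0"] sf_zero by simp

lemma vf_0: "(\<lambda>h x. 0) \<in> vf"
  by (rule vfI) (auto simp: sf_zero)

lemma vf_sumv: "finite I \<Longrightarrow> (\<And>i. i \<in> I \<Longrightarrow> X i \<in> vf) \<Longrightarrow> (\<And>i. i \<in> I \<Longrightarrow> f i \<in> sf) \<Longrightarrow>
    (\<lambda>h x. \<Sum>i\<in>I. f i x * X i h x) \<in> vf"
proof (induction I rule: finite_induct)
  case empty
  then show ?case using vf_0 by simp
next
  case (insert i I)
  then have "(\<lambda>h x. f i x * X i h x + one x * (\<Sum>i\<in>I. f i x * X i h x)) \<in> vf"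
    by (intro vf_comb sf_one) auto
  moreover have "one x * (\<Sum>i\<in>I. f i x * X i h x) = (\<Sum>i\<in>I. f i x * X i h x)" for h x
    using insert by (intro sf_one_mult sf_sum sf_mult vf_sf) auto
  ultimately show ?case using insert by simp
qed

lemma vf_bracket:
  assumes X: "X \<in> vf" and Y: "Y \<in> vf"
  shows "lie_bracket X Y \<in> vf"
proof (rule vfI)
  fix f g a b x assume f: "f \<in> sf" and g: "g \<in> sf"
  have s: "X f \<in> sf" "X g \<in> sf" "Y f \<in> sf" "Y g \<in> sf" using vf_sf X Y by auto
  show "lie_bracket X Y (\<lambda>x. a * f x + b * g x) x = a * lie_bracket X Y f x + b * lie_bracket X Y g x"
    using f g s by (simp add: lie_bracket_def vf_lincomb[OF X] vf_lincomb[OF Y] algebra_simps)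
  show "lie_bracket X Y (\<lambda>x. f x * g x) x = lie_bracket X Y f x * g x + f x * lie_bracket X Y g x"
    using f g s
    by (simp add: lie_bracket_def vf_add[OF X] vf_mult[OF X] vf_add[OF Y] vf_mult[OF Y] sf_mult algebra_simps)
next
  show "lie_bracket X Y f \<in> sf" for f
    unfolding lie_bracket_def by (rule sf_diff[OF vf_sf[OF X] vf_sf[OF Y]])
  show "lie_bracket X Y f = (\<lambda>x. 0)" if "f \<notin> sf" for f
    using vf_nonsmooth[OF X that] vf_nonsmooth[OF Y that] vf_zero[OF X] vf_zero[OF Y]
    by (simp add: lie_bracket_def)
qed

lemma bracket_comb:
  assumes D: "D \<in> vf" and X: "X \<in> vf" and Y: "Y \<in> vf" and f: "f \<in> sf" and g: "g \<in> sf"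
  shows "lie_bracket D (\<lambda>h x. f x * X h x + g x * Y h x) h x =
    f x * lie_bracket D X h x + D f x * X h x + (g x * lie_bracket D Y h x + D g x * Y h x)"
proof -
  have "X h \<in> sf" "Y h \<in> sf" using vf_sf X Y by auto
  then show ?thesis
    by (simp add: lie_bracket_def vf_add[OF D] vf_mult[OF D] sf_mult f g algebra_simps)
qed

section \<open>One-forms as linear functionals on vector fields\<close>

lemma form_sf: "\<alpha> \<in> of1 \<Longrightarrow> \<alpha> X \<in> sf"
  unfolding one_forms_def using sf_zero by (cases "X \<in> vf") auto

lemma form_comb_arg: "\<alpha> \<in> of1 \<Longrightarrow> X \<in> vf \<Longrightarrow> Y \<in> vf \<Longrightarrow> f \<in> sf \<Longrightarrow> g \<in> sf \<Longrightarrow>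
    \<alpha> (\<lambda>h x. f x * X h x + g x * Y h x) = (\<lambda>x. f x * \<alpha> X x + g x * \<alpha> Y x)"
  unfolding one_forms_def by blast

lemma form_off: "\<alpha> \<in> of1 \<Longrightarrow> X \<notin> vf \<Longrightarrow> \<alpha> X = (\<lambda>x. 0)"
  unfolding one_forms_def by blast

lemma formI:
  assumes "\<And>X. X \<in> vf \<Longrightarrow> \<alpha> X \<in> sf" "\<And>X. X \<notin> vf \<Longrightarrow> \<alpha> X = (\<lambda>x. 0)"
    and "\<And>X Y f g x. X \<in> vf \<Longrightarrow> Y \<in> vf \<Longrightarrow> f \<in> sf \<Longrightarrow> g \<in> sf \<Longrightarrow>
      \<alpha> (\<lambda>h x. f x * X h x + g x * Y h x) x = f x * \<alpha> X x + g x * \<alpha> Y x"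
  shows "\<alpha> \<in> of1"
  unfolding one_forms_def using assms by (auto simp: fun_eq_iff)

lemma form_scale_arg: "\<alpha> \<in> of1 \<Longrightarrow> X \<in> vf \<Longrightarrow> f \<in> sf \<Longrightarrow> \<alpha> (\<lambda>h x. f x * X h x) = (\<lambda>x. f x * \<alpha> X x)"
  using form_comb_arg[of \<alpha> X X f "\<lambda>x. 0"] sf_zero by simp

text \<open>Linearity is over \<open>sf\<close>, so the constant enters as \<open>c * one\<close>;
  the factor \<open>one\<close> disappears because all values vanish off the carrier.\<close>

lemma form_cscale_arg: "\<alpha> \<in> of1 \<Longrightarrow> X \<in> vf \<Longrightarrow> \<alpha> (\<lambda>h x. c * X h x) = (\<lambda>x. c * \<alpha> X x)"
  using form_scale_arg[OF _ _ sf_const[of c], of \<alpha> X] sf_one_mult[OF vf_sf[of X]] sf_one_mult[OF form_sf[of \<alpha>]]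
  by (simp add: mult.assoc)

lemma form_zero_arg: "\<alpha> \<in> of1 \<Longrightarrow> \<alpha> (\<lambda>h x. 0) = (\<lambda>x. 0)"
  using form_cscale_arg[OF _ vf_0, of \<alpha> 0] by simp

lemma form_add_arg: "\<alpha> \<in> of1 \<Longrightarrow> X \<in> vf \<Longrightarrow> Y \<in> vf \<Longrightarrow> \<alpha> (\<lambda>h x. X h x + Y h x) = (\<lambda>x. \<alpha> X x + \<alpha> Y x)"
  using form_comb_arg[OF _ _ _ sf_one sf_one, of \<alpha> X Y] sf_one_mult[OF vf_sf[of X]] sf_one_mult[OF vf_sf[of Y]]
    sf_one_mult[OF form_sf[of \<alpha>]] by simp

lemma form_sum_arg: "finite I \<Longrightarrow> \<alpha> \<in> of1 \<Longrightarrow> (\<And>i. i \<in> I \<Longrightarrow> X i \<in> vf) \<Longrightarrow> (\<And>i. i \<in> I \<Longrightarrow> f i \<in> sf) \<Longrightarrow>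
    \<alpha> (\<lambda>h x. \<Sum>i\<in>I. f i x * X i h x) = (\<lambda>x. \<Sum>i\<in>I. f i x * \<alpha> (X i) x)"
proof (induction I rule: finite_induct)
  case empty
  then show ?case by (simp add: form_zero_arg)
next
  case (insert i I)
  then show ?case
    using form_add_arg[of \<alpha> "\<lambda>h x. f i x * X i h x" "\<lambda>h x. \<Sum>i\<in>I. f i x * X i h x"]
    by (simp add: vf_scale vf_sumv form_scale_arg)
qed

lemma form_comb:
  assumes "\<alpha> \<in> of1" "\<beta> \<in> of1" "f \<in> sf" "g \<in> sf"
  shows "(\<lambda>X x. f x * \<alpha> X x + g x * \<beta> X x) \<in> of1"
proof (rule formI)
  show "(\<lambda>x. f x * \<alpha> X x + g x * \<beta> X x) \<in> sf" for X
    by (intro sf_add sf_mult assms(3,4) form_sf[OF assms(1)] form_sf[OF assms(2)])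
qed (simp_all add: form_off[OF assms(1)] form_off[OF assms(2)]
    form_comb_arg[OF assms(1)] form_comb_arg[OF assms(2)] algebra_simps)

text \<open>Linearity over smooth functions is the point: the derivative terms
  \<open>D f * \<alpha> X\<close> from the product rule cancel against those from the bracket with
  \<open>f X\<close>.\<close>

lemma form_lie:
  assumes D: "D \<in> vf" and \<alpha>: "\<alpha> \<in> of1"
  shows "(\<lambda>Y x. if Y \<in> vf then D (\<alpha> Y) x - \<alpha> (lie_bracket D Y) x else 0) \<in> of1"
proof (rule formI)
  show "(\<lambda>x. if X \<in> vf then D (\<alpha> X) x - \<alpha> (lie_bracket D X) x else 0) \<in> sf" if "X \<in> vf" for X
    using that by (simp add: sf_diff vf_sf[OF D] form_sf[OF \<alpha>])
  fix X Y f g x assume X: "X \<in> vf" and Y: "Y \<in> vf" and f: "f \<in> sf" and g: "g \<in> sf"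
  let ?Z = "\<lambda>h x. f x * X h x + g x * Y h x"
  let ?A = "\<lambda>h x. f x * lie_bracket D X h x + D f x * X h x"
  let ?B = "\<lambda>h x. g x * lie_bracket D Y h x + D g x * Y h x"
  have A: "?A \<in> vf" "?B \<in> vf"
    by (rule vf_comb[OF vf_bracket[OF D X] X f vf_sf[OF D]],
        rule vf_comb[OF vf_bracket[OF D Y] Y g vf_sf[OF D]])
  have "lie_bracket D ?Z = (\<lambda>h x. ?A h x + ?B h x)"
    using bracket_comb[OF D X Y f g] by (simp add: fun_eq_iff)
  then have "\<alpha> (lie_bracket D ?Z) = (\<lambda>x. \<alpha> ?A x + \<alpha> ?B x)"
    using form_add_arg[OF \<alpha> A] by simp
  also have "\<dots> = (\<lambda>x. f x * \<alpha> (lie_bracket D X) x + D f x * \<alpha> X x + (g x * \<alpha> (lie_bracket D Y) x + D g x * \<alpha> Y x))"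
    using form_comb_arg[OF \<alpha> vf_bracket[OF D X] X f vf_sf[OF D]]
      form_comb_arg[OF \<alpha> vf_bracket[OF D Y] Y g vf_sf[OF D]] by simp
  finally have 1: "\<alpha> (lie_bracket D ?Z) x = f x * \<alpha> (lie_bracket D X) x + D f x * \<alpha> X x +
    (g x * \<alpha> (lie_bracket D Y) x + D g x * \<alpha> Y x)" by simp
  have "D (\<alpha> ?Z) = D (\<lambda>x. f x * \<alpha> X x + g x * \<alpha> Y x)"
    using form_comb_arg[OF \<alpha> X Y f g] by simp
  also have "\<dots> = (\<lambda>x. D (\<lambda>x. f x * \<alpha> X x) x + D (\<lambda>x. g x * \<alpha> Y x) x)"
    by (rule vf_add[OF D sf_mult[OF f form_sf[OF \<alpha>]] sf_mult[OF g form_sf[OF \<alpha>]]])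
  finally have "D (\<alpha> ?Z) x = D f x * \<alpha> X x + f x * D (\<alpha> X) x + (D g x * \<alpha> Y x + g x * D (\<alpha> Y) x)"
    using vf_mult[OF D f form_sf[OF \<alpha>]] vf_mult[OF D g form_sf[OF \<alpha>]] by simp
  then show "(if ?Z \<in> vf then D (\<alpha> ?Z) x - \<alpha> (lie_bracket D ?Z) x else 0) =
      f x * (if X \<in> vf then D (\<alpha> X) x - \<alpha> (lie_bracket D X) x else 0) +
      g x * (if Y \<in> vf then D (\<alpha> Y) x - \<alpha> (lie_bracket D Y) x else 0)"
    using 1 vf_comb[OF X Y f g] X Y by (simp add: algebra_simps)
qed auto

section \<open>Extension by zero, and derivations in a chart\<close>

definition cut_off :: "'a set \<Rightarrow> ('a \<Rightarrow> real) \<Rightarrow> ('a \<Rightarrow> real) \<Rightarrow> 'a \<Rightarrow> real" where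
  "cut_off C \<rho> g = (\<lambda>x. if x \<in> C then \<rho> x * g x else (0::real))"

text \<open>Closedness is expressed through the charts so that the topology of the jet bundle, given by
  a subbasis only, never has to be inspected.\<close>

definition chart_closed :: "'a set \<Rightarrow> bool" where
  "chart_closed C \<longleftrightarrow> (\<forall>U \<phi>. (U, \<phi>) \<in> matlas N \<longrightarrow> openin (Euclidean_space (mdim N)) (\<phi> ` (U - C)))"

text \<open>In any chart two open sets cover the image: the part that the transition map sends into
  \<open>W\<close>, where \<open>F\<close> is \<open>g\<close> composed with that map, and the
  complement of \<open>C\<close>, where \<open>F\<close> is zero.\<close>

lemma extend_by_zero_smooth:
  assumes U: "(U, \<phi>) \<in> matlas N" and W: "openin (Euclidean_space (mdim N)) W" "W \<subseteq> \<phi> ` U"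
    and C: "C \<subseteq> U" "\<phi> ` C \<subseteq> W" "chart_closed C"
    and F: "\<And>x. x \<notin> C \<Longrightarrow> F x = 0" "\<And>x. x \<in> U \<Longrightarrow> \<phi> x \<in> W \<Longrightarrow> F x = g (\<phi> x)"
    and g: "smooth_on (mdim N) W g"
  shows "F \<in> sf"
proof -
  let ?n = "mdim N"
  have "smooth_on ?n (\<psi> ` V) (\<lambda>y. F (inv_into V \<psi> y))" if V: "(V, \<psi>) \<in> matlas N" for V \<psi>
  proof (rule smooth_on_local[OF chart_open[OF V]])
    fix p assume "p \<in> \<psi> ` V"
    then obtain x where x: "x \<in> V" "p = \<psi> x" by auto
    have inv: "inv_into V \<psi> (\<psi> x) = x" if "x \<in> V" for x
      using inv_into_f_f[OF chart_inj[OF V] that] .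
    show "\<exists>O' f. openin (Euclidean_space ?n) O' \<and> p \<in> O' \<and> smooth_on ?n O' f \<and>
        (\<forall>y\<in>O'. F (inv_into V \<psi> y) = f y)"
    proof (cases "x \<in> C")
      case True
      let ?O = "{y \<in> \<psi> ` (V \<inter> U). \<phi> (inv_into V \<psi> y) \<in> W}"
      have tr: "smooth_on ?n (\<psi> ` (V \<inter> U)) (\<lambda>y. \<phi> (inv_into V \<psi> y) i)" if "i < ?n" for i
        using transition[OF V U that] .
      have O: "openin (Euclidean_space ?n) ?O"
      proof (rule openin_Euclidean_preimage[OF overlap_open[OF V U] W(1)])
        show "continuous_on (\<psi> ` (V \<inter> U)) (\<lambda>y. \<phi> (inv_into V \<psi> y) i)" if "i < ?n" for i
          using smooth_on_continuous[OF overlap_open[OF V U] tr[OF that]] .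
        show "\<phi> (inv_into V \<psi> y) \<in> rvec ?n" if "y \<in> \<psi> ` (V \<inter> U)" for y
          using that chart_rvec[OF U] inv by auto
      qed
      have "smooth_on ?n ?O (\<lambda>y. g (\<phi> (inv_into V \<psi> y)))"
      proof (rule smooth_on_compose[OF O W(1) g])
        show "smooth_on ?n ?O (\<lambda>y. \<phi> (inv_into V \<psi> y) i)" if "i < ?n" for i
          by (rule smooth_on_subset[OF overlap_open[OF V U] O _ tr[OF that]]) auto
      qed simp
      moreover have "p \<in> ?O" using True C x inv by auto
      moreover have "\<forall>y\<in>?O. F (inv_into V \<psi> y) = g (\<phi> (inv_into V \<psi> y))"
        using F(2) inv by auto
      ultimately show ?thesis using O by blast
    next
      case False
      have O: "openin (Euclidean_space ?n) (\<psi> ` (V - C))"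
        using C(3) V unfolding chart_closed_def by blast
      have "\<forall>y\<in>\<psi> ` (V - C). F (inv_into V \<psi> y) = 0"
        using inv F(1) by auto
      moreover have "p \<in> \<psi> ` (V - C)" using False x by auto
      ultimately show ?thesis using O smooth_on_const[OF O] by blast
    qed
  qed
  moreover have "F x = 0" if "x \<notin> points N" for x
    using that C(1) chart_subset_points[OF U] F(1) by auto
  ultimately show ?thesis unfolding sf_iff by blast
qed

lemma cut_off_smooth:
  assumes U: "(U, \<phi>) \<in> matlas N" and W: "openin (Euclidean_space (mdim N)) W" "W \<subseteq> \<phi> ` U"
    and C: "C \<subseteq> U" "\<phi> ` C \<subseteq> W" "chart_closed C"
    and \<rho>: "\<rho> \<in> sf" "\<And>x. x \<notin> C \<Longrightarrow> \<rho> x = 0" and g: "smooth_on (mdim N) W g"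
  shows "cut_off C \<rho> (\<lambda>x. g (\<phi> x)) \<in> sf"
proof (rule extend_by_zero_smooth[OF U W C])
  show "smooth_on (mdim N) W (\<lambda>y. \<rho> (inv_into U \<phi> y) * g y)"
    by (intro smooth_on_mult[OF W(1)] g smooth_on_subset[OF chart_open[OF U] W sf_chart[OF \<rho>(1) U]])
  show "cut_off C \<rho> (\<lambda>x. g (\<phi> x)) x = \<rho> (inv_into U \<phi> (\<phi> x)) * g (\<phi> x)" if "x \<in> U" for x
    using \<rho>(2) inv_into_f_f[OF chart_inj[OF U] that] by (simp add: cut_off_def)
qed (simp add: cut_off_def)

text \<open>Write
  \<open>\<rho>\<^sup>2 F = F(q) \<rho>\<^sup>2 + \<Sum>\<^sub>i \<rho> (g\<^sub>i - g\<^sub>i(q)) \<cdot> \<rho> h\<^sub>i\<close> by Hadamard's lemma and differentiate at \<open>q\<close>.\<close>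

lemma derivation_in_chart:
  assumes U: "(U, \<phi>) \<in> matlas N" and W: "openin (Euclidean_space (mdim N)) W" "W \<subseteq> \<phi> ` U"
    and star: "\<And>p. p \<in> W \<Longrightarrow> star_set p W"
    and C: "C \<subseteq> U" "\<phi> ` C \<subseteq> W" "chart_closed C"
    and \<rho>: "\<rho> \<in> sf" "\<And>x. x \<notin> C \<Longrightarrow> \<rho> x = 0"
    and g: "\<And>i. i < mdim N \<Longrightarrow> g i \<in> sf" "\<And>i x. i < mdim N \<Longrightarrow> x \<in> C \<Longrightarrow> g i x = \<phi> x i"
    and X: "X \<in> vf" and F: "F \<in> sf" and q: "q \<in> C" "\<rho> q \<noteq> 0"
  shows "X F q = (\<Sum>i<mdim N. X (g i) q * partial_deriv i (\<lambda>y. F (inv_into U \<phi> y)) (\<phi> q))"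
proof -
  let ?n = "mdim N" and ?f = "\<lambda>y. F (inv_into U \<phi> y)" and ?p = "\<phi> q"
  have p: "?p \<in> W" using q C by auto
  have inv: "inv_into U \<phi> (\<phi> x) = x" if "x \<in> U" for x
    using inv_into_f_f[OF chart_inj[OF U] that] .
  have qN: "q \<in> points N" using q C chart_subset_points[OF U] by blast
  obtain h where h: "\<And>i. i < ?n \<Longrightarrow> smooth_on ?n W (h i)" "\<And>i. i < ?n \<Longrightarrow> h i ?p = partial_deriv i ?f ?p"
    "\<And>x. x \<in> W \<Longrightarrow> ?f x = ?f ?p + (\<Sum>i<?n. (x i - ?p i) * h i x)"
    using Hadamard[OF W(1) star[OF p] p smooth_on_subset[OF chart_open[OF U] W(1,2) sf_chart[OF F U]]] by blast
  define G where "G i = cut_off C \<rho> (\<lambda>x. h i (\<phi> x))" for i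
  define K where "K i = (\<lambda>x. \<rho> x * (g i x - ?p i * one x))" for i
  have G: "G i \<in> sf" if "i < ?n" for i
    unfolding G_def using cut_off_smooth[OF U W C \<rho> h(1)[OF that]] by blast
  have K': "(\<lambda>x. g i x - ?p i * one x) \<in> sf" if "i < ?n" for i
    by (intro sf_diff g(1)[OF that] sf_const)
  have K: "K i \<in> sf" if "i < ?n" for i
    unfolding K_def by (rule sf_mult[OF \<rho>(1) K'[OF that]])
  have eq: "\<rho> x * \<rho> x * F x = F q * (\<rho> x * \<rho> x) + (\<Sum>i<?n. K i x * G i x)" for x
  proof (cases "x \<in> C")
    case True
    have "x \<in> points N" using True C chart_subset_points[OF U] by blast
    then have KG: "K i x * G i x = \<rho> x * \<rho> x * ((\<phi> x i - ?p i) * h i (\<phi> x))" if "i < ?n" for i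
      using g(2)[OF that True] True by (simp add: K_def G_def cut_off_def)
    have "F x = F q + (\<Sum>i<?n. (\<phi> x i - ?p i) * h i (\<phi> x))"
      using h(3)[of "\<phi> x"] True C q inv by (auto simp: subset_iff)
    then have "\<rho> x * \<rho> x * F x = F q * (\<rho> x * \<rho> x) + (\<Sum>i<?n. \<rho> x * \<rho> x * ((\<phi> x i - ?p i) * h i (\<phi> x)))"
      by (simp add: distrib_left mult.commute[of "F q"] flip: sum_distrib_left)
    then show ?thesis using KG by simp
  next
    case False
    then show ?thesis using \<rho>(2) by (simp add: K_def)
  qed
  have \<rho>\<rho>: "(\<lambda>x. \<rho> x * \<rho> x) \<in> sf" by (intro sf_mult \<rho>)
  have KG: "(\<lambda>x. K i x * G i x) \<in> sf" if "i < ?n" for i using K G that by (intro sf_mult)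
  have X\<rho>\<rho>: "X (\<lambda>x. \<rho> x * \<rho> x) q = 2 * \<rho> q * X \<rho> q"
    using vf_mult[OF X \<rho>(1) \<rho>(1)] by simp
  have "X (\<lambda>x. \<rho> x * \<rho> x * F x) q = 2 * \<rho> q * X \<rho> q * F q + \<rho> q * \<rho> q * X F q"
    using vf_mult[OF X \<rho>\<rho> F] X\<rho>\<rho> by simp
  moreover have "X (\<lambda>x. \<rho> x * \<rho> x * F x) q =
      X (\<lambda>x. F q * (\<rho> x * \<rho> x) + (\<Sum>i<?n. K i x * G i x)) q"
    using eq by simp
  moreover have "\<dots> = F q * X (\<lambda>x. \<rho> x * \<rho> x) q + (\<Sum>i<?n. X (\<lambda>x. K i x * G i x) q)"
    using vf_add[OF X sf_cmult[OF \<rho>\<rho>] sf_sum[of "{..<?n}" "\<lambda>i x. K i x * G i x"]] KG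
      vf_cmult[OF X \<rho>\<rho>] vf_sum[OF finite_lessThan X, of ?n "\<lambda>i x. K i x * G i x"] by simp
  \<comment> \<open>\<open>K i\<close> vanishes at \<open>q\<close>, so only the term with
    \<open>X (K i)\<close> survives in the product rule.\<close>
  moreover have "X (\<lambda>x. K i x * G i x) q = \<rho> q * \<rho> q * (X (g i) q * partial_deriv i ?f ?p)" if i: "i < ?n" for i
  proof -
    have "X (\<lambda>x. g i x - ?p i * one x) q = X (g i) q"
      using vf_diff[OF X g(1)[OF i] sf_const] vf_cmult[OF X sf_one] vf_one[OF X] by simp
    moreover have 0: "g i q - ?p i * one q = 0" using g(2)[OF i q(1)] qN by simp
    ultimately have "X (K i) q = \<rho> q * X (g i) q"
      unfolding K_def using vf_mult[OF X \<rho>(1) K'[OF i]] by simp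
    moreover have "K i q = 0" using 0 by (simp add: K_def)
    moreover have "G i q = \<rho> q * partial_deriv i ?f ?p"
      using q(1) h(2)[OF i] by (simp add: G_def cut_off_def)
    ultimately show ?thesis
      using vf_mult[OF X K[OF i] G[OF i]] by simp
  qed
  ultimately have "2 * \<rho> q * X \<rho> q * F q + \<rho> q * \<rho> q * X F q =
     F q * (2 * \<rho> q * X \<rho> q) + (\<Sum>i<?n. \<rho> q * \<rho> q * (X (g i) q * partial_deriv i ?f ?p))"
    using X\<rho>\<rho> by simp
  \<comment> \<open>The terms with \<open>X \<rho> q\<close> cancel.\<close>
  then have "\<rho> q * \<rho> q * X F q = \<rho> q * \<rho> q * (\<Sum>i<?n. X (g i) q * partial_deriv i ?f ?p)"
    by (simp add: sum_distrib_left)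
  then show ?thesis using q(2) by simp
qed

end

section \<open>Bump functions on manifolds\<close>

locale smooth_mfd =
  fixes M :: "'a manifold"
  assumes mfd: "smooth_manifold M"
begin

lemma chart:
  assumes "(U, \<phi>) \<in> matlas M"
  shows "openin (mtop M) U" "openin (Euclidean_space (mdim M)) (\<phi> ` U)"
    "homeomorphic_map (subtopology (mtop M) U) (subtopology (Euclidean_space (mdim M)) (\<phi> ` U)) \<phi>"
  using mfd assms unfolding smooth_manifold_def by auto

lemma chart_topspace: "(U, \<phi>) \<in> matlas M \<Longrightarrow> topspace (subtopology (mtop M) U) = U"
  using openin_subset[OF chart(1)] by auto

lemma chart_image_open:
  assumes U: "(U, \<phi>) \<in> matlas M" and D: "openin (mtop M) D" "D \<subseteq> U"
  shows "openin (Euclidean_space (mdim M)) (\<phi> ` D)"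
proof -
  have "openin (subtopology (mtop M) U) D"
    using D chart(1)[OF U] by (simp add: openin_open_subtopology)
  then have "openin (subtopology (Euclidean_space (mdim M)) (\<phi> ` U)) (\<phi> ` D)"
    using homeomorphic_imp_open_map[OF chart(3)[OF U]] unfolding open_map_def by simp
  then show ?thesis using openin_trans_full chart(2)[OF U] by metis
qed

lemma chart_preimage_open:
  assumes U: "(U, \<phi>) \<in> matlas M" and B: "openin (Euclidean_space (mdim M)) B"
  shows "openin (mtop M) {x \<in> U. \<phi> x \<in> B}"
proof -
  have "openin (subtopology (Euclidean_space (mdim M)) (\<phi> ` U)) (B \<inter> \<phi> ` U)"
    using B by (metis openin_subtopology_Int)
  from openin_continuous_map_preimage[OF homeomorphic_imp_continuous_map[OF chart(3)[OF U]] this]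
  have "openin (subtopology (mtop M) U) {x \<in> U. \<phi> x \<in> B \<inter> \<phi> ` U}"
    unfolding chart_topspace[OF U] .
  moreover have "{x \<in> U. \<phi> x \<in> B \<inter> \<phi> ` U} = {x \<in> U. \<phi> x \<in> B}" by auto
  ultimately show ?thesis using openin_trans_full chart(1)[OF U] by metis
qed

sublocale smooth_atlas M
proof
  fix U \<phi> V \<psi> assume U: "(U, \<phi>) \<in> matlas M" and V: "(V, \<psi>) \<in> matlas M"
  show "openin (Euclidean_space (mdim M)) (\<phi> ` (U \<inter> V))"
    by (rule chart_image_open[OF U openin_Int[OF chart(1)[OF U] chart(1)[OF V]]]) simp
  show "smooth_on (mdim M) (\<phi> ` (U \<inter> V)) (\<lambda>y. \<psi> (inv_into U \<phi> y) i)" if "i < mdim M" for i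
    using mfd U V that unfolding smooth_manifold_def by fast
next
  fix U \<phi> assume U: "(U, \<phi>) \<in> matlas M"
  show "inj_on \<phi> U"
    using homeomorphic_imp_injective_map[OF chart(3)[OF U]] chart_topspace[OF U] by simp
  show "openin (Euclidean_space (mdim M)) (\<phi> ` U)" by (rule chart(2)[OF U])
next
  show "points M = (\<Union>(U, \<phi>)\<in>matlas M. U)"
    using mfd unfolding smooth_manifold_def by blast
qed

lemma inv_chart: "(U, \<phi>) \<in> matlas M \<Longrightarrow> x \<in> U \<Longrightarrow> inv_into U \<phi> (\<phi> x) = x"
  using inv_into_f_f[OF chart_inj] by metis

lemma chart_inverse_continuous:
  assumes U: "(U, \<phi>) \<in> matlas M"
  shows "continuous_map (subtopology (Euclidean_space (mdim M)) (\<phi> ` U)) (mtop M) (inv_into U \<phi>)"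
proof -
  have ts: "topspace (subtopology (Euclidean_space (mdim M)) (\<phi> ` U)) = \<phi> ` U"
    using openin_subset[OF chart(2)[OF U]] by auto
  obtain g where g: "homeomorphic_maps (subtopology (mtop M) U)
      (subtopology (Euclidean_space (mdim M)) (\<phi> ` U)) \<phi> g"
    using chart(3)[OF U] unfolding homeomorphic_map_maps by metis
  then have cont: "continuous_map (subtopology (Euclidean_space (mdim M)) (\<phi> ` U)) (subtopology (mtop M) U) g"
    and gx: "\<And>x. x \<in> U \<Longrightarrow> g (\<phi> x) = x"
    unfolding homeomorphic_maps_def chart_topspace[OF U] by auto
  have "continuous_map (subtopology (Euclidean_space (mdim M)) (\<phi> ` U)) (mtop M) g"
    using cont continuous_map_in_subtopology by blast
  then show ?thesis
    by (rule continuous_map_eq) (use ts gx inv_chart[OF U] in auto)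
qed

definition coord_box :: "(nat \<Rightarrow> real) \<Rightarrow> real \<Rightarrow> (nat \<Rightarrow> real) set" where
  "coord_box p d = {x \<in> rvec (mdim M). \<forall>i<mdim M. x i \<in> {p i - d<..<p i + d}}"

lemma coord_box_open: "openin (Euclidean_space (mdim M)) (coord_box p d)"
  unfolding coord_box_def
  by (intro openin_Euclidean_finite_Collect open_rvec openin_Euclidean_Collect continuous_on_coord) auto

text \<open>A box is convex, hence star-shaped about each of its points; Hadamard's lemma will be
  applied at arbitrary points of the box.\<close>

lemma coord_box_star:
  assumes "q \<in> coord_box p d"
  shows "star_set q (coord_box p d)"
  unfolding star_set_def
proof (intro ballI)
  fix x t assume x: "x \<in> coord_box p d" and t: "t \<in> {0..1::real}"
  have "q i + t * (x i - q i) \<in> {p i - d<..<p i + d}" if i: "i < mdim M" for i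
  proof -
    have a: "\<bar>x i - p i\<bar> < d" "\<bar>q i - p i\<bar> < d"
      using assms x i by (auto simp: coord_box_def abs_less_iff)
    have "q i + t * (x i - q i) - p i = (1 - t) * (q i - p i) + t * (x i - p i)"
      by (simp add: algebra_simps)
    also have "\<bar>\<dots>\<bar> \<le> (1 - t) * \<bar>q i - p i\<bar> + t * \<bar>x i - p i\<bar>"
      using t by (intro order_trans[OF abs_triangle_ineq]) (simp add: abs_mult)
    also have "\<dots> < d"
      using convex_bound_lt[OF a(2,1), of "1 - t" t] t by simp
    finally show ?thesis by (auto simp: abs_less_iff)
  qed
  then show "(\<lambda>i. q i + t * (x i - q i)) \<in> coord_box p d"
    using assms x by (auto simp: coord_box_def rvec_def)
qed

text \<open>Inside the space of all sequences the closed box is a product of compact sets, intervals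
  below the dimension and \<open>{0}\<close> from there on.\<close>

lemma closed_coord_box_compactin:
  "compactin (Euclidean_space (mdim M)) {x \<in> rvec (mdim M). \<forall>i<mdim M. x i \<in> {p i - d..p i + d}}"
proof -
  let ?S = "\<lambda>i. if i < mdim M then {p i - d..p i + d} else {0}"
  have eq: "{x \<in> rvec (mdim M). \<forall>i<mdim M. x i \<in> {p i - d..p i + d}} = Pi\<^sub>E UNIV ?S"
    by (force simp: rvec_def PiE_def Pi_def not_less)
  have "compactin (powertop_real UNIV) (Pi\<^sub>E UNIV ?S)"
    by (simp add: compactin_PiE)
  moreover have "Pi\<^sub>E UNIV ?S \<subseteq> rvec (mdim M)" unfolding eq[symmetric] by auto
  ultimately show ?thesis
    unfolding eq Euclidean_space_def compactin_subtopology rvec_def[symmetric] by simp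
qed

text \<open>The box is compact in the chart, hence in \<open>M\<close>, hence closed because
  \<open>M\<close> is Hausdorff. This is what allows a bump function in a chart to be extended by
  zero.\<close>

lemma closed_coord_box_chart_closed:
  assumes U: "(U, \<phi>) \<in> matlas M" and K: "{x \<in> rvec (mdim M). \<forall>i<mdim M. x i \<in> {p i - d..p i + d}} \<subseteq> \<phi> ` U"
  shows "closedin (mtop M) {x \<in> U. \<forall>i<mdim M. \<phi> x i \<in> {p i - d..p i + d}}" (is "closedin _ ?C")
proof -
  let ?K = "{x \<in> rvec (mdim M). \<forall>i<mdim M. x i \<in> {p i - d..p i + d}}"
  have "\<phi> ` ?C = ?K"
    using K chart_rvec[OF U] by (auto simp: image_iff subset_iff)
  then have "compactin (subtopology (Euclidean_space (mdim M)) (\<phi> ` U)) (\<phi> ` ?C)"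
    using closed_coord_box_compactin K by (simp add: compactin_subtopology)
  then have "compactin (subtopology (mtop M) U) ?C"
    using homeomorphic_map_compactness_eq[OF chart(3)[OF U], of ?C] chart_topspace[OF U] by auto
  then have "compactin (mtop M) ?C" by (simp add: compactin_subtopology)
  moreover have "Hausdorff_space (mtop M)" using mfd unfolding smooth_manifold_def by blast
  ultimately show ?thesis by (rule compactin_imp_closedin[rotated])
qed

lemma closedin_chart_closed:
  assumes "closedin (mtop M) C"
  shows "chart_closed C"
  unfolding chart_closed_def
proof (intro allI impI)
  fix V \<psi> assume V: "(V, \<psi>) \<in> matlas M"
  show "openin (Euclidean_space (mdim M)) (\<psi> ` (V - C))"
    by (rule chart_image_open[OF V openin_diff[OF chart(1)[OF V] assms]]) auto
qed

definition box_bump :: "(nat \<Rightarrow> real) \<Rightarrow> real \<Rightarrow> (nat \<Rightarrow> real) \<Rightarrow> real" where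
  "box_bump p d x = (\<Prod>i<mdim M. plateau ((x i - p i) / d))"

lemma smooth_on_box_bump:
  assumes "openin (Euclidean_space (mdim M)) W"
  shows "smooth_on (mdim M) W (box_bump p d)"
  unfolding box_bump_def divide_inverse
  by (intro smooth_on_prod smooth_on_compose_line[OF _ open_UNIV smooth_on_plateau]
      smooth_on_mult smooth_on_diff smooth_on_coord smooth_on_const assms) auto

lemma box_bump_1: "d > 0 \<Longrightarrow> (\<And>i. i < mdim M \<Longrightarrow> \<bar>x i - p i\<bar> \<le> d) \<Longrightarrow> box_bump p d x = 1"
  unfolding box_bump_def by (intro prod.neutral ballI plateau_eq_1) (auto simp: abs_divide)

lemma box_bump_0: "d > 0 \<Longrightarrow> i < mdim M \<Longrightarrow> \<bar>x i - p i\<bar> \<ge> 2 * d \<Longrightarrow> box_bump p d x = 0"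
  unfolding box_bump_def
  by (intro prod_zero bexI[of _ i] plateau_eq_0) (auto simp: abs_divide field_simps)

text \<open>\<open>W\<close> is the box on which Hadamard's lemma is used, \<open>C\<close> carries
  the support of \<open>\<rho>\<close>, and on \<open>O1\<close> the bump equals 1. The global
  functions \<open>g i\<close> agree with the coordinates on a whole open neighbourhood
  \<open>D\<close> of \<open>C\<close>, because lifts differentiate them along curves.\<close>

lemma chart_bump:
  assumes U: "(U, \<phi>) \<in> matlas M" and x0: "x0 \<in> U"
  obtains W C O1 D \<rho> g where
    "openin (Euclidean_space (mdim M)) W" "W \<subseteq> \<phi> ` U" "\<And>q. q \<in> W \<Longrightarrow> star_set q W"
    "C \<subseteq> U" "\<phi> ` C \<subseteq> W" "closedin (mtop M) C"
    "\<rho> \<in> sf" "\<And>x. x \<notin> C \<Longrightarrow> \<rho> x = 0"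
    "openin (mtop M) O1" "x0 \<in> O1" "O1 \<subseteq> C" "\<And>x. x \<in> O1 \<Longrightarrow> \<rho> x = 1"
    "openin (mtop M) D" "C \<subseteq> D" "D \<subseteq> U"
    "\<And>i. i < mdim M \<Longrightarrow> g i \<in> sf" "\<And>i x. i < mdim M \<Longrightarrow> x \<in> D \<Longrightarrow> g i x = \<phi> x i"
proof -
  let ?n = "mdim M" and ?p = "\<phi> x0"
  have p: "?p \<in> \<phi> ` U" "?p \<in> rvec ?n" using x0 chart_rvec[OF U] by auto
  obtain e where e: "e > 0" "\<And>x. x \<in> rvec ?n \<Longrightarrow> (\<And>i. i < ?n \<Longrightarrow> \<bar>x i - ?p i\<bar> < e) \<Longrightarrow> x \<in> \<phi> ` U"
    using openin_Euclidean_box[OF chart(2)[OF U] p(1)] by blast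
  \<comment> \<open>Nested boxes of radius \<open>d\<close> (where \<open>\<rho> = 1\<close>),
    \<open>2 * d\<close> (\<open>C\<close>), \<open>3 * d\<close> (\<open>D\<close>),
    \<open>6 * d\<close> (the cut-off defining \<open>g\<close>) and \<open>7 * d\<close>
    (\<open>W\<close>) must fit into the chart, of radius \<open>e = 8 * d\<close>.\<close>
  define d where "d = e / 8"
  have d: "d > 0" using e by (simp add: d_def)
  define W where "W = coord_box ?p (7 * d)"
  define cl where "cl s = {x \<in> U. \<forall>i<?n. \<phi> x i \<in> {?p i - s..?p i + s}}" for s
  define opn where "opn s = {x \<in> U. \<phi> x \<in> coord_box ?p s}" for s
  have opn_iff: "x \<in> opn s \<longleftrightarrow> x \<in> U \<and> (\<forall>i<?n. \<bar>\<phi> x i - ?p i\<bar> < s)" for x s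
    using chart_rvec[OF U] unfolding opn_def coord_box_def by (auto simp: abs_less_iff)
  have cl_iff: "x \<in> cl s \<longleftrightarrow> x \<in> U \<and> (\<forall>i<?n. \<bar>\<phi> x i - ?p i\<bar> \<le> s)" for x s
    unfolding cl_def by (auto simp: abs_le_iff)
  have W: "openin (Euclidean_space ?n) W" "W \<subseteq> \<phi> ` U" "\<And>q. q \<in> W \<Longrightarrow> star_set q W"
    unfolding W_def using coord_box_open coord_box_star
    by (auto intro!: e(2) simp: coord_box_def d_def abs_less_iff)
  have cl: "closedin (mtop M) (cl s)" if "s < e" for s
    unfolding cl_def
    by (rule closed_coord_box_chart_closed[OF U]) (use that in \<open>fastforce intro!: e(2) simp: abs_less_iff\<close>)
  have opn: "openin (mtop M) (opn s)" for s
    unfolding opn_def by (rule chart_preimage_open[OF U coord_box_open])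
  have clW: "\<phi> ` cl s \<subseteq> W" if "s < 7 * d" for s
    using that chart_rvec[OF U] unfolding W_def coord_box_def cl_def by fastforce
  have sub: "opn s \<subseteq> cl s" "s < s' \<Longrightarrow> cl s \<subseteq> opn s'" "opn s \<subseteq> U" "cl s \<subseteq> U" for s s'
    by (force simp: opn_iff cl_iff)+
  define \<rho> where "\<rho> s x = (if x \<in> cl (2 * s) then box_bump ?p s (\<phi> x) else 0)" for s x
  have clo: "chart_closed (cl s)" if "s < 7 * d" for s
    using closedin_chart_closed cl that e(1) by (simp add: d_def)
  have b0: "box_bump ?p s (\<phi> x) = 0" if "x \<in> U" "x \<notin> opn (2 * s)" "s > 0" for x s
    using that box_bump_0[of s _ "\<phi> x" ?p] unfolding opn_iff by (auto simp: not_less)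
  have \<rho>: "\<rho> s \<in> sf" if s: "s > 0" "2 * s < 7 * d" for s
  proof (rule extend_by_zero_smooth[OF U W(1,2) _ clW[OF s(2)] clo[OF s(2)] _ _ smooth_on_box_bump[OF W(1)]])
    show "\<rho> s x = box_bump ?p s (\<phi> x)" if "x \<in> U" for x
      using b0[OF that _ s(1)] sub(1)[of "2 * s"] by (auto simp: \<rho>_def)
  qed (use sub(4) in \<open>auto simp: \<rho>_def\<close>)
  have \<rho>1: "\<rho> s x = 1" if "x \<in> cl s" "s > 0" for s x
    using that box_bump_1[of s "\<phi> x" ?p] unfolding \<rho>_def cl_iff by force
  define g where "g i = cut_off (cl (6 * d)) (\<rho> (3 * d)) (\<lambda>x. \<phi> x i)" for i
  have g: "g i \<in> sf" for i
    unfolding g_def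
    by (rule cut_off_smooth[OF U W(1,2) sub(4) clW clo \<rho> _ smooth_on_coord[OF W(1)]])
      (use d in \<open>auto simp: \<rho>_def\<close>)
  have g\<phi>: "g i x = \<phi> x i" if "x \<in> opn (3 * d)" for i x
  proof -
    have "x \<in> cl (3 * d)" using that sub(1) by blast
    moreover from this have "x \<in> cl (6 * d)" using d by (force simp: cl_iff)
    ultimately show ?thesis using \<rho>1[of x "3 * d"] d by (simp add: g_def cut_off_def)
  qed
  show ?thesis
  proof (rule that[OF W, of "cl (2 * d)" "\<rho> d" "opn d" "opn (3 * d)" g])
    show "opn d \<subseteq> cl (2 * d)" using d by (force simp: opn_iff cl_iff)
    show "cl (2 * d) \<subseteq> opn (3 * d)" using d by (force simp: opn_iff cl_iff)
    show "\<rho> d x = 1" if "x \<in> opn d" for x using \<rho>1 that sub(1) d by blast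
    show "x0 \<in> opn d" using x0 d by (simp add: opn_iff)
    show "closedin (mtop M) (cl (2 * d))" by (rule cl) (use d e(1) in \<open>simp add: d_def\<close>)
    show "\<phi> ` cl (2 * d) \<subseteq> W" by (rule clW) (use d in simp)
    show "\<rho> d \<in> sf" by (rule \<rho>) (use d in auto)
    show "\<rho> d x = 0" if "x \<notin> cl (2 * d)" for x using that by (simp add: \<rho>_def)
  qed (use sub opn g g\<phi> in auto)
qed

end

section \<open>Contact of functions of one variable\<close>

text \<open>Openness of \<open>T\<close> is built in, since an iterated \<open>deriv\<close> depends
  on a neighbourhood.\<close>

definition smooth1 :: "real set \<Rightarrow> (real \<Rightarrow> real) \<Rightarrow> bool" where
  "smooth1 T u \<longleftrightarrow> open T \<and> (\<forall>k. \<forall>t\<in>T. (deriv ^^ k) u differentiable (at t))"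

lemma smooth1_iff_line: "open T \<Longrightarrow> smooth1 T u \<longleftrightarrow> smooth_on 1 (line T) (\<lambda>x. u (x 0))"
  using smooth_on_line_iff[of T u] by (simp add: smooth1_def)

lemma smooth1_open: "smooth1 T u \<Longrightarrow> open T"
  by (simp add: smooth1_def)

lemma smooth1_line: "smooth1 T u \<Longrightarrow> smooth_on 1 (line T) (\<lambda>x. u (x 0))"
  using smooth1_iff_line smooth1_open by metis

lemma smooth1_lineI: "open T \<Longrightarrow> smooth_on 1 (line T) (\<lambda>x. u (x 0)) \<Longrightarrow> smooth1 T u"
  by (simp only: smooth1_iff_line)

lemma smooth1_subset: "smooth1 T u \<Longrightarrow> open S \<Longrightarrow> S \<subseteq> T \<Longrightarrow> smooth1 S u"
  unfolding smooth1_def by (meson subsetD)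

lemma smooth1_DERIV: "smooth1 T u \<Longrightarrow> t \<in> T \<Longrightarrow> (u has_real_derivative deriv u t) (at t)"
  unfolding smooth1_def by (metis DERIV_deriv_iff_real_differentiable funpow_0)

lemma smooth1_deriv: "smooth1 T u \<Longrightarrow> smooth1 T (deriv u)"
  unfolding smooth1_def by (metis funpow_Suc_right comp_apply)

lemma smooth1_const: "open T \<Longrightarrow> smooth1 T (\<lambda>t. c)"
  using smooth_on_const[OF openin_line] smooth1_iff_line by blast

lemma smooth1_ident: "open T \<Longrightarrow> smooth1 T (\<lambda>t. t)"
  unfolding smooth1_iff_line by (rule smooth_on_coord[OF openin_line])

lemma smooth1_mult: "smooth1 T u \<Longrightarrow> smooth1 T v \<Longrightarrow> smooth1 T (\<lambda>t. u t * v t)"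
  by (rule smooth1_lineI[of T "\<lambda>t. u t * v t"])
    (erule smooth1_open, rule smooth_on_mult[OF openin_line[OF smooth1_open]], assumption, (erule smooth1_line)+)

lemma smooth1_sum:
  "open T \<Longrightarrow> finite I \<Longrightarrow> (\<And>i. i \<in> I \<Longrightarrow> smooth1 T (f i)) \<Longrightarrow> smooth1 T (\<lambda>t. \<Sum>i\<in>I. f i t)"
  unfolding smooth1_iff_line by (rule smooth_on_sum[OF openin_line])

lemma smooth1_power: "smooth1 T u \<Longrightarrow> smooth1 T (\<lambda>t. u t ^ m)"
  by (rule smooth1_lineI[of T "\<lambda>t. u t ^ m"])
    (erule smooth1_open, rule smooth_on_power[OF openin_line[OF smooth1_open]], assumption, erule smooth1_line)

lemma smooth1_compose:
  assumes "openin (Euclidean_space n) W" "smooth_on n W G" "open T"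
    and "\<And>i. i < n \<Longrightarrow> smooth1 T (\<lambda>t. c t i)" "\<And>t. t \<in> T \<Longrightarrow> c t \<in> W"
  shows "smooth1 T (\<lambda>t. G (c t))"
  unfolding smooth1_iff_line[OF assms(3)]
  by (rule smooth_on_compose[OF openin_line[OF assms(3)] assms(1,2), where h = "\<lambda>x. c (x 0)"])
    (use assms(4,5) smooth1_line in \<open>auto simp: line_def\<close>)

lemma deriv_pow_cong:
  assumes "open T" "\<And>t. t \<in> T \<Longrightarrow> u t = v t" "t \<in> T"
  shows "(deriv ^^ k) u t = (deriv ^^ k) v t"
  using assms(3)
proof (induction k arbitrary: t)
  case 0
  then show ?case using assms(2) by simp
next
  case (Suc k)
  have "\<forall>\<^sub>F s in nhds t. (deriv ^^ k) u s = (deriv ^^ k) v s"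
    using eventually_nhds_in_open[OF assms(1) Suc.prems] by eventually_elim (rule Suc.IH)
  then show ?case by (auto intro!: deriv_cong_ev)
qed

lemma smooth1_cong: 
  assumes "smooth1 T u" "\<And>t. t \<in> T \<Longrightarrow> u t = v t"
  shows "smooth1 T v"
proof -
  have o: "open T" by (rule smooth1_open[OF assms(1)])
  have "(deriv ^^ k) v differentiable (at t)" if "t \<in> T" for k t
  proof -
    have "((deriv ^^ k) u has_real_derivative deriv ((deriv ^^ k) u) t) (at t)"
      using assms(1) that unfolding smooth1_def by (simp add: DERIV_deriv_iff_real_differentiable)
    moreover have "\<forall>\<^sub>F s in nhds t. (deriv ^^ k) u s = (deriv ^^ k) v s"
      using eventually_nhds_in_open[OF o that] by eventually_elim (rule deriv_pow_cong[OF o assms(2)])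
    ultimately have "((deriv ^^ k) v has_real_derivative deriv ((deriv ^^ k) u) t) (at t)"
      using DERIV_cong_ev[OF refl _ refl] by metis
    then show ?thesis by (auto simp: real_differentiable_def)
  qed
  then show ?thesis using o by (simp add: smooth1_def)
qed

definition contact :: "nat \<Rightarrow> (real \<Rightarrow> real) \<Rightarrow> (real \<Rightarrow> real) \<Rightarrow> bool" where
  "contact k u v \<longleftrightarrow> (\<forall>m\<le>k. (deriv ^^ m) u 0 = (deriv ^^ m) v 0)"

lemma contact_0: "contact 0 u v \<longleftrightarrow> u 0 = v 0"
  by (simp add: contact_def)

text \<open>The recursion behind all closure properties of contact: they follow by induction from
  the first-order rules for sums, products and compositions, in place of higher Leibniz and Faa di
  Bruno formulas.\<close>

lemma contact_Suc: "contact (Suc k) u v \<longleftrightarrow> u 0 = v 0 \<and> contact k (deriv u) (deriv v)"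
proof
  assume L: "contact (Suc k) u v"
  have "(deriv ^^ m) (deriv u) 0 = (deriv ^^ m) (deriv v) 0" if "m \<le> k" for m
    using L that unfolding contact_def by (metis Suc_le_mono comp_apply funpow_Suc_right)
  then show "u 0 = v 0 \<and> contact k (deriv u) (deriv v)"
    using L by (auto simp: contact_def)
next
  assume R: "u 0 = v 0 \<and> contact k (deriv u) (deriv v)"
  have "(deriv ^^ m) u 0 = (deriv ^^ m) v 0" if "m \<le> Suc k" for m
  proof (cases m)
    case 0
    then show ?thesis using R by simp
  next
    case (Suc l)
    then show ?thesis using R that unfolding contact_def by (metis Suc_le_mono comp_apply funpow_Suc_right)
  qed
  then show "contact (Suc k) u v" by (simp add: contact_def)
qed

lemma contact_mono: "contact k u v \<Longrightarrow> m \<le> k \<Longrightarrow> contact m u v"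
  by (simp add: contact_def)

lemma contact_refl: "contact k u u"
  by (simp add: contact_def)

lemma contact_cong:
  assumes "open T" "0 \<in> T" "\<And>t. t \<in> T \<Longrightarrow> u t = u' t" "\<And>t. t \<in> T \<Longrightarrow> v t = v' t" "contact k u v"
  shows "contact k u' v'"
  using assms(5) unfolding contact_def
  by (simp only: deriv_pow_cong[OF assms(1,3,2)] deriv_pow_cong[OF assms(1,4,2)])

lemma contact_add:
  assumes "0 \<in> T" "smooth1 T u" "smooth1 T u'" "smooth1 T v" "smooth1 T v'" "contact k u v" "contact k u' v'"
  shows "contact k (\<lambda>t. u t + u' t) (\<lambda>t. v t + v' t)"
  using assms(2-)
proof (induction k arbitrary: u u' v v')
  case 0
  then show ?case by (simp add: contact_0)
next
  case (Suc k)
  have d: "deriv (\<lambda>t. a t + b t) t = deriv a t + deriv b t" if "smooth1 T a" "smooth1 T b" "t \<in> T" for a b t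
    using that by (intro DERIV_imp_deriv DERIV_add smooth1_DERIV)
  have "contact k (\<lambda>t. deriv u t + deriv u' t) (\<lambda>t. deriv v t + deriv v' t)"
    using Suc.prems by (intro Suc.IH smooth1_deriv) (auto simp: contact_Suc)
  then have "contact k (deriv (\<lambda>t. u t + u' t)) (deriv (\<lambda>t. v t + v' t))"
    by (rule contact_cong[OF smooth1_open[OF Suc.prems(1)] assms(1), rotated 2]) (use d Suc.prems in auto)
  then show ?case using Suc.prems by (simp add: contact_Suc)
qed

lemma contact_mult:
  assumes "0 \<in> T" "smooth1 T u" "smooth1 T u'" "smooth1 T v" "smooth1 T v'" "contact k u v" "contact k u' v'"
  shows "contact k (\<lambda>t. u t * u' t) (\<lambda>t. v t * v' t)"
  using assms(2-)
proof (induction k arbitrary: u u' v v')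
  case 0
  then show ?case by (simp add: contact_0)
next
  case (Suc k)
  have d: "deriv (\<lambda>t. a t * b t) t = deriv a t * b t + deriv b t * a t" if "smooth1 T a" "smooth1 T b" "t \<in> T" for a b t
    using that by (intro DERIV_imp_deriv DERIV_mult smooth1_DERIV)
  have "contact k (\<lambda>t. deriv u t * u' t) (\<lambda>t. deriv v t * v' t)"
    using Suc.prems contact_mono[OF Suc.prems(6)] by (intro Suc.IH smooth1_deriv) (auto simp: contact_Suc)
  moreover have "contact k (\<lambda>t. deriv u' t * u t) (\<lambda>t. deriv v' t * v t)"
    using Suc.prems contact_mono[OF Suc.prems(5)] by (intro Suc.IH smooth1_deriv) (auto simp: contact_Suc)
  ultimately have "contact k (\<lambda>t. deriv u t * u' t + deriv u' t * u t) (\<lambda>t. deriv v t * v' t + deriv v' t * v t)"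
    using Suc.prems by (intro contact_add[OF assms(1)] smooth1_mult smooth1_deriv)
  then have "contact k (deriv (\<lambda>t. u t * u' t)) (deriv (\<lambda>t. v t * v' t))"
    by (rule contact_cong[OF smooth1_open[OF Suc.prems(1)] assms(1), rotated 2]) (use d Suc.prems in auto)
  then show ?case using Suc.prems by (simp add: contact_Suc)
qed

lemma contact_sum:
  assumes "finite I" "0 \<in> T" "open T" "\<And>i. i \<in> I \<Longrightarrow> smooth1 T (u i)" "\<And>i. i \<in> I \<Longrightarrow> smooth1 T (v i)"
    "\<And>i. i \<in> I \<Longrightarrow> contact k (u i) (v i)"
  shows "contact k (\<lambda>t. \<Sum>i\<in>I. u i t) (\<lambda>t. \<Sum>i\<in>I. v i t)"
  using assms(1,4-)
proof (induction I rule: finite_induct)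
  case empty
  then show ?case by (simp add: contact_refl)
next
  case (insert i I)
  then have "contact k (\<lambda>t. u i t + (\<Sum>i\<in>I. u i t)) (\<lambda>t. v i t + (\<Sum>i\<in>I. v i t))"
    by (intro contact_add[OF assms(2)] smooth1_sum assms(3)) auto
  then show ?case using insert by simp
qed

text \<open>The derivative of \<open>G \<circ> c\<close> involves the functions
  \<open>partial_deriv i G \<circ> c\<close>, to which the induction hypothesis applies because it
  is stated for all smooth \<open>G\<close>, and the derivatives of the coordinates of
  \<open>c\<close>.\<close>

lemma contact_compose:
  assumes W: "openin (Euclidean_space n) W" and G: "smooth_on n W G" and T: "open T" "0 \<in> T"
    and c: "\<And>i. i < n \<Longrightarrow> smooth1 T (\<lambda>t. c t i)" "\<And>t. t \<in> T \<Longrightarrow> c t \<in> W"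
    and d: "\<And>i. i < n \<Longrightarrow> smooth1 T (\<lambda>t. d t i)" "\<And>t. t \<in> T \<Longrightarrow> d t \<in> W"
    and cd: "\<And>i. i < n \<Longrightarrow> contact k (\<lambda>t. c t i) (\<lambda>t. d t i)"
  shows "contact k (\<lambda>t. G (c t)) (\<lambda>t. G (d t))"
proof -
  \<comment> \<open>Contact controls the first \<open>n\<close> coordinates; the others vanish
    because both points lie in \<open>rvec n\<close>.\<close>
  have "c 0 i = d 0 i" for i
  proof (cases "i < n")
    case True
    then show ?thesis using contact_mono[OF cd[OF True], of 0] by (simp add: contact_0)
  next
    case False
    then show ?thesis using c(2) d(2) T(2) openin_Euclidean_subset[OF W] rvec_0 by (metis subsetD)
  qed
  then have cd0: "c 0 = d 0" by auto
  show ?thesis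
  using G cd
proof (induction k arbitrary: G)
  case 0
  then show ?case using cd0 by (simp add: contact_0)
next
  case (Suc k)
  have D: "deriv (\<lambda>t. G (e t)) t = (\<Sum>i<n. partial_deriv i G (e t) * deriv (\<lambda>t. e t i) t)"
    if e: "\<And>i. i < n \<Longrightarrow> smooth1 T (\<lambda>t. e t i)" "\<And>t. t \<in> T \<Longrightarrow> e t \<in> W" and t: "t \<in> T" for e t
  proof (rule DERIV_imp_deriv, rule has_real_derivative_compose_partial[OF W Suc.prems(1)])
    show "\<forall>\<^sub>F t in nhds t. e t \<in> rvec n"
      using eventually_nhds_in_open[OF T(1) t] by eventually_elim (use e(2) openin_Euclidean_subset[OF W] in blast)
    show "e t \<in> W" by (rule e(2)[OF t])
    show "((\<lambda>t. e t i) has_real_derivative deriv (\<lambda>t. e t i) t) (at t)" if "i < n" for i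
      by (rule smooth1_DERIV[OF e(1)[OF that] t])
  qed
  have "contact k (\<lambda>t. partial_deriv i G (c t)) (\<lambda>t. partial_deriv i G (d t))" if "i < n" for i
    by (rule Suc.IH[OF smooth_on_partial_deriv[OF W Suc.prems(1) that]])
      (rule contact_mono[OF Suc.prems(2)], simp_all)
  moreover have "contact k (deriv (\<lambda>t. c t i)) (deriv (\<lambda>t. d t i))" if "i < n" for i
    using Suc.prems(2)[OF that] by (simp add: contact_Suc)
  moreover have "smooth1 T (\<lambda>t. partial_deriv i G (c t))" "smooth1 T (\<lambda>t. partial_deriv i G (d t))" if "i < n" for i
    using smooth1_compose[OF W smooth_on_partial_deriv[OF W Suc.prems(1) that] T(1)] c d by auto
  ultimately have "contact k (\<lambda>t. \<Sum>i<n. partial_deriv i G (c t) * deriv (\<lambda>t. c t i) t)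
      (\<lambda>t. \<Sum>i<n. partial_deriv i G (d t) * deriv (\<lambda>t. d t i) t)"
    by (intro contact_sum[OF _ T(2,1)] contact_mult[OF T(2)] smooth1_mult)
      (auto intro!: smooth1_deriv c(1) d(1))
  then have "contact k (deriv (\<lambda>t. G (c t))) (deriv (\<lambda>t. G (d t)))"
    by (rule contact_cong[OF T(1,2), rotated 2]) (use D[of c] D[of d] c d in auto)
  then show ?case using cd0 by (simp add: contact_Suc)
qed
qed

text \<open>The source of all weights: each differentiation of \<open>u (s * t)\<close> releases one
  factor \<open>s\<close>.\<close>

lemma deriv_pow_scale:
  assumes "smooth1 T u" "s * t \<in> T"
  shows "(deriv ^^ k) (\<lambda>t. u (s * t)) t = s ^ k * (deriv ^^ k) u (s * t)"
  using assms(2)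
proof (induction k arbitrary: t)
  case 0
  then show ?case by simp
next
  case (Suc k)
  let ?S = "(\<lambda>t. s * t) -` T"
  have S: "open ?S" "t \<in> ?S"
    using Suc.prems by (auto intro!: open_vimage smooth1_open[OF assms(1)] continuous_intros)
  have "\<forall>\<^sub>F t in nhds t. (deriv ^^ k) (\<lambda>t. u (s * t)) t = s ^ k * (deriv ^^ k) u (s * t)"
    using eventually_nhds_in_open[OF S] by eventually_elim (simp add: Suc.IH)
  then have "deriv ((deriv ^^ k) (\<lambda>t. u (s * t))) t = deriv (\<lambda>t. s ^ k * (deriv ^^ k) u (s * t)) t"
    by (rule deriv_cong_ev) simp
  also have "\<dots> = s ^ k * ((deriv ^^ Suc k) u (s * t) * s)"
  proof (rule DERIV_imp_deriv, rule DERIV_cmult)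
    have "((deriv ^^ k) u has_real_derivative (deriv ^^ Suc k) u (s * t)) (at (s * t))"
      using assms(1) Suc.prems unfolding smooth1_def by (simp add: DERIV_deriv_iff_real_differentiable)
    moreover have "((\<lambda>t. s * t) has_real_derivative s) (at t)"
      by (auto intro!: derivative_eq_intros)
    ultimately show "((\<lambda>t. (deriv ^^ k) u (s * t)) has_real_derivative (deriv ^^ Suc k) u (s * t) * s) (at t)"
      by (rule DERIV_chain2)
  qed
  finally show ?case by simp
qed

lemma smooth1_scale:
  assumes "smooth1 T u"
  shows "smooth1 ((\<lambda>t. s * t) -` T) (\<lambda>t. u (s * t))"
proof -
  have o: "open ((\<lambda>t. s * t) -` T)"
    by (intro open_vimage smooth1_open[OF assms] continuous_intros)
  have "smooth_on 1 (line ((\<lambda>t. s * t) -` T)) (\<lambda>x. u (s * x 0))"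
  proof (rule smooth_on_compose_line[OF openin_line[OF o] smooth1_open[OF assms] smooth1_line[OF assms]])
    show "smooth_on 1 (line ((\<lambda>t. s * t) -` T)) (\<lambda>x. s * x 0)"
      by (intro smooth_on_mult smooth_on_const smooth_on_coord openin_line[OF o])
  qed (simp add: line_def)
  then show ?thesis using smooth1_iff_line[OF o] by simp
qed

lemma deriv_pow_poly: "(deriv ^^ k) (poly p) = poly ((pderiv ^^ k) p)" for p :: "real poly"
proof (induction k)
  case (Suc k)
  have "deriv (poly q) = poly (pderiv q)" for q :: "real poly"
    using DERIV_imp_deriv[OF poly_DERIV] by blast
  then show ?case using Suc by simp
qed simp

lemma deriv_pow_polynomial_0:
  assumes "k \<le> r"
  shows "(deriv ^^ k) (\<lambda>t. \<Sum>m\<le>r. a m * t ^ m) (0::real) = fact k * a k"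
proof -
  define p where "p = (\<Sum>m\<le>r. monom (a m) m)"
  have "poly p = (\<lambda>t. \<Sum>m\<le>r. a m * t ^ m)"
    by (simp add: p_def poly_sum poly_monom fun_eq_iff)
  then have "(deriv ^^ k) (\<lambda>t. \<Sum>m\<le>r. a m * t ^ m) 0 = poly ((pderiv ^^ k) p) 0"
    using deriv_pow_poly by metis
  also have "\<dots> = fact k * coeff p k"
    by (simp add: poly_0_coeff_0 coeff_higher_pderiv pochhammer_fact)
  also have "coeff p k = a k"
    using assms by (simp add: p_def coeff_sum)
  finally show ?thesis .
qed

section \<open>Jets of curves\<close>

locale jet_mfd = smooth_mfd M for M :: "'a manifold" + fixes r :: nat
begin

abbreviation "n \<equiv> mdim M"
abbreviation "JB \<equiv> jet_bundle M r"

lemma curve_open: "smooth_curve M \<gamma> \<Longrightarrow> openin (mtop M) U \<Longrightarrow> open {t. \<gamma> t \<in> U}"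
  using openin_continuous_map_preimage[of euclideanreal "mtop M" \<gamma> U]
  unfolding smooth_curve_def by (simp add: open_openin[symmetric])

lemma curve_points: "smooth_curve M \<gamma> \<Longrightarrow> \<gamma> t \<in> points M"
  unfolding smooth_curve_def continuous_map_def by auto

lemma curve_smooth1:
  assumes "smooth_curve M \<gamma>" "(U, \<phi>) \<in> matlas M" "i < n"
  shows "smooth1 {t. \<gamma> t \<in> U} (\<lambda>t. \<phi> (\<gamma> t) i)"
  using assms curve_open[OF assms(1) chart(1)[OF assms(2)]]
  unfolding smooth_curve_def smooth1_def by fast

lemma curve_function_smooth1:
  assumes \<gamma>: "smooth_curve M \<gamma>" and U: "(U, \<phi>) \<in> matlas M" and f: "f \<in> sf"
  shows "smooth1 {t. \<gamma> t \<in> U} (\<lambda>t. f (\<gamma> t))"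
proof -
  have "smooth1 {t. \<gamma> t \<in> U} (\<lambda>t. f (inv_into U \<phi> (\<phi> (\<gamma> t))))"
    by (rule smooth1_compose[OF chart(2)[OF U] sf_chart[OF f U] curve_open[OF \<gamma> chart(1)[OF U]]
        curve_smooth1[OF \<gamma> U]]) auto
  then show ?thesis by (rule smooth1_cong) (simp add: inv_chart[OF U])
qed

lemma point_chart:
  assumes "x \<in> points M"
  obtains U \<phi> where "(U, \<phi>) \<in> matlas M" "x \<in> U"
  using assms unfolding points_eq by auto

lemma jet_equiv_contact:
  "jet_equiv M r \<gamma> \<eta> \<longleftrightarrow> \<gamma> 0 = \<eta> 0 \<and>
    (\<forall>U \<phi>. (U, \<phi>) \<in> matlas M \<and> \<gamma> 0 \<in> U \<longrightarrow> (\<forall>i<n. contact r (\<lambda>t. \<phi> (\<gamma> t) i) (\<lambda>t. \<phi> (\<eta> t) i)))"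
  unfolding jet_equiv_def contact_def by auto

lemma jet_equiv_sym: "jet_equiv M r \<gamma> \<eta> \<Longrightarrow> jet_equiv M r \<eta> \<gamma>"
  unfolding jet_equiv_contact contact_def by simp

lemma jet_equiv_trans: "jet_equiv M r \<gamma> \<eta> \<Longrightarrow> jet_equiv M r \<eta> \<zeta> \<Longrightarrow> jet_equiv M r \<gamma> \<zeta>"
  unfolding jet_equiv_contact contact_def by simp

text \<open>Smoothness of \<open>f\<close> is asked only on \<open>B\<close>, so that besides global
  functions the components of another chart are covered, with \<open>B\<close> the overlap of the
  domains.\<close>

lemma contact_function_in_chart:
  assumes \<gamma>: "smooth_curve M \<gamma>" and \<eta>: "smooth_curve M \<eta>" and U: "(U, \<phi>) \<in> matlas M" "\<gamma> 0 \<in> U"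
    and eq: "\<gamma> 0 = \<eta> 0" "\<And>i. i < n \<Longrightarrow> contact r (\<lambda>t. \<phi> (\<gamma> t) i) (\<lambda>t. \<phi> (\<eta> t) i)"
    and B: "openin (mtop M) B" "B \<subseteq> U" "\<gamma> 0 \<in> B" and G: "smooth_on n (\<phi> ` B) (\<lambda>y. f (inv_into U \<phi> y))"
  shows "contact r (\<lambda>t. f (\<gamma> t)) (\<lambda>t. f (\<eta> t))"
proof -
  let ?T = "{t. \<gamma> t \<in> B} \<inter> {t. \<eta> t \<in> B}"
  have T: "open ?T" "0 \<in> ?T" using curve_open \<gamma> \<eta> B eq by auto
  have s: "smooth1 ?T (\<lambda>t. \<phi> (\<gamma> t) i)" "smooth1 ?T (\<lambda>t. \<phi> (\<eta> t) i)" if "i < n" for i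
    by (rule smooth1_subset[OF curve_smooth1[OF \<gamma> U(1) that] T(1)], use B(2) in blast)
      (rule smooth1_subset[OF curve_smooth1[OF \<eta> U(1) that] T(1)], use B(2) in blast)
  have "contact r (\<lambda>t. f (inv_into U \<phi> (\<phi> (\<gamma> t)))) (\<lambda>t. f (inv_into U \<phi> (\<phi> (\<eta> t))))"
    by (rule contact_compose[OF chart_image_open[OF U(1) B(1,2)] G T, where c = "\<lambda>t. \<phi> (\<gamma> t)" and d = "\<lambda>t. \<phi> (\<eta> t)"])
      (use s eq in auto)
  then show ?thesis
    by (rule contact_cong[OF T, rotated 2]) (use B(2) inv_chart[OF U(1)] in auto)
qed

text \<open>Equality of jets quantifies over all charts, but one chart suffices, since transition
  functions preserve contact.\<close>

lemma jet_equivI: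
  assumes \<gamma>: "smooth_curve M \<gamma>" and \<eta>: "smooth_curve M \<eta>" and U: "(U, \<phi>) \<in> matlas M" "\<gamma> 0 \<in> U"
    and eq: "\<gamma> 0 = \<eta> 0" "\<And>i. i < n \<Longrightarrow> contact r (\<lambda>t. \<phi> (\<gamma> t) i) (\<lambda>t. \<phi> (\<eta> t) i)"
  shows "jet_equiv M r \<gamma> \<eta>"
  unfolding jet_equiv_contact
proof (intro conjI allI impI)
  fix V \<psi> i assume V: "(V, \<psi>) \<in> matlas M \<and> \<gamma> 0 \<in> V" and i: "i < n"
  show "contact r (\<lambda>t. \<psi> (\<gamma> t) i) (\<lambda>t. \<psi> (\<eta> t) i)"
    using V chart(1) U transition[OF U(1) _ i]
    by (intro contact_function_in_chart[OF \<gamma> \<eta> U eq, of "U \<inter> V" "\<lambda>x. \<psi> x i"]) auto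
qed (rule eq)

text \<open>Makes the values of \<open>fun_lift\<close> independent of the representative picked by
  \<open>jet_rep\<close>.\<close>

lemma contact_function:
  assumes \<gamma>: "smooth_curve M \<gamma>" and \<eta>: "smooth_curve M \<eta>" and eq: "jet_equiv M r \<gamma> \<eta>" and f: "f \<in> sf"
  shows "contact r (\<lambda>t. f (\<gamma> t)) (\<lambda>t. f (\<eta> t))"
proof -
  obtain U \<phi> where U: "(U, \<phi>) \<in> matlas M" "\<gamma> 0 \<in> U" by (rule point_chart[OF curve_points[OF \<gamma>]])
  show ?thesis
    using eq U by (intro contact_function_in_chart[OF \<gamma> \<eta> U _ _ chart(1)[OF U(1)] _ _ sf_chart[OF f U(1)]])
      (auto simp: jet_equiv_contact)
qed

lemma jet_of_mem: "smooth_curve M \<gamma> \<Longrightarrow> \<gamma> \<in> jet_of M r \<gamma>"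
  by (simp add: jet_of_def jet_equiv_contact contact_refl)

lemma jet_of_eq: "jet_equiv M r \<gamma> \<eta> \<Longrightarrow> jet_of M r \<gamma> = jet_of M r \<eta>"
  unfolding jet_of_def using jet_equiv_sym jet_equiv_trans by blast

lemma jet_rep_jet_of:
  assumes "smooth_curve M \<gamma>"
  shows "smooth_curve M (jet_rep (jet_of M r \<gamma>))" "jet_equiv M r \<gamma> (jet_rep (jet_of M r \<gamma>))"
proof -
  have "jet_rep (jet_of M r \<gamma>) \<in> jet_of M r \<gamma>"
    unfolding jet_rep_def using jet_of_mem[OF assms]
    by (rule someI[of "\<lambda>\<eta>. \<eta> \<in> jet_of M r \<gamma>"])
  then show "smooth_curve M (jet_rep (jet_of M r \<gamma>))" "jet_equiv M r \<gamma> (jet_rep (jet_of M r \<gamma>))"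
    by (auto simp: jet_of_def)
qed

lemma jets_rep:
  assumes "j \<in> jets M r"
  shows "smooth_curve M (jet_rep j)" "jet_of M r (jet_rep j) = j"
proof -
  obtain \<gamma> where \<gamma>: "smooth_curve M \<gamma>" "j = jet_of M r \<gamma>" using assms by (auto simp: jets_def)
  show "smooth_curve M (jet_rep j)" "jet_of M r (jet_rep j) = j"
    using jet_rep_jet_of(1)[OF \<gamma>(1)] jet_of_eq[OF jet_rep_jet_of(2)[OF \<gamma>(1)]] \<gamma>(2) by simp_all
qed

lemma jet_of_jets: "smooth_curve M \<gamma> \<Longrightarrow> jet_of M r \<gamma> \<in> jets M r"
  by (simp add: jets_def)

lemma jet_rep_0: "smooth_curve M \<gamma> \<Longrightarrow> jet_rep (jet_of M r \<gamma>) 0 = \<gamma> 0"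
  using jet_rep_jet_of(2) by (simp add: jet_equiv_contact)

section \<open>Induced charts of the jet bundle\<close>

definition jdom :: "'a set \<Rightarrow> 'a jet set" where
  "jdom U = {j \<in> jets M r. jet_rep j 0 \<in> U}"

definition jcoord :: "('a \<Rightarrow> nat \<Rightarrow> real) \<Rightarrow> 'a jet \<Rightarrow> nat \<Rightarrow> real" where
  "jcoord \<phi> = (\<lambda>j k. if k < n * Suc r
     then (deriv ^^ (k div n)) (\<lambda>t. \<phi> (jet_rep j t) (k mod n)) 0 / fact (k div n) else 0)"

lemma jet_chart_eq: "jet_chart M r (U, \<phi>) = (jdom U, jcoord \<phi>)"
  by (simp add: jet_chart_def jdom_def jcoord_def)

lemma mdim_JB: "mdim JB = n * Suc r"
  by (simp add: jet_bundle_def)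

lemma matlas_JB: "(V, \<Phi>) \<in> matlas JB \<longleftrightarrow> (\<exists>U \<phi>. (U, \<phi>) \<in> matlas M \<and> V = jdom U \<and> \<Phi> = jcoord \<phi>)"
  by (force simp: jet_bundle_def image_iff jet_chart_eq)

lemma jcoord_rvec: "jcoord \<phi> j \<in> rvec (n * Suc r)"
  by (simp add: jcoord_def rvec_def)

lemma jets_cover: "j \<in> jets M r \<Longrightarrow> \<exists>U \<phi>. (U, \<phi>) \<in> matlas M \<and> j \<in> jdom U"
  using point_chart[OF curve_points[OF jets_rep(1)]] unfolding jdom_def by blast

lemma points_JB: "points JB = jets M r"
proof -
  have "points JB = (\<Union>(V, \<Phi>)\<in>jet_chart M r ` matlas M. V)"
  proof -
    let ?G = "{{j \<in> V. \<Phi> j \<in> W} | V \<Phi> W.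
         (V, \<Phi>) \<in> jet_chart M r ` matlas M \<and> openin (Euclidean_space (n * Suc r)) W}"
    have "\<Union>?G = (\<Union>(V, \<Phi>)\<in>jet_chart M r ` matlas M. V)"
    proof
      show "(\<Union>(V, \<Phi>)\<in>jet_chart M r ` matlas M. V) \<subseteq> \<Union>?G"
      proof
        fix j assume "j \<in> (\<Union>(V, \<Phi>)\<in>jet_chart M r ` matlas M. V)"
        then obtain U \<phi> where U: "(U, \<phi>) \<in> matlas M" "j \<in> jdom U"
          by (auto simp: jet_chart_eq)
        have "(jdom U, jcoord \<phi>) \<in> jet_chart M r ` matlas M"
          using U(1) jet_chart_eq by (metis image_eqI)
        \<comment> \<open>Taking the whole model space for \<open>W\<close> puts the full chart
          domain among the generators of the topology.\<close>
        then have "{j \<in> jdom U. jcoord \<phi> j \<in> rvec (n * Suc r)} \<in> ?G"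
          using open_rvec by blast
        then show "j \<in> \<Union>?G" using U(2) jcoord_rvec by blast
      qed
    qed auto
    then show ?thesis by (simp add: jet_bundle_def)
  qed
  also have "\<dots> = (\<Union>(U, \<phi>)\<in>matlas M. jdom U)"
    by (auto simp: jet_chart_eq)
  also have "\<dots> = jets M r"
    using jets_cover by (fastforce simp: jdom_def)
  finally show ?thesis .
qed

lemma index_split:
  assumes "k < n * Suc r"
  shows "k div n \<le> r" "k mod n < n" "(k div n) * n + k mod n = k"
proof -
  have "n > 0" using assms by (cases n) auto
  then show "k mod n < n" by simp
  show "k div n \<le> r" using less_mult_imp_div_less[of k "Suc r" n] assms by (simp add: mult.commute)
qed simp

lemma index_join:
  assumes "i < n" "m \<le> r"
  shows "m * n + i < n * Suc r" "(m * n + i) div n = m" "(m * n + i) mod n = i"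
proof -
  have "m * n + i < Suc m * n" using assms(1) by simp
  also have "\<dots> \<le> Suc r * n" using assms(2) by (intro mult_le_mono1) simp
  finally show "m * n + i < n * Suc r" by (simp add: mult.commute)
qed (use assms in auto)

lemma jcoord_jet_of:
  assumes \<gamma>: "smooth_curve M \<gamma>" "\<gamma> 0 \<in> U" and U: "(U, \<phi>) \<in> matlas M" and k: "k < n * Suc r"
  shows "jcoord \<phi> (jet_of M r \<gamma>) k = (deriv ^^ (k div n)) (\<lambda>t. \<phi> (\<gamma> t) (k mod n)) 0 / fact (k div n)"
  using jet_rep_jet_of(2)[OF \<gamma>(1)] \<gamma>(2) U k index_split[OF k]
  by (simp add: jcoord_def jet_equiv_contact contact_def)

lemma fun_lift_jet_of:
  assumes \<gamma>: "smooth_curve M \<gamma>" and f: "f \<in> sf" and k: "k \<le> r"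
  shows "fun_lift M r (int k) f (jet_of M r \<gamma>) = (deriv ^^ k) (\<lambda>t. f (\<gamma> t)) 0 / fact k"
  using contact_function[OF \<gamma> jet_rep_jet_of[OF \<gamma>] f] k jet_of_jets[OF \<gamma>]
  by (simp add: fun_lift_def points_JB contact_def)

text \<open>The coordinates with \<open>\<mu> = 0\<close> sit at the positions below
  \<open>n\<close>, so \<open>base\<close> is the bundle projection in coordinates.\<close>

definition base :: "(nat \<Rightarrow> real) \<Rightarrow> nat \<Rightarrow> real" where
  "base y = (\<lambda>i. if i < n then y i else 0)"

lemma base_jcoord:
  assumes U: "(U, \<phi>) \<in> matlas M" and j: "j \<in> jdom U"
  shows "base (jcoord \<phi> j) = \<phi> (jet_rep j 0)"
proof
  fix i
  have "jet_rep j 0 \<in> U" using j by (simp add: jdom_def)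
  then have "\<phi> (jet_rep j 0) i = 0" if "\<not> i < n" using rvec_0[OF chart_rvec[OF U] that] by simp
  then show "base (jcoord \<phi> j) i = \<phi> (jet_rep j 0) i"
    using index_join[of i 0] by (auto simp: base_def jcoord_def)
qed

lemma jcoord_inj:
  assumes U: "(U, \<phi>) \<in> matlas M"
  shows "inj_on (jcoord \<phi>) (jdom U)"
proof (rule inj_onI)
  fix j j' assume j: "j \<in> jdom U" "j' \<in> jdom U" and eq: "jcoord \<phi> j = jcoord \<phi> j'"
  have jj: "j \<in> jets M r" "j' \<in> jets M r" "jet_rep j 0 \<in> U" "jet_rep j' 0 \<in> U" using j by (auto simp: jdom_def)
  have "\<phi> (jet_rep j 0) = \<phi> (jet_rep j' 0)"
    using base_jcoord[OF U] j eq by metis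
  then have 0: "jet_rep j 0 = jet_rep j' 0"
    using chart_inj[OF U] jj(3,4) by (simp add: inj_on_def)
  have "contact r (\<lambda>t. \<phi> (jet_rep j t) i) (\<lambda>t. \<phi> (jet_rep j' t) i)" if i: "i < n" for i
    unfolding contact_def
  proof (intro allI impI)
    fix m assume m: "m \<le> r"
    have "jcoord \<phi> j (m * n + i) = jcoord \<phi> j' (m * n + i)" using eq by simp
    then show "(deriv ^^ m) (\<lambda>t. \<phi> (jet_rep j t) i) 0 = (deriv ^^ m) (\<lambda>t. \<phi> (jet_rep j' t) i) 0"
      using index_join[OF i m] by (simp add: jcoord_def)
  qed
  then have "jet_equiv M r (jet_rep j) (jet_rep j')"
    using jets_rep(1) jj 0 by (intro jet_equivI[OF _ _ U]) auto
  then show "j = j'" using jet_of_eq jets_rep(2) jj(1,2) by metis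
qed

text \<open>The polynomial with the prescribed Taylor coefficients may leave the chart for large
  times. Precomposing it with a smooth \<open>\<kappa>\<close> that is the identity near 0 and takes
  small values only keeps it inside without changing the jet.\<close>

lemma curve_with_coords:
  assumes U: "(U, \<phi>) \<in> matlas M" and y: "base y \<in> \<phi> ` U"
  obtains \<gamma> where "smooth_curve M \<gamma>" "\<gamma> 0 \<in> U"
    "\<And>i k. i < n \<Longrightarrow> k \<le> r \<Longrightarrow> (deriv ^^ k) (\<lambda>t. \<phi> (\<gamma> t) i) 0 = fact k * y (k * n + i)"
proof -
  define P where "P s = (\<lambda>i. if i < n then \<Sum>m\<le>r. y (m * n + i) * s ^ m else 0)" for s :: real
  have Pr: "P s \<in> rvec n" for s by (simp add: P_def rvec_def)
  have "P 0 = base y"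
  proof
    fix i
    have "(\<Sum>m\<le>r. y (m * n + i) * 0 ^ m) = (\<Sum>m\<in>{0}. y (m * n + i) * 0 ^ m)"
      by (rule sum.mono_neutral_right) auto
    then show "P 0 i = base y i" by (simp add: P_def base_def)
  qed
  then have P0: "P 0 \<in> \<phi> ` U" using y by simp
  have "\<forall>\<^sub>F s in nhds 0. P s \<in> \<phi> ` U"
  proof (rule eventually_in_open[OF chart(2)[OF U] P0])
    show "((\<lambda>s. P s i) \<longlongrightarrow> P 0 i) (nhds 0)" if "i < n" for i
    proof -
      have "isCont (\<lambda>s. \<Sum>m\<le>r. y (m * n + i) * s ^ m) 0" by (intro continuous_intros)
      then have "isCont (\<lambda>s. P s i) 0" using that by (simp add: P_def)
      then show ?thesis using tendsto_at_iff_tendsto_nhds[of "\<lambda>s. P s i" 0] by (simp add: isCont_def)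
    qed
  qed (use Pr in auto)
  then obtain e where e: "e > 0" "\<And>s. dist s 0 < e \<Longrightarrow> P s \<in> \<phi> ` U"
    unfolding eventually_nhds_metric by blast
  \<comment> \<open>\<open>\<kappa>\<close> vanishes for \<open>\<bar>t\<bar> \<ge> 2 * d\<close>
    and never exceeds \<open>\<bar>t\<bar>\<close> in absolute value, so it stays below
    \<open>2 * d < e\<close>.\<close>
  define d where "d = e / 3"
  have d: "d > 0" using e by (simp add: d_def)
  define \<kappa> where "\<kappa> t = t * plateau (t * inverse d)" for t
  have \<kappa>_small: "\<bar>\<kappa> t\<bar> < e" for t
  proof (cases "\<bar>t * inverse d\<bar> \<ge> 2")
    case True
    then show ?thesis using plateau_eq_0 e by (simp add: \<kappa>_def)
  next
    case False
    then have "\<bar>t\<bar> < 2 * d" using d by (simp add: abs_mult divide_inverse[symmetric] field_simps)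
    moreover have "\<bar>\<kappa> t\<bar> \<le> \<bar>t\<bar> * 1"
      unfolding \<kappa>_def abs_mult using plateau_bounds[of "t * inverse d"] by (intro mult_left_mono) auto
    ultimately show ?thesis using d by (simp add: d_def)
  qed
  have \<kappa>_id: "\<kappa> t = t" if "t \<in> ball 0 d" for t
    using that d plateau_eq_1[of "t * inverse d"] by (simp add: \<kappa>_def abs_mult field_simps)
  have \<kappa>_smooth: "smooth1 UNIV \<kappa>"
    unfolding \<kappa>_def
  proof (intro smooth1_mult smooth1_ident open_UNIV)
    show "smooth1 UNIV (\<lambda>t. plateau (t * inverse d))"
      by (rule smooth1_lineI[OF open_UNIV],
          rule smooth_on_compose_line[OF openin_line[OF open_UNIV] open_UNIV smooth_on_plateau])
        (intro smooth_on_mult smooth_on_coord smooth_on_const openin_line open_UNIV, simp)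
  qed
  define c where "c t = P (\<kappa> t)" for t
  have cU: "c t \<in> \<phi> ` U" for t using e(2) \<kappa>_small by (simp add: c_def dist_real_def)
  have c_smooth: "smooth1 UNIV (\<lambda>t. c t i)" if "i < n" for i
    using that unfolding c_def P_def
    by (auto intro!: smooth1_sum smooth1_mult smooth1_const smooth1_power \<kappa>_smooth)
  define \<gamma> where "\<gamma> t = inv_into U \<phi> (c t)" for t
  have \<gamma>U: "\<gamma> t \<in> U" "\<phi> (\<gamma> t) = c t" for t
    using inv_into_into[OF cU] f_inv_into_f[OF cU] by (auto simp: \<gamma>_def)
  have "smooth_curve M \<gamma>"
    unfolding smooth_curve_def
  proof (rule conjI)
    have "continuous_map euclideanreal (Euclidean_space n) (\<lambda>t i. if i < n then c t i else 0)"
      unfolding continuous_map_componentwise_Euclidean_space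
    proof (intro allI impI)
      fix i assume "i < n"
      then have "continuous_on UNIV (\<lambda>t. c t i)"
        using smooth1_DERIV[OF c_smooth] by (intro continuous_at_imp_continuous_on ballI DERIV_isCont) auto
      then show "continuous_map euclideanreal euclideanreal (\<lambda>t. c t i)" by simp
    qed
    moreover have "(\<lambda>t i. if i < n then c t i else 0) = c"
      using Pr by (auto simp: c_def P_def fun_eq_iff)
    ultimately have "continuous_map euclideanreal (subtopology (Euclidean_space n) (\<phi> ` U)) c"
      using cU by (auto simp: continuous_map_in_subtopology)
    from continuous_map_compose[OF this chart_inverse_continuous[OF U]]
    show "continuous_map euclideanreal (mtop M) \<gamma>"
      by (simp add: \<gamma>_def[abs_def] comp_def)
  next
    have "(deriv ^^ k) (\<lambda>s. \<psi> (\<gamma> s) i) differentiable (at t)"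
      if V: "(V, \<psi>) \<in> matlas M" and i: "i < n" and t: "\<gamma> t \<in> V" for V \<psi> i t k
    proof -
      let ?T = "{t. c t \<in> \<phi> ` (U \<inter> V)}"
      have cont: "isCont (\<lambda>t. c t i) t" if "i < n" for i t
        using smooth1_DERIV[OF c_smooth[OF that]] by (intro DERIV_isCont) auto
      have T: "open ?T"
      proof (subst open_subopen, intro ballI)
        fix t assume "t \<in> ?T"
        then have "c t \<in> \<phi> ` (U \<inter> V)" by simp
        from eventually_in_open[OF overlap_open[OF U V] this, of c "nhds t"]
        have "\<forall>\<^sub>F s in nhds t. c s \<in> \<phi> ` (U \<inter> V)"
          using cont Pr by (simp add: c_def continuous_at isCont_def tendsto_nhds_iff)
        then show "\<exists>S. open S \<and> t \<in> S \<and> S \<subseteq> ?T"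
          unfolding eventually_nhds by blast
      qed
      have "t \<in> ?T" using t \<gamma>U by (metis IntI imageI mem_Collect_eq)
      moreover have "smooth1 ?T (\<lambda>t. \<psi> (inv_into U \<phi> (c t)) i)"
        by (rule smooth1_compose[OF overlap_open[OF U V] transition[OF U V i] T])
          (use smooth1_subset[OF c_smooth T] in auto)
      ultimately show ?thesis
        by (simp add: smooth1_def \<gamma>_def)
    qed
    then show "\<forall>(V, \<psi>)\<in>matlas M. \<forall>i<n. \<forall>t k. \<gamma> t \<in> V \<longrightarrow>
        (deriv ^^ k) (\<lambda>s. \<psi> (\<gamma> s) i) differentiable (at t)"
      by auto
  qed
  moreover have "(deriv ^^ k) (\<lambda>t. \<phi> (\<gamma> t) i) 0 = fact k * y (k * n + i)" if "i < n" "k \<le> r" for i k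
  proof -
    have "(deriv ^^ k) (\<lambda>t. \<phi> (\<gamma> t) i) 0 = (deriv ^^ k) (\<lambda>t. \<Sum>m\<le>r. y (m * n + i) * t ^ m) 0"
      by (rule deriv_pow_cong[of "ball 0 d"]) (use d \<gamma>U(2) \<kappa>_id that(1) in \<open>auto simp: c_def P_def\<close>)
    then show ?thesis using deriv_pow_polynomial_0[OF that(2)] by simp
  qed
  ultimately show ?thesis using that \<gamma>U(1) by blast
qed

text \<open>All fibre coordinates are attained by curves, so the image over \<open>A\<close> is a
  full cylinder. \<open>A\<close> is not only a chart domain: openness of overlaps in the jet bundle
  and of complements of supports is read off from this.\<close>

lemma jcoord_image:
  assumes U: "(U, \<phi>) \<in> matlas M" and A: "A \<subseteq> U"
  shows "jcoord \<phi> ` jdom A = {y \<in> rvec (n * Suc r). base y \<in> \<phi> ` A}"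
proof (intro equalityI subsetI)
  fix y assume "y \<in> jcoord \<phi> ` jdom A"
  then obtain j where j: "j \<in> jdom A" "y = jcoord \<phi> j" by auto
  then have "j \<in> jdom U" "jet_rep j 0 \<in> A" using A by (auto simp: jdom_def)
  then show "y \<in> {y \<in> rvec (n * Suc r). base y \<in> \<phi> ` A}"
    using base_jcoord[OF U] jcoord_rvec j(2) by auto
next
  fix y assume y: "y \<in> {y \<in> rvec (n * Suc r). base y \<in> \<phi> ` A}"
  then have "base y \<in> \<phi> ` U" using A by auto
  then obtain \<gamma> where \<gamma>: "smooth_curve M \<gamma>" "\<gamma> 0 \<in> U"
    "\<And>i k. i < n \<Longrightarrow> k \<le> r \<Longrightarrow> (deriv ^^ k) (\<lambda>t. \<phi> (\<gamma> t) i) 0 = fact k * y (k * n + i)"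
    using curve_with_coords[OF U] by metis
  let ?j = "jet_of M r \<gamma>"
  have "jcoord \<phi> ?j k = y k" for k
  proof (cases "k < n * Suc r")
    case True
    then show ?thesis using jcoord_jet_of[OF \<gamma>(1,2) U True] \<gamma>(3) index_split[OF True] by simp
  next
    case False
    then show ?thesis using y rvec_0[of y "n * Suc r" k] by (simp add: jcoord_def)
  qed
  then have eq: "jcoord \<phi> ?j = y" by auto
  have jU: "?j \<in> jdom U" using \<gamma> jet_of_jets jet_rep_0 by (simp add: jdom_def)
  have "\<phi> (\<gamma> 0) \<in> \<phi> ` A" using base_jcoord[OF U jU] eq y jet_rep_0[OF \<gamma>(1)] by simp
  then have "\<gamma> 0 \<in> A" using chart_inj[OF U] \<gamma>(2) A by (auto simp: inj_on_def)
  then have "?j \<in> jdom A" using \<gamma> jet_of_jets jet_rep_0 by (simp add: jdom_def)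
  then show "y \<in> jcoord \<phi> ` jdom A" using eq by blast
qed

lemma base_preimage_open:
  assumes B: "openin (Euclidean_space n) B"
  shows "openin (Euclidean_space (n * Suc r)) {y \<in> rvec (n * Suc r). base y \<in> B}"
proof (rule openin_Euclidean_preimage[OF open_rvec B])
  show "continuous_on (rvec (n * Suc r)) (\<lambda>x. base x i)" if "i < n" for i
    using that continuous_on_coord by (simp add: base_def)
qed (simp add: base_def rvec_def)

lemma jcoord_image_open:
  assumes "(U, \<phi>) \<in> matlas M" "openin (mtop M) A" "A \<subseteq> U"
  shows "openin (Euclidean_space (n * Suc r)) (jcoord \<phi> ` jdom A)"
  using jcoord_image[OF assms(1,3)] base_preimage_open[OF chart_image_open[OF assms]] by simp

text \<open>The canonical homogeneity structure \<open>h\<^sub>s\<close>.\<close>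

definition hs :: "real \<Rightarrow> 'a jet \<Rightarrow> 'a jet" where
  "hs s j = jet_of M r (\<lambda>t. jet_rep j (s * t))"

lemma scaled_curve:
  assumes \<gamma>: "smooth_curve M \<gamma>"
  shows "smooth_curve M (\<lambda>t. \<gamma> (s * t))"
  unfolding smooth_curve_def
proof (rule conjI)
  have "continuous_map euclideanreal euclideanreal (\<lambda>t. s * t)"
    by (simp add: continuous_on_mult_left)
  from continuous_map_compose[OF this] show "continuous_map euclideanreal (mtop M) (\<lambda>t. \<gamma> (s * t))"
    using \<gamma> unfolding smooth_curve_def comp_def by blast
  have "(deriv ^^ k) (\<lambda>t. \<phi> (\<gamma> (s * t)) i) differentiable (at t)"
    if "(U, \<phi>) \<in> matlas M" "i < n" "\<gamma> (s * t) \<in> U" for U \<phi> i t k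
    using smooth1_scale[OF curve_smooth1[OF \<gamma> that(1,2)], of s] that(3) unfolding smooth1_def by simp
  then show "\<forall>(U, \<phi>)\<in>matlas M. \<forall>i<n. \<forall>t k. \<gamma> (s * t) \<in> U \<longrightarrow>
      (deriv ^^ k) (\<lambda>t. \<phi> (\<gamma> (s * t)) i) differentiable (at t)"
    by auto
qed

lemma hs_jets: "j \<in> jets M r \<Longrightarrow> hs s j \<in> jets M r"
  unfolding hs_def by (intro jet_of_jets scaled_curve jets_rep(1))

lemma hs_rep_0: "j \<in> jets M r \<Longrightarrow> jet_rep (hs s j) 0 = jet_rep j 0"
  unfolding hs_def using jet_rep_0[OF scaled_curve[OF jets_rep(1)], of j s] by simp

lemma hs_jdom: "j \<in> jdom U \<Longrightarrow> hs s j \<in> jdom U"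
  using hs_jets hs_rep_0 by (simp add: jdom_def)

lemma hs_1: "j \<in> jets M r \<Longrightarrow> hs 1 j = j"
  by (simp add: hs_def jets_rep(2))

lemma jcoord_hs:
  assumes U: "(U, \<phi>) \<in> matlas M" and j: "j \<in> jdom U"
  shows "jcoord \<phi> (hs s j) k = s ^ (k div n) * jcoord \<phi> j k"
proof (cases "k < n * Suc r")
  case True
  have jj: "j \<in> jets M r" "jet_rep j 0 \<in> U" using j by (auto simp: jdom_def)
  note c = jets_rep(1)[OF jj(1)]
  have "(deriv ^^ (k div n)) (\<lambda>t. \<phi> (jet_rep j (s * t)) (k mod n)) 0 =
      s ^ (k div n) * (deriv ^^ (k div n)) (\<lambda>t. \<phi> (jet_rep j t) (k mod n)) (s * 0)"
    by (rule deriv_pow_scale[OF curve_smooth1[OF c U index_split(2)[OF True]]]) (simp add: jj)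
  then show ?thesis
    using jcoord_jet_of[OF scaled_curve[OF c, of s] _ U True] jj True
    by (simp add: hs_def jcoord_def)
next
  case False
  then show ?thesis by (simp add: jcoord_def)
qed

lemma fun_lift_hs:
  assumes j: "j \<in> jets M r" and f: "f \<in> sf" and k: "k \<le> r"
  shows "fun_lift M r (int k) f (hs s j) = s ^ k * fun_lift M r (int k) f j"
proof -
  note c = jets_rep(1)[OF j]
  obtain U \<phi> where U: "(U, \<phi>) \<in> matlas M" "jet_rep j 0 \<in> U" by (rule point_chart[OF curve_points[OF c]])
  have "(deriv ^^ k) (\<lambda>t. f (jet_rep j (s * t))) 0 = s ^ k * (deriv ^^ k) (\<lambda>t. f (jet_rep j t)) (s * 0)"
    by (rule deriv_pow_scale[OF curve_function_smooth1[OF c U(1) f]]) (simp add: U)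
  then show ?thesis
    using fun_lift_jet_of[OF scaled_curve[OF c, of s] f k] fun_lift_jet_of[OF c f k] jets_rep(2)[OF j]
    by (simp add: hs_def)
qed

end

section \<open>The jet bundle and its weight vector field\<close>

lemma fun_tensor_fieldD: "fun_tensor f \<in> tensor_fields N \<Longrightarrow> f \<in> smooth_functions N"
  unfolding tensor_fields_def by (auto simp: fun_tensor_def args_ok_def)

context smooth_atlas
begin

lemma args_ok_Nil: "args_ok N [] as \<longleftrightarrow> as = []"
  by (simp add: args_ok_def)

lemma fun_tensor_field: "f \<in> sf \<Longrightarrow> fun_tensor f \<in> tensor_fields N"
  unfolding tensor_fields_def by (auto simp: fun_tensor_def args_ok_Nil)

end

locale jet_lift = jet_mfd M r for M :: "'a manifold" and r +
  fixes L :: "int \<Rightarrow> 'a tensor \<Rightarrow> 'a jet tensor"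
  assumes lift: "is_lift M r L"
begin

lemma lift_field:
  assumes "K \<in> tensor_fields M"
  shows "L k K \<in> tensor_fields JB" "sig (L k K) = sig K"
  using lift[unfolded is_lift_def, THEN conjunct1] assms by simp_all

lemma lift_fun: "f \<in> sf \<Longrightarrow> L k (fun_tensor f) = fun_tensor (fun_lift M r k f)"
  by (rule lift[unfolded is_lift_def, THEN conjunct2, THEN conjunct2, THEN conjunct2, THEN conjunct2,
        THEN conjunct1, rule_format])

text \<open>The smoothness of the lifted functions comes for free from the existence of the lift;
  it yields the smoothness of the transition functions of the jet bundle.\<close>

lemma fun_lift_smooth: "f \<in> sf \<Longrightarrow> fun_lift M r k f \<in> smooth_functions JB"
  using fun_tensor_fieldD lift_field(1)[OF fun_tensor_field] lift_fun by metis

text \<open>\<open>g\<close> agrees with the coordinate on an open set, which the curve does not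
  leave for small times, so all derivatives at time 0 agree.\<close>

lemma fun_lift_coord:
  assumes j: "j \<in> jets M r" and U: "(U, \<phi>) \<in> matlas M" and D: "openin (mtop M) D" "D \<subseteq> U" "jet_rep j 0 \<in> D"
    and g: "\<And>x. x \<in> D \<Longrightarrow> g x = \<phi> x (k mod n)" and k: "k < n * Suc r"
  shows "fun_lift M r (int (k div n)) g j = jcoord \<phi> j k"
proof -
  have "(deriv ^^ (k div n)) (\<lambda>t. g (jet_rep j t)) 0 = (deriv ^^ (k div n)) (\<lambda>t. \<phi> (jet_rep j t) (k mod n)) 0"
    by (rule deriv_pow_cong[OF curve_open[OF jets_rep(1)[OF j] D(1)]]) (use g D in auto)
  then show ?thesis
    using j index_split(1)[OF k] k by (simp add: fun_lift_def points_JB jcoord_def)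
qed

lemma inv_jcoord: "(U, \<phi>) \<in> matlas M \<Longrightarrow> j \<in> jdom U \<Longrightarrow> inv_into (jdom U) (jcoord \<phi>) (jcoord \<phi> j) = j"
  using inv_into_f_f[OF jcoord_inj] by metis

text \<open>Near a given jet, each coordinate of the second chart is the lift of a global function
  that equals a coordinate of \<open>M\<close> there, and lifted functions are smooth in every
  induced chart.\<close>

lemma jcoord_transition:
  assumes U: "(U, \<phi>) \<in> matlas M" and V: "(V, \<psi>) \<in> matlas M" and k: "k < n * Suc r"
  shows "smooth_on (n * Suc r) (jcoord \<phi> ` (jdom U \<inter> jdom V))
    (\<lambda>y. jcoord \<psi> (inv_into (jdom U) (jcoord \<phi>) y) k)"
proof -
  have UV: "jdom U \<inter> jdom V = jdom (U \<inter> V)" by (auto simp: jdom_def)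
  have o: "openin (Euclidean_space (n * Suc r)) (jcoord \<phi> ` jdom (U \<inter> V))"
    using chart(1) U V by (intro jcoord_image_open[OF U]) auto
  show ?thesis
    unfolding UV
  proof (rule smooth_on_local[OF o])
    fix y assume "y \<in> jcoord \<phi> ` jdom (U \<inter> V)"
    then obtain j where j: "j \<in> jdom (U \<inter> V)" "y = jcoord \<phi> j" by auto
    then have x0: "jet_rep j 0 \<in> V" by (simp add: jdom_def)
    obtain W C O1 D \<rho> g where D: "O1 \<subseteq> C" "C \<subseteq> D" "jet_rep j 0 \<in> O1" "openin (mtop M) D" "D \<subseteq> V"
      and g: "\<And>i. i < n \<Longrightarrow> g i \<in> sf" "\<And>i x. i < n \<Longrightarrow> x \<in> D \<Longrightarrow> g i x = \<psi> x i"
      by (rule chart_bump[OF V x0]) metis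
    let ?G = "fun_lift M r (int (k div n)) (g (k mod n))"
    let ?O = "jcoord \<phi> ` jdom (U \<inter> D)"
    have O: "openin (Euclidean_space (n * Suc r)) ?O"
      using chart(1)[OF U] D(4) by (intro jcoord_image_open[OF U]) auto
    have OU: "openin (Euclidean_space (n * Suc r)) (jcoord \<phi> ` jdom U)"
      using chart(1)[OF U] by (intro jcoord_image_open[OF U]) auto
    have "?G \<in> smooth_functions JB"
      by (rule fun_lift_smooth[OF g(1)[OF index_split(2)[OF k]]])
    moreover have "(jdom U, jcoord \<phi>) \<in> matlas JB" using U matlas_JB by blast
    ultimately have "smooth_on (n * Suc r) (jcoord \<phi> ` jdom U) (\<lambda>y. ?G (inv_into (jdom U) (jcoord \<phi>) y))"
      unfolding smooth_functions_def mdim_JB by blast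
    then have "smooth_on (n * Suc r) ?O (\<lambda>y. ?G (inv_into (jdom U) (jcoord \<phi>) y))"
      by (rule smooth_on_subset[OF OU O, rotated]) (auto simp: jdom_def)
    moreover have "y \<in> ?O" using j D by (auto simp: jdom_def)
    moreover have "jcoord \<psi> (inv_into (jdom U) (jcoord \<phi>) y) k = ?G (inv_into (jdom U) (jcoord \<phi>) y)"
      if y: "y \<in> ?O" for y
    proof -
      obtain j where j: "j \<in> jdom (U \<inter> D)" "y = jcoord \<phi> j" using y by auto
      then have "j \<in> jdom U" by (simp add: jdom_def)
      then have "inv_into (jdom U) (jcoord \<phi>) y = j" using inv_jcoord[OF U] j(2) by simp
      moreover have "?G j = jcoord \<psi> j k"
        by (rule fun_lift_coord[OF _ V D(4,5) _ g(2)[OF index_split(2)[OF k]] k])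
          (use j(1) in \<open>auto simp: jdom_def\<close>)
      ultimately show ?thesis by simp
    qed
    ultimately show "\<exists>O' f. openin (Euclidean_space (n * Suc r)) O' \<and> y \<in> O' \<and> smooth_on (n * Suc r) O' f \<and>
        (\<forall>y\<in>O'. jcoord \<psi> (inv_into (jdom U) (jcoord \<phi>) y) k = f y)"
      using O by (metis (no_types, lifting))
  qed
qed

sublocale J: smooth_atlas JB
proof
  fix V \<Phi> V' \<Phi>' assume "(V, \<Phi>) \<in> matlas JB" "(V', \<Phi>') \<in> matlas JB"
  then obtain U \<phi> U' \<phi>' where U: "(U, \<phi>) \<in> matlas M" "V = jdom U" "\<Phi> = jcoord \<phi>"
    and U': "(U', \<phi>') \<in> matlas M" "V' = jdom U'" "\<Phi>' = jcoord \<phi>'"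
    unfolding matlas_JB by blast
  have "jdom U \<inter> jdom U' = jdom (U \<inter> U')" by (auto simp: jdom_def)
  moreover have "openin (Euclidean_space (n * Suc r)) (jcoord \<phi> ` jdom (U \<inter> U'))"
    using chart(1) U U' by (intro jcoord_image_open[OF U(1)]) auto
  ultimately show "openin (Euclidean_space (mdim JB)) (\<Phi> ` (V \<inter> V'))"
    unfolding mdim_JB U U' by simp
  show "smooth_on (mdim JB) (\<Phi> ` (V \<inter> V')) (\<lambda>y. \<Phi>' (inv_into V \<Phi> y) i)" if "i < mdim JB" for i
    using jcoord_transition[OF U(1) U'(1)] that unfolding mdim_JB U U' by blast
next
  fix V \<Phi> assume "(V, \<Phi>) \<in> matlas JB"
  then obtain U \<phi> where U: "(U, \<phi>) \<in> matlas M" "V = jdom U" "\<Phi> = jcoord \<phi>"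
    unfolding matlas_JB by blast
  show "inj_on \<Phi> V" using jcoord_inj[OF U(1)] U by simp
  show "openin (Euclidean_space (mdim JB)) (\<Phi> ` V)"
    using jcoord_image_open[OF U(1) chart(1)[OF U(1)]] unfolding mdim_JB U by simp
next
  show "points JB = (\<Union>(V, \<Phi>)\<in>matlas JB. V)"
  proof
    show "points JB \<subseteq> (\<Union>(V, \<Phi>)\<in>matlas JB. V)"
    proof
      fix j assume "j \<in> points JB"
      then obtain U \<phi> where "(U, \<phi>) \<in> matlas M" "j \<in> jdom U" using jets_cover points_JB by blast
      moreover from this have "(jdom U, jcoord \<phi>) \<in> matlas JB" using matlas_JB by blast
      ultimately show "j \<in> (\<Union>(V, \<Phi>)\<in>matlas JB. V)" by blast
    qed
    show "(\<Union>(V, \<Phi>)\<in>matlas JB. V) \<subseteq> points JB"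
      unfolding points_JB using matlas_JB by (auto simp: jdom_def)
  qed
qed

section \<open>The weight vector field as a derivation\<close>

abbreviation "\<Delta> \<equiv> weight_field M r"

lemma jet_chart_atlas: "(U, \<phi>) \<in> matlas M \<Longrightarrow> (jdom U, jcoord \<phi>) \<in> matlas JB"
  unfolding matlas_JB by blast

lemma DERIV_hs:
  assumes F: "F \<in> J.sf" and U: "(U, \<phi>) \<in> matlas M" and j: "j \<in> jdom U"
  shows "((\<lambda>s. F (hs s j)) has_real_derivative
    (\<Sum>k<n * Suc r. partial_deriv k (\<lambda>y. F (inv_into (jdom U) (jcoord \<phi>) y)) (jcoord \<phi> j) *
      (real (k div n) * jcoord \<phi> j k))) (at 1)"
proof -
  let ?f = "\<lambda>y. F (inv_into (jdom U) (jcoord \<phi>) y)"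
  have f: "smooth_on (n * Suc r) (jcoord \<phi> ` jdom U) ?f"
    using J.sf_chart[OF F jet_chart_atlas[OF U]] unfolding mdim_JB .
  have o: "openin (Euclidean_space (n * Suc r)) (jcoord \<phi> ` jdom U)"
    using J.chart_open[OF jet_chart_atlas[OF U]] unfolding mdim_JB .
  have "((\<lambda>s. ?f (jcoord \<phi> (hs s j))) has_real_derivative
    (\<Sum>k<n * Suc r. partial_deriv k ?f (jcoord \<phi> (hs 1 j)) * (real (k div n) * jcoord \<phi> j k))) (at 1)"
  proof (rule has_real_derivative_compose_partial[OF o f])
    show "\<forall>\<^sub>F s in nhds 1. jcoord \<phi> (hs s j) \<in> rvec (n * Suc r)"
      using jcoord_rvec by simp
    show "jcoord \<phi> (hs 1 j) \<in> jcoord \<phi> ` jdom U" using hs_jdom[OF j] by blast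
    show "((\<lambda>s. jcoord \<phi> (hs s j) k) has_real_derivative real (k div n) * jcoord \<phi> j k) (at 1)" for k
      unfolding jcoord_hs[OF U j] by (auto intro!: derivative_eq_intros)
  qed
  then show ?thesis
    using inv_jcoord[OF U hs_jdom[OF j]] hs_1[of j] j by (simp add: jdom_def)
qed

lemma sum_jet_indices:
  "(\<Sum>i<n. \<Sum>\<mu>=1..r. real \<mu> * a (\<mu> * n + i)) = (\<Sum>k<n * Suc r. real (k div n) * a k)"
proof -
  \<comment> \<open>The summands with \<open>\<mu> = 0\<close> are zero and may be added.\<close>
  have "(\<Sum>i<n. \<Sum>\<mu>=1..r. real \<mu> * a (\<mu> * n + i)) = (\<Sum>i<n. \<Sum>\<mu>\<le>r. real \<mu> * a (\<mu> * n + i))"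
    by (intro sum.cong refl sum.mono_neutral_left) auto
  also have "\<dots> = (\<Sum>(i, \<mu>)\<in>{..<n} \<times> {..r}. real \<mu> * a (\<mu> * n + i))"
    by (simp add: sum.cartesian_product)
  also have "\<dots> = (\<Sum>k<n * Suc r. real (k div n) * a k)"
    by (rule sum.reindex_bij_witness[where i = "\<lambda>k. (k mod n, k div n)" and j = "\<lambda>(i, \<mu>). \<mu> * n + i"])
      (use index_split index_join in auto)
  finally show ?thesis .
qed

lemma weight_field_eq:
  assumes F: "F \<in> J.sf" and j: "j \<in> jets M r"
  shows "\<Delta> F j = deriv (\<lambda>s. F (hs s j)) 1"
proof -
  let ?c = "SOME c. c \<in> matlas JB \<and> j \<in> fst c"
  have "\<exists>c. c \<in> matlas JB \<and> j \<in> fst c" using jets_cover[OF j] jet_chart_atlas by fastforce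
  then have "?c \<in> matlas JB \<and> j \<in> fst ?c" by (rule someI_ex)
  moreover obtain V \<Phi> where c: "?c = (V, \<Phi>)" by (rule prod.exhaust)
  ultimately have V: "(V, \<Phi>) \<in> matlas JB" "j \<in> V" by simp_all
  from V(1) obtain U \<phi> where "(U, \<phi>) \<in> matlas M" "V = jdom U" "\<Phi> = jcoord \<phi>"
    unfolding matlas_JB by (elim exE conjE)
  with V(2) c have U: "(U, \<phi>) \<in> matlas M" "?c = (jdom U, jcoord \<phi>)" "j \<in> jdom U" by simp_all
  let ?f = "\<lambda>y. F (inv_into (jdom U) (jcoord \<phi>) y)"
  have "\<Delta> F j = (\<Sum>i<n. \<Sum>\<mu>=1..r. real \<mu> * jcoord \<phi> j (\<mu> * n + i) * partial_deriv (\<mu> * n + i) ?f (jcoord \<phi> j))"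
    unfolding weight_field_def U(2) using F j by (simp add: points_JB)
  also have "\<dots> = (\<Sum>k<n * Suc r. real (k div n) * (jcoord \<phi> j k * partial_deriv k ?f (jcoord \<phi> j)))"
    using sum_jet_indices[of "\<lambda>k. jcoord \<phi> j k * partial_deriv k ?f (jcoord \<phi> j)"] by (simp add: mult.assoc)
  also have "\<dots> = deriv (\<lambda>s. F (hs s j)) 1"
    using DERIV_imp_deriv[OF DERIV_hs[OF F U(1,3)]] by (simp add: mult_ac)
  finally show ?thesis .
qed

lemma DERIV_hs_weight:
  assumes F: "F \<in> J.sf" and j: "j \<in> jets M r"
  shows "((\<lambda>s. F (hs s j)) has_real_derivative \<Delta> F j) (at 1)"
proof -
  obtain U \<phi> where "(U, \<phi>) \<in> matlas M" "j \<in> jdom U" using jets_cover[OF j] by (elim exE conjE)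
  from DERIV_hs[OF F this] show ?thesis
    unfolding weight_field_eq[OF F j] by (simp add: DERIV_imp_deriv)
qed

lemma weight_field_off: "F \<notin> J.sf \<or> j \<notin> jets M r \<Longrightarrow> \<Delta> F j = 0"
  unfolding weight_field_def points_JB by auto

lemma weight_field_vf: "\<Delta> \<in> J.vf"
proof (rule J.vfI)
  show "\<Delta> F = (\<lambda>j. 0)" if "F \<notin> J.sf" for F using weight_field_off that by auto
  show "\<Delta> F \<in> J.sf" if F: "F \<in> J.sf" for F
    unfolding J.sf_iff
  proof (intro conjI allI impI)
    show "\<Delta> F j = 0" if "j \<notin> points JB" for j using weight_field_off that points_JB by blast
    fix V \<Phi> assume V: "(V, \<Phi>) \<in> matlas JB"
    then obtain U \<phi> where U: "(U, \<phi>) \<in> matlas M" "V = jdom U" "\<Phi> = jcoord \<phi>"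
      unfolding matlas_JB by blast
    let ?f = "\<lambda>y. F (inv_into V \<Phi> y)"
    note o = J.chart_open[OF V]
    \<comment> \<open>This is the Euler operator in an arbitrary induced chart, which need not be
      the one picked by \<open>weight_field\<close>; both compute the derivative along
      \<open>hs\<close>.\<close>
    have "smooth_on (mdim JB) (\<Phi> ` V) (\<lambda>y. \<Sum>k<mdim JB. partial_deriv k ?f y * (real (k div n) * y k))"
      by (intro smooth_on_sum[OF o] smooth_on_mult[OF o] smooth_on_const[OF o] smooth_on_coord[OF o]
          smooth_on_partial_deriv[OF o J.sf_chart[OF F V]]) auto
    then show "smooth_on (mdim JB) (\<Phi> ` V) (\<lambda>y. \<Delta> F (inv_into V \<Phi> y))"
    proof (rule smooth_on_cong[OF o, rotated])
      fix y assume "y \<in> \<Phi> ` V"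
      then obtain j where j: "j \<in> jdom U" "y = jcoord \<phi> j" using U by auto
      then have "inv_into V \<Phi> y = j" using inv_jcoord[OF U(1)] U by simp
      moreover have "j \<in> jets M r" using j by (simp add: jdom_def)
      ultimately show "(\<Sum>k<mdim JB. partial_deriv k ?f y * (real (k div n) * y k)) = \<Delta> F (inv_into V \<Phi> y)"
        using DERIV_imp_deriv[OF DERIV_hs[OF F U(1) j(1)]] weight_field_eq[OF F] j U
        by (simp add: mdim_JB)
    qed
  qed
  fix F G a b j assume F: "F \<in> J.sf" and G: "G \<in> J.sf"
  have lc: "(\<lambda>j. a * F j + b * G j) \<in> J.sf" by (intro J.sf_add J.sf_cmult F G)
  have mu: "(\<lambda>j. F j * G j) \<in> J.sf" by (intro J.sf_mult F G)
  show "\<Delta> (\<lambda>j. a * F j + b * G j) j = a * \<Delta> F j + b * \<Delta> G j"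
  proof (cases "j \<in> jets M r")
    case True
    have "((\<lambda>s. a * F (hs s j) + b * G (hs s j)) has_real_derivative a * \<Delta> F j + b * \<Delta> G j) (at 1)"
      by (intro DERIV_add DERIV_cmult DERIV_hs_weight F G True)
    then show ?thesis using weight_field_eq[OF lc True] DERIV_imp_deriv by metis
  qed (simp add: weight_field_off)
  show "\<Delta> (\<lambda>j. F j * G j) j = \<Delta> F j * G j + F j * \<Delta> G j"
  proof (cases "j \<in> jets M r")
    case True
    have "((\<lambda>s. F (hs s j) * G (hs s j)) has_real_derivative \<Delta> F j * G (hs 1 j) + \<Delta> G j * F (hs 1 j)) (at 1)"
      by (intro DERIV_mult DERIV_hs_weight F G True)
    then show ?thesis using weight_field_eq[OF mu True] hs_1[OF True] DERIV_imp_deriv by (simp add: mult.commute)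
  qed (simp add: weight_field_off)
qed

lemma weight_fun_lift:
  assumes f: "f \<in> sf"
  shows "\<Delta> (fun_lift M r k f) = (\<lambda>j. of_int k * fun_lift M r k f j)"
proof (cases "0 \<le> k \<and> k \<le> int r")
  case True
  then obtain m where m: "k = int m" "m \<le> r" by (metis nonneg_int_cases of_nat_le_iff)
  show ?thesis
  proof
    fix j
    show "\<Delta> (fun_lift M r k f) j = of_int k * fun_lift M r k f j"
    proof (cases "j \<in> jets M r")
      case j: True
      have "((\<lambda>s. s ^ m * fun_lift M r k f j) has_real_derivative real m * fun_lift M r k f j) (at 1)"
        by (auto intro!: derivative_eq_intros)
      then show ?thesis
        using weight_field_eq[OF fun_lift_smooth[OF f] j] fun_lift_hs[OF j f m(2)] DERIV_imp_deriv m(1)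
        by fastforce
    next
      case False
      then show ?thesis by (simp add: weight_field_off fun_lift_def points_JB)
    qed
  qed
next
  case False
  \<comment> \<open>Outside \<open>0..r\<close> the lift is zero by convention, so the formula holds
    for every integer \<open>k\<close>; the lift of a vector field will produce negative
    indices.\<close>
  then have "fun_lift M r k f = (\<lambda>j. 0)" by (auto simp: fun_lift_def)
  then show ?thesis using J.vf_zero[OF weight_field_vf] by simp
qed

end

section \<open>Lie derivatives of tensor fields\<close>

lemma sum_lessThan_add: "(\<Sum>i<m + k. f i) = (\<Sum>i<m. f i) + (\<Sum>i<k. f (m + i))"
  for f :: "nat \<Rightarrow> 'b::comm_monoid_add"
  by (induction k) (simp_all add: add.assoc)

text \<open>The product of dual numbers \<open>a + \<epsilon> a'\<close>, represented as pairs: it computes a product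
  together with its derivative, and is invariant under permutations of the factors.\<close>

definition dual_mult :: "'b::comm_ring_1 \<times> 'b \<Rightarrow> 'b \<times> 'b \<Rightarrow> 'b \<times> 'b" where
  "dual_mult p q = (fst p * fst q, snd p * fst q + fst p * snd q)"

definition dual_prod :: "('b::comm_ring_1 \<times> 'b) list \<Rightarrow> 'b \<times> 'b" where
  "dual_prod ps = foldr dual_mult ps (1, 0)"

lemma dual_prod_Nil [simp]: "dual_prod [] = (1, 0)"
  and dual_prod_Cons [simp]: "dual_prod (p # ps) = dual_mult p (dual_prod ps)"
  by (simp_all add: dual_prod_def)

lemma dual_prod_perm:
  assumes "mset ps = mset qs"
  shows "dual_prod ps = dual_prod qs"
proof -
  have comm: "dual_mult p \<circ> dual_mult q = dual_mult q \<circ> dual_mult p" for p q :: "'a \<times> 'a"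
    by (auto simp: dual_mult_def fun_eq_iff algebra_simps)
  have "fold dual_mult ps = fold dual_mult qs"
    by (rule fold_multiset_equiv[OF comm assms])
  then show ?thesis
    unfolding dual_prod_def by (simp add: foldr_fold[OF comm])
qed

context smooth_atlas
begin

section \<open>Algebra of tensor fields on an atlas\<close>

abbreviation "tf \<equiv> tensor_fields N"

lemma args_ok_length: "args_ok N \<sigma> as \<Longrightarrow> length as = length \<sigma>"
  unfolding args_ok_def by (simp add: list_all2_lengthD)

lemma args_ok_append:
  "args_ok N (\<sigma> @ \<tau>) as \<longleftrightarrow>
    args_ok N \<sigma> (take (length \<sigma>) as) \<and> args_ok N \<tau> (drop (length \<sigma>) as)"
proof
  assume "args_ok N (\<sigma> @ \<tau>) as"
  then show "args_ok N \<sigma> (take (length \<sigma>) as) \<and> args_ok N \<tau> (drop (length \<sigma>) as)"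
    unfolding args_ok_def list_all2_append1 by auto
next
  assume "args_ok N \<sigma> (take (length \<sigma>) as) \<and> args_ok N \<tau> (drop (length \<sigma>) as)"
  then have "list_all2 (arg_ok N) (\<sigma> @ \<tau>) (take (length \<sigma>) as @ drop (length \<sigma>) as)"
    unfolding args_ok_def by (intro list_all2_appendI) auto
  then show "args_ok N (\<sigma> @ \<tau>) as" by (simp add: args_ok_def)
qed

lemma tf_app_sf: "T \<in> tf \<Longrightarrow> app T as \<in> sf"
  unfolding tensor_fields_def using sf_zero by (cases "args_ok N (sig T) as") auto

lemma tf_app_not_ok: "T \<in> tf \<Longrightarrow> \<not> args_ok N (sig T) as \<Longrightarrow> app T as = (\<lambda>x. 0)"
  unfolding tensor_fields_def by blast

lemma tf_app_off: "T \<in> tf \<Longrightarrow> x \<notin> points N \<Longrightarrow> app T as x = 0"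
  using sf_off[OF tf_app_sf] by blast

lemma tf_multilinear:
  "T \<in> tf \<Longrightarrow> args_ok N (sig T) as \<Longrightarrow> i < length (sig T) \<Longrightarrow> arg_ok N (sig T ! i) b \<Longrightarrow>
    f \<in> sf \<Longrightarrow> g \<in> sf \<Longrightarrow>
    app T (as[i := arg_comb f (as ! i) g b]) = (\<lambda>x. f x * app T as x + g x * app T (as[i := b]) x)"
  unfolding tensor_fields_def by blast

lemma tfI:
  assumes "\<And>as. args_ok N (sig T) as \<Longrightarrow> app T as \<in> sf"
    and "\<And>as. \<not> args_ok N (sig T) as \<Longrightarrow> app T as = (\<lambda>x. 0)"
    and "\<And>as b i f g x. args_ok N (sig T) as \<Longrightarrow> i < length (sig T) \<Longrightarrow> arg_ok N (sig T ! i) b \<Longrightarrow>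
      f \<in> sf \<Longrightarrow> g \<in> sf \<Longrightarrow>
      app T (as[i := arg_comb f (as ! i) g b]) x = f x * app T as x + g x * app T (as[i := b]) x"
  shows "T \<in> tf"
  unfolding tensor_fields_def using assms by (auto simp: fun_eq_iff)

lemma sig_simps [simp]:
  "sig (tensor_prod T S) = sig T @ sig S" "sig (tensor_add T S) = sig T" "sig (tensor_scale c T) = sig T"
  "sig (tensor_sum \<sigma> F I) = \<sigma>" "sig (form_tensor \<alpha>) = [Cov]" "sig (vec_tensor N X) = [Con]"
  "sig (fun_tensor f) = []"
  by (simp_all add: tensor_prod_def tensor_add_def tensor_scale_def tensor_sum_def form_tensor_def
      vec_tensor_def fun_tensor_def)

lemma app_simps:
  "app (tensor_prod T S) as x = app T (take (length (sig T)) as) x * app S (drop (length (sig T)) as) x"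
  "app (tensor_add T S) as x = app T as x + app S as x"
  "app (tensor_scale c T) as x = c * app T as x"
  "app (tensor_sum \<sigma> F I) as x = (\<Sum>i\<in>I. app (F i) as x)"
  by (simp_all add: tensor_prod_def tensor_add_def tensor_scale_def tensor_sum_def)

lemma tensor_prod_field:
  assumes T: "T \<in> tf" and S: "S \<in> tf"
  shows "tensor_prod T S \<in> tf"
proof (rule tfI)
  let ?m = "length (sig T)"
  show "app (tensor_prod T S) as \<in> sf" for as
    unfolding app_simps[abs_def] by (rule sf_mult[OF tf_app_sf[OF T] tf_app_sf[OF S]])
  show "app (tensor_prod T S) as = (\<lambda>x. 0)" if "\<not> args_ok N (sig (tensor_prod T S)) as" for as
    using that tf_app_not_ok[OF T, of "take ?m as"] tf_app_not_ok[OF S, of "drop ?m as"]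
    by (auto simp: fun_eq_iff app_simps args_ok_append)
  fix as b i f g x assume ok: "args_ok N (sig (tensor_prod T S)) as"
    and i: "i < length (sig (tensor_prod T S))" and b: "arg_ok N (sig (tensor_prod T S) ! i) b"
    and f: "f \<in> sf" and g: "g \<in> sf"
  have ok': "args_ok N (sig T) (take ?m as)" "args_ok N (sig S) (drop ?m as)"
    using ok by (simp_all add: args_ok_append)
  show "app (tensor_prod T S) (as[i := arg_comb f (as ! i) g b]) x =
      f x * app (tensor_prod T S) as x + g x * app (tensor_prod T S) (as[i := b]) x"
  proof (cases "i < ?m")
    case True
    then have b': "arg_ok N (sig T ! i) b" using b by (simp add: nth_append)
    show ?thesis
      using tf_multilinear[OF T ok'(1) True b' f g] True
      by (simp add: app_simps take_update_swap algebra_simps)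
  next
    case False
    then have b': "arg_ok N (sig S ! (i - ?m)) b" and i': "i - ?m < length (sig S)"
      using b i by (auto simp: nth_append)
    have "as ! i = drop ?m as ! (i - ?m)"
      using False args_ok_length[OF ok] by (simp add: nth_drop)
    then show ?thesis
      using tf_multilinear[OF S ok'(2) i' b' f g] False
      by (simp add: app_simps drop_update_swap algebra_simps)
  qed
qed

lemma tensor_scale_field:
  assumes T: "T \<in> tf"
  shows "tensor_scale c T \<in> tf"
proof (rule tfI)
  show "app (tensor_scale c T) as \<in> sf" for as
    unfolding app_simps[abs_def] by (rule sf_cmult[OF tf_app_sf[OF T]])
qed (simp_all add: fun_eq_iff app_simps tf_app_not_ok[OF T] tf_multilinear[OF T] algebra_simps)

lemma tensor_sum_field:
  assumes T: "\<And>i. i \<in> I \<Longrightarrow> T i \<in> tf" "\<And>i. i \<in> I \<Longrightarrow> sig (T i) = \<sigma>" and I: "finite I"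
  shows "tensor_sum \<sigma> T I \<in> tf"
proof (rule tfI)
  show "app (tensor_sum \<sigma> T I) as \<in> sf" for as
    unfolding app_simps[abs_def] by (rule sf_sum[OF I tf_app_sf[OF T(1)]])
  show "app (tensor_sum \<sigma> T I) as = (\<lambda>x. 0)" if "\<not> args_ok N (sig (tensor_sum \<sigma> T I)) as" for as
    using that tf_app_not_ok[OF T(1)] T(2) by (auto simp: fun_eq_iff app_simps intro!: sum.neutral)
  fix as b k f g x assume ok: "args_ok N (sig (tensor_sum \<sigma> T I)) as"
    and k: "k < length (sig (tensor_sum \<sigma> T I))" and b: "arg_ok N (sig (tensor_sum \<sigma> T I) ! k) b"
    and f: "f \<in> sf" and g: "g \<in> sf"
  have "app (T i) (as[k := arg_comb f (as ! k) g b]) x = f x * app (T i) as x + g x * app (T i) (as[k := b]) x"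
    if "i \<in> I" for i
    using tf_multilinear[OF T(1)[OF that] _ _ _ f g, of as k b] ok k b T(2)[OF that] by simp
  then show "app (tensor_sum \<sigma> T I) (as[k := arg_comb f (as ! k) g b]) x =
      f x * app (tensor_sum \<sigma> T I) as x + g x * app (tensor_sum \<sigma> T I) (as[k := b]) x"
    by (simp add: app_simps sum.distrib sum_distrib_left)
qed

lemma args_ok_single:
  "args_ok N [Cov] as \<longleftrightarrow> (\<exists>X\<in>vf. as = [Vec X])" "args_ok N [Con] as \<longleftrightarrow> (\<exists>\<alpha>\<in>of1. as = [Form \<alpha>])"
proof -
  have "arg_ok N Cov a \<longleftrightarrow> (\<exists>X\<in>vf. a = Vec X)" "arg_ok N Con a \<longleftrightarrow> (\<exists>\<alpha>\<in>of1. a = Form \<alpha>)" for a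
    by (cases a; simp)+
  then show "args_ok N [Cov] as \<longleftrightarrow> (\<exists>X\<in>vf. as = [Vec X])" "args_ok N [Con] as \<longleftrightarrow> (\<exists>\<alpha>\<in>of1. as = [Form \<alpha>])"
    by (auto simp: args_ok_def list_all2_Cons1)
qed

lemma app_form_tensor: "app (form_tensor \<alpha>) [Vec X] = \<alpha> X"
  by (simp add: form_tensor_def)

lemma app_vec_tensor: "\<alpha> \<in> of1 \<Longrightarrow> app (vec_tensor N X) [Form \<alpha>] = \<alpha> X"
  by (simp add: vec_tensor_def)

lemma form_tensor_field:
  assumes \<alpha>: "\<alpha> \<in> of1"
  shows "form_tensor \<alpha> \<in> tf"
proof (rule tfI)
  show "app (form_tensor \<alpha>) as \<in> sf" if "args_ok N (sig (form_tensor \<alpha>)) as" for as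
    using that form_sf[OF \<alpha>] by (auto simp: args_ok_single app_form_tensor)
  show "app (form_tensor \<alpha>) as = (\<lambda>x. 0)" if "\<not> args_ok N (sig (form_tensor \<alpha>)) as" for as
    using that form_off[OF \<alpha>] by (auto simp: args_ok_single form_tensor_def split: list.splits arg.splits)
  fix as b i f g x assume ok: "args_ok N (sig (form_tensor \<alpha>)) as"
    and i: "i < length (sig (form_tensor \<alpha>))" and b: "arg_ok N (sig (form_tensor \<alpha>) ! i) b"
    and f: "f \<in> sf" and g: "g \<in> sf"
  have "args_ok N [Cov] [b]" using i b by (simp add: args_ok_def)
  then obtain X Y where X: "X \<in> vf" "as = [Vec X]" and Y: "Y \<in> vf" "b = Vec Y"
    using ok by (auto simp: args_ok_single)
  show "app (form_tensor \<alpha>) (as[i := arg_comb f (as ! i) g b]) x =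
      f x * app (form_tensor \<alpha>) as x + g x * app (form_tensor \<alpha>) (as[i := b]) x"
    using i form_comb_arg[OF \<alpha> X(1) Y(1) f g] by (simp add: X Y app_form_tensor)
qed

lemma vec_tensor_field:
  assumes X: "X \<in> vf"
  shows "vec_tensor N X \<in> tf"
proof (rule tfI)
  show "app (vec_tensor N X) as \<in> sf" if "args_ok N (sig (vec_tensor N X)) as" for as
    using that form_sf by (auto simp: args_ok_single app_vec_tensor)
  show "app (vec_tensor N X) as = (\<lambda>x. 0)" if "\<not> args_ok N (sig (vec_tensor N X)) as" for as
    using that by (auto simp: args_ok_single vec_tensor_def split: list.splits arg.splits)
  fix as b i f g x assume ok: "args_ok N (sig (vec_tensor N X)) as"
    and i: "i < length (sig (vec_tensor N X))" and b: "arg_ok N (sig (vec_tensor N X) ! i) b"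
    and f: "f \<in> sf" and g: "g \<in> sf"
  have "args_ok N [Con] [b]" using i b by (simp add: args_ok_def)
  then obtain \<alpha> \<beta> where \<alpha>: "\<alpha> \<in> of1" "as = [Form \<alpha>]" and \<beta>: "\<beta> \<in> of1" "b = Form \<beta>"
    using ok by (auto simp: args_ok_single)
  show "app (vec_tensor N X) (as[i := arg_comb f (as ! i) g b]) x =
      f x * app (vec_tensor N X) as x + g x * app (vec_tensor N X) (as[i := b]) x"
    using i form_comb[OF \<alpha>(1) \<beta>(1) f g] by (simp add: \<alpha> \<beta> app_vec_tensor)
qed

lemma tensor_prods_simps [simp]:
  "tensor_prods N [] = fun_tensor one" "tensor_prods N (T # Ts) = tensor_prod T (tensor_prods N Ts)"
  by (simp_all add: tensor_prods_def)

lemma tensor_prods_field: "set Ts \<subseteq> tf \<Longrightarrow> tensor_prods N Ts \<in> tf"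
  by (induction Ts) (auto intro: fun_tensor_field sf_one tensor_prod_field)

lemma sig_tensor_prods: "sig (tensor_prods N Ts) = concat (map sig Ts)"
  by (induction Ts) auto

text \<open>Cuts an argument list into one block per factor, so that a permutation of the factors
  can be matched by a permutation of the blocks.\<close>

lemma args_ok_blocks:
  "args_ok N (concat (map sig Ts)) as \<Longrightarrow>
    \<exists>bs. as = concat bs \<and> list_all2 (\<lambda>T b. args_ok N (sig T) b) Ts bs"
proof (induction Ts arbitrary: as)
  case Nil
  then show ?case by (intro exI[of _ "[]"]) (simp add: args_ok_Nil)
next
  case (Cons T Ts)
  then have ok: "args_ok N (sig T) (take (length (sig T)) as)"
    "args_ok N (concat (map sig Ts)) (drop (length (sig T)) as)"
    by (simp_all add: args_ok_append)
  from Cons.IH[OF ok(2)] obtain bs where "drop (length (sig T)) as = concat bs"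
    "list_all2 (\<lambda>T b. args_ok N (sig T) b) Ts bs" by auto
  then show ?case using ok(1)
    by (intro exI[of _ "take (length (sig T)) as # bs"]) (auto, metis append_take_drop_id)
qed

lemma blocks_args_ok:
  "list_all2 (\<lambda>T b. args_ok N (sig T) b) Ts bs \<Longrightarrow> args_ok N (concat (map sig Ts)) (concat bs)"
  unfolding args_ok_def
  by (induction rule: list_all2_induct) (auto intro: list_all2_appendI)

lemma fdg_form: "f \<in> sf \<Longrightarrow> g \<in> sf \<Longrightarrow> fdg N f g \<in> of1"
  by (rule formI) (auto simp: fdg_def vf_comb vf_sf algebra_simps intro!: sf_mult)

text \<open>Phrased with \<open>permute_list\<close>, the summands are products over lists with the
  same multiset of factors.\<close>

lemma wedge_eq: "wedge N Ts = tensor_sum (concat (map sig Ts))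
    (\<lambda>\<pi>. tensor_scale (of_int (sign \<pi>)) (tensor_prods N (permute_list \<pi> Ts))) {\<pi>. \<pi> permutes {..<length Ts}}"
  by (simp add: wedge_def permute_list_def)

lemma wedge_field:
  assumes "set Ts \<subseteq> tf" "\<And>T. T \<in> set Ts \<Longrightarrow> sig T = [s]"
  shows "wedge N Ts \<in> tf" "sig (wedge N Ts) = replicate (length Ts) s"
    "\<And>\<pi>. \<pi> permutes {..<length Ts} \<Longrightarrow>
      sig (tensor_prods N (permute_list \<pi> Ts)) = replicate (length Ts) s"
proof -
  have sg: "concat (map sig Us) = replicate (length Us) s" if "\<And>T. T \<in> set Us \<Longrightarrow> sig T = [s]" for Us :: "'a tensor list"
    using that by (induction Us) auto
  show sp: "sig (tensor_prods N (permute_list \<pi> Ts)) = replicate (length Ts) s" if "\<pi> permutes {..<length Ts}" for \<pi>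
    unfolding sig_tensor_prods using sg[of "permute_list \<pi> Ts"] that assms(2) by simp
  show "sig (wedge N Ts) = replicate (length Ts) s"
    using sg[OF assms(2)] by (simp add: wedge_def)
  show "wedge N Ts \<in> tf"
    unfolding wedge_eq
  proof (rule tensor_sum_field)
    fix \<pi> assume "\<pi> \<in> {\<pi>. \<pi> permutes {..<length Ts}}"
    then have \<pi>: "\<pi> permutes {..<length Ts}" by simp
    have "tensor_prods N (permute_list \<pi> Ts) \<in> tf"
      by (rule tensor_prods_field) (use assms(1) \<pi> in simp)
    then show "tensor_scale (of_int (sign \<pi>)) (tensor_prods N (permute_list \<pi> Ts)) \<in> tf"
      by (rule tensor_scale_field)
    show "sig (tensor_scale (of_int (sign \<pi>)) (tensor_prods N (permute_list \<pi> Ts))) = concat (map sig Ts)"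
      using sp[OF \<pi>] sg[OF assms(2)] by simp
  qed (simp add: finite_permutations)
qed

end

section \<open>Lie derivative along a fixed vector field, and homogeneous tensors\<close>

locale derivation = smooth_atlas N for N :: "'a manifold" +
  fixes D :: "'a vfield"
  assumes D: "D \<in> vf"
begin

abbreviation "lie \<equiv> lie_derivative N D"

definition homog :: "'a tensor \<Rightarrow> real \<Rightarrow> bool" where
  "homog K w \<longleftrightarrow> lie K = tensor_scale w K"

lemma sig_lie [simp]: "sig (lie T) = sig T"
  by (simp add: lie_derivative_def)

lemma app_lie: "args_ok N (sig T) as \<Longrightarrow>
    app (lie T) as x = D (app T as) x - (\<Sum>i<length as. app T (as[i := lie_arg N D (as ! i)]) x)"
  by (simp add: lie_derivative_def)

lemma app_lie_not_ok: "\<not> args_ok N (sig T) as \<Longrightarrow> app (lie T) as x = 0"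
  by (simp add: lie_derivative_def)

lemma app_lie_off:
  assumes "T \<in> tf" "x \<notin> points N"
  shows "app (lie T) as x = 0"
proof (cases "args_ok N (sig T) as")
  case True
  then show ?thesis using vf_off[OF D assms(2)] tf_app_off[OF assms] by (simp add: app_lie)
qed (simp add: app_lie_not_ok)

text \<open>At ill-formed arguments and off the carrier both sides are zero by the conventions for
  extension.\<close>

lemma homogI:
  assumes K: "K \<in> tf"
    and "\<And>as x. args_ok N (sig K) as \<Longrightarrow> x \<in> points N \<Longrightarrow> app (lie K) as x = w * app K as x"
  shows "homog K w"
proof -
  have "app (lie K) as x = w * app K as x" for as x
    using assms app_lie_not_ok[of K as x] tf_app_not_ok[OF K, of as] app_lie_off[OF K, of x as] tf_app_off[OF K, of x as]
    by (cases "args_ok N (sig K) as"; cases "x \<in> points N") auto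
  then show ?thesis
    unfolding homog_def by (intro tensor.expand) (simp add: app_simps fun_eq_iff)
qed

lemma homogD: "homog K w \<Longrightarrow> app (lie K) as x = w * app K as x"
  unfolding homog_def by (simp add: app_simps)

text \<open>The sum over the slots splits at \<open>length a\<close>: a substitution in one block
  leaves the other factor unchanged.\<close>

lemma lie_prod:
  assumes T: "T \<in> tf" and S: "S \<in> tf" and a: "args_ok N (sig T) a" and b: "args_ok N (sig S) b"
  shows "app (lie (tensor_prod T S)) (a @ b) x = app (lie T) a x * app S b x + app T a x * app (lie S) b x"
proof -
  let ?u = "\<lambda>as i. as[i := lie_arg N D (as ! i)]"
  have la: "length a = length (sig T)" "length b = length (sig S)" using args_ok_length a b by auto
  have ok: "args_ok N (sig (tensor_prod T S)) (a @ b)" using a b la by (simp add: args_ok_append)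
  have "D (app (tensor_prod T S) (a @ b)) x = D (\<lambda>x. app T a x * app S b x) x"
    using la by (simp add: tensor_prod_def)
  also have "\<dots> = D (app T a) x * app S b x + app T a x * D (app S b) x"
    using vf_mult[OF D tf_app_sf[OF T] tf_app_sf[OF S]] by simp
  finally have 1: "D (app (tensor_prod T S) (a @ b)) x = D (app T a) x * app S b x + app T a x * D (app S b) x" .
  have 2: "(\<Sum>i<length a. app (tensor_prod T S) (?u (a @ b) i) x) = (\<Sum>i<length a. app T (?u a i) x) * app S b x"
    unfolding sum_distrib_right
    by (rule sum.cong) (simp_all add: la app_simps list_update_append1 nth_append)
  have 3: "(\<Sum>i<length b. app (tensor_prod T S) (?u (a @ b) (length a + i)) x) = app T a x * (\<Sum>i<length b. app S (?u b i) x)"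
    unfolding sum_distrib_left
    by (rule sum.cong) (simp_all add: la(1)[symmetric] app_simps list_update_append)
  show ?thesis
    unfolding app_lie[OF ok] app_lie[OF a] app_lie[OF b] length_append sum_lessThan_add 1 2 3
    by (simp add: algebra_simps)
qed

lemma lie_sum:
  assumes T: "\<And>i. i \<in> I \<Longrightarrow> T i \<in> tf" "\<And>i. i \<in> I \<Longrightarrow> sig (T i) = \<sigma>" and I: "finite I"
    and as: "args_ok N \<sigma> as"
  shows "app (lie (tensor_sum \<sigma> T I)) as x = (\<Sum>i\<in>I. app (lie (T i)) as x)"
proof -
  have "D (app (tensor_sum \<sigma> T I) as) x = (\<Sum>i\<in>I. D (app (T i) as) x)"
    using vf_sum[OF I D, of "\<lambda>i. app (T i) as"] tf_app_sf[OF T(1)] by (simp add: tensor_sum_def)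
  then show ?thesis
    using as T(2) by (simp add: app_lie app_simps sum_subtractf sum.swap[of _ I])
qed

lemma homog_prod:
  assumes "T \<in> tf" "S \<in> tf" "homog T v" "homog S w"
  shows "homog (tensor_prod T S) (v + w)"
proof (rule homogI[OF tensor_prod_field[OF assms(1,2)]])
  fix as x assume "args_ok N (sig (tensor_prod T S)) as"
  then have ok: "args_ok N (sig T) (take (length (sig T)) as)" "args_ok N (sig S) (drop (length (sig T)) as)"
    by (simp_all add: args_ok_append)
  show "app (lie (tensor_prod T S)) as x = (v + w) * app (tensor_prod T S) as x"
    using lie_prod[OF assms(1,2) ok, of x] homogD[OF assms(3)] homogD[OF assms(4)]
    by (simp add: app_simps algebra_simps)
qed

lemma homog_sum:
  assumes T: "\<And>i. i \<in> I \<Longrightarrow> T i \<in> tf" "\<And>i. i \<in> I \<Longrightarrow> sig (T i) = \<sigma>" and I: "finite I"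
    and h: "\<And>i. i \<in> I \<Longrightarrow> homog (T i) w"
  shows "homog (tensor_sum \<sigma> T I) w"
proof (rule homogI[OF tensor_sum_field[OF T I]])
  fix as x assume "args_ok N (sig (tensor_sum \<sigma> T I)) as"
  then have ok: "args_ok N \<sigma> as" by simp
  show "app (lie (tensor_sum \<sigma> T I)) as x = w * app (tensor_sum \<sigma> T I) as x"
    using lie_sum[OF T I ok] homogD[OF h] by (simp add: app_simps sum_distrib_left)
qed

lemma homog_scale:
  assumes T: "T \<in> tf" and h: "homog T w"
  shows "homog (tensor_scale c T) w"
proof (rule homogI[OF tensor_scale_field[OF T]])
  fix as x assume ok: "args_ok N (sig (tensor_scale c T)) as"
  have "D (app (tensor_scale c T) as) x = c * D (app T as) x"
    using vf_cmult[OF D tf_app_sf[OF T]] by (simp add: tensor_scale_def)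
  then have "app (lie (tensor_scale c T)) as x = c * app (lie T) as x"
    using ok by (simp add: app_lie app_simps sum_distrib_left right_diff_distrib)
  then show "app (lie (tensor_scale c T)) as x = w * app (tensor_scale c T) as x"
    using homogD[OF h] by (simp add: app_simps)
qed

lemma homog_fun:
  assumes "f \<in> sf" "D f = (\<lambda>x. w * f x)"
  shows "homog (fun_tensor f) w"
proof (rule homogI[OF fun_tensor_field[OF assms(1)]])
  fix as x assume "args_ok N (sig (fun_tensor f)) as"
  then show "app (lie (fun_tensor f)) as x = w * app (fun_tensor f) as x"
    using assms(2) by (simp add: app_lie args_ok_Nil) (simp add: fun_tensor_def)
qed

lemma app_lie_form:
  "Y \<in> vf \<Longrightarrow> app (lie (form_tensor \<alpha>)) [Vec Y] x = D (\<alpha> Y) x - \<alpha> (lie_bracket D Y) x"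
  using app_lie[of "form_tensor \<alpha>" "[Vec Y]" x] by (simp add: args_ok_single app_form_tensor)

text \<open>The bracket term exchanges \<open>D (Y g)\<close> for \<open>Y (D g) = w * Y g\<close>,
  while \<open>D f\<close> contributes \<open>v\<close>.\<close>

lemma homog_fdg:
  assumes f: "f \<in> sf" "D f = (\<lambda>x. v * f x)" and g: "g \<in> sf" "D g = (\<lambda>x. w * g x)"
  shows "homog (form_tensor (fdg N f g)) (v + w)"
proof (rule homogI[OF form_tensor_field[OF fdg_form[OF f(1) g(1)]]])
  fix as x assume "args_ok N (sig (form_tensor (fdg N f g))) as"
  then obtain Y where Y: "Y \<in> vf" "as = [Vec Y]" by (auto simp: args_ok_single)
  have "D (fdg N f g Y) x = D (\<lambda>x. f x * Y g x) x" by (simp add: fdg_def Y)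
  also have "\<dots> = v * f x * Y g x + f x * D (Y g) x"
    using vf_mult[OF D f(1) vf_sf[OF Y(1)]] f(2) by simp
  finally show "app (lie (form_tensor (fdg N f g))) as x = (v + w) * app (form_tensor (fdg N f g)) as x"
    using vf_bracket[OF D Y(1)] vf_cmult[OF Y(1) g(1)] g(2)
    by (simp add: Y app_lie_form app_form_tensor fdg_def lie_bracket_def algebra_simps)
qed

text \<open>The argument is a form \<open>\<alpha>\<close>, whose own Lie derivative removes
  \<open>D (\<alpha> Y)\<close> and leaves \<open>\<alpha> (lie_bracket D Y)\<close>.\<close>

lemma homog_vec:
  assumes Y: "Y \<in> vf" and b: "lie_bracket D Y = (\<lambda>h x. w * Y h x)"
  shows "homog (vec_tensor N Y) w"
proof (rule homogI[OF vec_tensor_field[OF Y]])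
  fix as x assume ok: "args_ok N (sig (vec_tensor N Y)) as"
  then obtain \<alpha> where \<alpha>: "\<alpha> \<in> of1" "as = [Form \<alpha>]" by (auto simp: args_ok_single)
  have "app (lie (vec_tensor N Y)) as x = D (\<alpha> Y) x - (D (\<alpha> Y) x - \<alpha> (lie_bracket D Y) x)"
    using app_lie[OF ok, of x] form_lie[OF D \<alpha>(1)] Y by (simp add: \<alpha> app_vec_tensor)
  then show "app (lie (vec_tensor N Y)) as x = w * app (vec_tensor N Y) as x"
    using form_cscale_arg[OF \<alpha>(1) Y, of w] by (simp add: \<alpha> app_vec_tensor b)
qed

text \<open>The Leibniz rule says that value and Lie derivative multiply like the two components of
  a dual number.\<close>

lemma eval_tensor_prods:
  assumes "set Ts \<subseteq> tf" "list_all2 (\<lambda>T b. args_ok N (sig T) b) Ts bs" "x \<in> points N"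
  shows "(app (tensor_prods N Ts) (concat bs) x, app (lie (tensor_prods N Ts)) (concat bs) x) =
    dual_prod (map (\<lambda>(T, b). (app T b x, app (lie T) b x)) (zip Ts bs))"
  using assms(2,1)
proof (induction rule: list_all2_induct)
  case Nil
  \<comment> \<open>The empty product is the unit function, which \<open>D\<close> kills; on the
    carrier it gives the neutral dual number \<open>(1, 0)\<close>.\<close>
  have "app (lie (fun_tensor one)) [] x = 0"
    using vf_one[OF D] app_lie[of "fun_tensor one" "[]" x] by (simp add: args_ok_Nil fun_tensor_def)
  then show ?case using assms(3) by (simp add: fun_tensor_def)
next
  case (Cons T Ts b bs)
  have "args_ok N (sig (tensor_prods N Ts)) (concat bs)"
    unfolding sig_tensor_prods by (rule blocks_args_ok[OF Cons.hyps(2)])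
  then have "app (lie (tensor_prod T (tensor_prods N Ts))) (b @ concat bs) x =
      app (lie T) b x * app (tensor_prods N Ts) (concat bs) x + app T b x * app (lie (tensor_prods N Ts)) (concat bs) x"
    using Cons.prems by (intro lie_prod tensor_prods_field Cons.hyps(1)) auto
  moreover have "app (tensor_prod T (tensor_prods N Ts)) (b @ concat bs) x = app T b x * app (tensor_prods N Ts) (concat bs) x"
    using args_ok_length[OF Cons.hyps(1)] by (simp add: app_simps)
  ultimately show ?case
    using Cons.IH Cons.prems by (simp add: dual_mult_def prod_eq_iff)
qed

text \<open>The two products may have different signatures, so they are not compared as tensors:
  values and Lie derivatives agree at arguments whose blocks are permuted along with the
  factors.\<close>

lemma homog_tensor_prods_perm:
  assumes Ts: "set Ts \<subseteq> tf" and perm: "mset Ts' = mset Ts" and h: "homog (tensor_prods N Ts) w"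
  shows "homog (tensor_prods N Ts') w"
proof (rule homogI)
  have Ts': "set Ts' \<subseteq> tf" using Ts perm mset_eq_setD by blast
  then show "tensor_prods N Ts' \<in> tf" by (rule tensor_prods_field)
  fix as x assume "args_ok N (sig (tensor_prods N Ts')) as" and x: "x \<in> points N"
  then obtain bs' where bs': "as = concat bs'" "list_all2 (\<lambda>T b. args_ok N (sig T) b) Ts' bs'"
    unfolding sig_tensor_prods using args_ok_blocks by metis
  \<comment> \<open>Each factor of \<open>Ts\<close> receives the block that it had in
    \<open>Ts'\<close>; comparing multisets of pairs takes care of repeated factors.\<close>
  obtain bs where bs: "length bs = length Ts" "mset (zip Ts bs) = mset (zip Ts' bs')"
    using ex_mset_zip_left[OF list_all2_lengthD[OF bs'(2)] perm[symmetric]] by auto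
  have ok: "list_all2 (\<lambda>T b. args_ok N (sig T) b) Ts bs"
    using bs' mset_eq_setD[OF bs(2)] bs(1) by (auto simp: list_all2_iff)
  let ?F = "\<lambda>(T, b). (app T b x, app (lie T) b x)"
  have "dual_prod (map ?F (zip Ts bs)) = dual_prod (map ?F (zip Ts' bs'))"
    by (rule dual_prod_perm) (simp add: bs(2))
  then show "app (lie (tensor_prods N Ts')) as x = w * app (tensor_prods N Ts') as x"
    using eval_tensor_prods[OF Ts ok x] eval_tensor_prods[OF Ts' bs'(2) x] homogD[OF h, of "concat bs" x]
    unfolding bs'(1) by (metis prod.inject)
qed

text \<open>Each summand is a multiple of a permuted product, and since the factors share one
  signature, so do the summands.\<close>

lemma homog_wedge:
  assumes Ts: "set Ts \<subseteq> tf" "\<And>T. T \<in> set Ts \<Longrightarrow> sig T = [s]" and h: "homog (tensor_prods N Ts) w"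
  shows "homog (wedge N Ts) w"
  unfolding wedge_eq
proof (rule homog_sum)
  fix \<pi> assume "\<pi> \<in> {\<pi>. \<pi> permutes {..<length Ts}}"
  then have \<pi>: "\<pi> permutes {..<length Ts}" by simp
  have f: "tensor_prods N (permute_list \<pi> Ts) \<in> tf"
    by (rule tensor_prods_field) (use Ts(1) \<pi> in simp)
  then show "tensor_scale (of_int (sign \<pi>)) (tensor_prods N (permute_list \<pi> Ts)) \<in> tf"
    by (rule tensor_scale_field)
  show "sig (tensor_scale (of_int (sign \<pi>)) (tensor_prods N (permute_list \<pi> Ts))) = concat (map sig Ts)"
    using wedge_field(2)[OF Ts] wedge_field(3)[OF Ts \<pi>] by (simp add: wedge_def)
  have "homog (tensor_prods N (permute_list \<pi> Ts)) w"
    by (rule homog_tensor_prods_perm[OF Ts(1) mset_permute_list[OF \<pi>] h])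
  with f show "homog (tensor_scale (of_int (sign \<pi>)) (tensor_prods N (permute_list \<pi> Ts))) w"
    by (rule homog_scale)
qed (simp add: finite_permutations)

end

section \<open>Degrees of lifts\<close>

lemma list_all2_replicate:
  "(\<And>x. x \<in> set xs \<Longrightarrow> P x d) \<Longrightarrow> list_all2 P xs (replicate (length xs) d)"
  by (simp add: list_all2_conv_all_nth)

context jet_lift
begin

sublocale JD: derivation JB \<Delta>
  by unfold_locales (rule weight_field_vf)

lemma has_degree_iff: "has_degree M r K w \<longleftrightarrow> JD.homog K w"
  unfolding has_degree_def JD.homog_def ..

lemmas lift_clauses = lift[unfolded is_lift_def]

lemma lift_scale: "K \<in> tensor_fields M \<Longrightarrow> L k (tensor_scale c K) = tensor_scale c (L k K)"
  by (rule lift_clauses[THEN conjunct2, THEN conjunct2, THEN conjunct1, rule_format])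

lemma lift_add: "K \<in> tensor_fields M \<Longrightarrow> K' \<in> tensor_fields M \<Longrightarrow> sig K = sig K' \<Longrightarrow>
    L k (tensor_add K K') = tensor_add (L k K) (L k K')"
  by (rule lift_clauses[THEN conjunct2, THEN conjunct2, THEN conjunct2, THEN conjunct1, rule_format])

lemma lift_fdg: "k \<in> {0..int r} \<Longrightarrow> f \<in> sf \<Longrightarrow> g \<in> sf \<Longrightarrow>
    L k (form_tensor (fdg M f g)) = tensor_sum [Cov]
      (\<lambda>m. form_tensor (fdg JB (fun_lift M r m f) (fun_lift M r (k - m) g))) {0..k}"
  by (rule lift_clauses[THEN conjunct2, THEN conjunct2, THEN conjunct2, THEN conjunct2, THEN conjunct2,
        THEN conjunct1, rule_format])

lemma lift_vec: "k \<in> {0..int r} \<Longrightarrow> X \<in> vf \<Longrightarrow> \<exists>Y\<in>J.vf. L k (vec_tensor M X) = vec_tensor JB Y \<and>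
    (\<forall>f\<in>sf. \<forall>m\<in>{0..int r}. Y (fun_lift M r m f) = fun_lift M r (k + m - int r) (X f))"
  by (rule lift_clauses[THEN conjunct2, THEN conjunct2, THEN conjunct2, THEN conjunct2, THEN conjunct2,
        THEN conjunct2, THEN conjunct1, rule_format])

lemma lift_prod: "k \<in> {0..int r} \<Longrightarrow> T \<in> tf \<Longrightarrow> S \<in> tf \<Longrightarrow>
    L k (tensor_prod T S) = tensor_sum (sig T @ sig S) (\<lambda>m. tensor_prod (L m T) (L (k - m) S)) {0..k}"
  by (rule lift_clauses[THEN conjunct2, THEN conjunct2, THEN conjunct2, THEN conjunct2, THEN conjunct2,
        THEN conjunct2, THEN conjunct2, rule_format])

text \<open>The degree minus the upper index, required for all \<open>k\<close> at once, because the
  product rule for one index involves all lower ones.\<close>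

definition lift_degree :: "'a tensor \<Rightarrow> real \<Rightarrow> bool" where
  "lift_degree K d \<longleftrightarrow> (\<forall>k\<in>{0..int r}. JD.homog (L k K) (of_int k + d))"

lemma lift_degreeD: "lift_degree K d \<Longrightarrow> k \<in> {0..int r} \<Longrightarrow> JD.homog (L k K) (of_int k + d)"
  unfolding lift_degree_def by blast

lemma lift_degree_prod:
  assumes T: "T \<in> tf" "lift_degree T c" and S: "S \<in> tf" "lift_degree S d"
  shows "lift_degree (tensor_prod T S) (c + d)"
  unfolding lift_degree_def
proof
  fix k assume k: "k \<in> {0..int r}"
  have "JD.homog (tensor_prod (L m T) (L (k - m) S)) (of_int k + (c + d))" if m: "m \<in> {0..k}" for m
  proof -
    have "JD.homog (tensor_prod (L m T) (L (k - m) S)) ((of_int m + c) + (of_int (k - m) + d))"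
      using k m by (intro JD.homog_prod lift_field T(1) S(1) lift_degreeD T(2) S(2)) auto
    then show ?thesis by (simp add: algebra_simps)
  qed
  then show "JD.homog (L k (tensor_prod T S)) (of_int k + (c + d))"
    unfolding lift_prod[OF k T(1) S(1)]
    by (intro JD.homog_sum) (auto intro!: J.tensor_prod_field lift_field T(1) S(1) simp: lift_field(2) T(1) S(1))
qed

lemma homog_lift_sum:
  assumes "finite I" "\<And>i. i \<in> I \<Longrightarrow> T i \<in> tf" "\<And>i. i \<in> I \<Longrightarrow> sig (T i) = \<sigma>" "\<And>i. i \<in> I \<Longrightarrow> JD.homog (L k (T i)) w"
  shows "JD.homog (L k (tensor_sum \<sigma> T I)) w"
  using assms
proof (induction I rule: finite_induct)
  case empty
  have Z: "tensor_sum \<sigma> T {} \<in> tf" by (rule tensor_sum_field) auto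
  \<comment> \<open>The empty sum is 0 times itself, so homogeneity of \<open>L k\<close> under
    scaling forces its lift to vanish.\<close>
  have "tensor_scale 0 (tensor_sum \<sigma> T {}) = tensor_sum \<sigma> T {}"
    by (simp add: tensor_scale_def tensor_sum_def)
  then have eq: "L k (tensor_sum \<sigma> T {}) = tensor_scale 0 (L k (tensor_sum \<sigma> T {}))"
    using lift_scale[OF Z, of k 0] by simp
  show ?case
  proof (rule JD.homogI[OF lift_field(1)[OF Z]])
    fix as j assume ok: "args_ok JB (sig (L k (tensor_sum \<sigma> T {}))) as"
    have 0: "app (L k (tensor_sum \<sigma> T {})) as = (\<lambda>x. 0)" for as
      by (subst eq) (simp add: fun_eq_iff app_simps)
    show "app (JD.lie (L k (tensor_sum \<sigma> T {}))) as j = w * app (L k (tensor_sum \<sigma> T {})) as j"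
      unfolding JD.app_lie[OF ok] 0 by (simp add: J.vf_zero[OF weight_field_vf])
  qed
next
  case (insert i I)
  have f: "tensor_sum \<sigma> T I \<in> tf" "T i \<in> tf" "sig (T i) = \<sigma>"
    using insert.prems insert.hyps by (auto intro!: tensor_sum_field)
  \<comment> \<open>A sum of two tensors is presented as a sum over \<open>bool\<close>, to which
    \<open>JD.homog_sum\<close> applies.\<close>
  let ?b = "\<lambda>b. if b then L k (T i) else L k (tensor_sum \<sigma> T I)"
  have "tensor_sum \<sigma> T (insert i I) = tensor_add (T i) (tensor_sum \<sigma> T I)"
    using insert.hyps f(3) by (simp add: tensor_sum_def tensor_add_def)
  then have "L k (tensor_sum \<sigma> T (insert i I)) = tensor_add (L k (T i)) (L k (tensor_sum \<sigma> T I))"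
    using lift_add[OF f(2,1)] f(3) by simp
  also have "\<dots> = tensor_sum \<sigma> ?b UNIV"
    by (simp add: tensor_add_def tensor_sum_def UNIV_bool lift_field(2)[OF f(2)] f(3) add.commute)
  finally have eq: "L k (tensor_sum \<sigma> T (insert i I)) = tensor_sum \<sigma> ?b UNIV" .
  show ?case unfolding eq
    using insert.IH insert.prems insert.hyps f lift_field
    by (intro JD.homog_sum) auto
qed

lemma lift_degree_sum:
  assumes "finite I" "\<And>i. i \<in> I \<Longrightarrow> T i \<in> tf" "\<And>i. i \<in> I \<Longrightarrow> sig (T i) = \<sigma>" "\<And>i. i \<in> I \<Longrightarrow> lift_degree (T i) d"
  shows "lift_degree (tensor_sum \<sigma> T I) d"
  unfolding lift_degree_def
proof
  fix k assume "k \<in> {0..int r}"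
  then show "JD.homog (L k (tensor_sum \<sigma> T I)) (of_int k + d)"
    by (intro homog_lift_sum assms(1-3) lift_degreeD assms(4))
qed

lemma lift_degree_scale: "T \<in> tf \<Longrightarrow> lift_degree T d \<Longrightarrow> lift_degree (tensor_scale c T) d"
  unfolding lift_degree_def by (simp add: lift_scale JD.homog_scale lift_field)

lemma homog_fun_lift: "f \<in> sf \<Longrightarrow> JD.homog (fun_tensor (fun_lift M r k f)) (of_int k)"
  by (rule JD.homog_fun[OF fun_lift_smooth weight_fun_lift])

lemma lift_degree_fun: "f \<in> sf \<Longrightarrow> lift_degree (fun_tensor f) 0"
  unfolding lift_degree_def using homog_fun_lift by (simp add: lift_fun)

lemma lift_degree_fdg: "f \<in> sf \<Longrightarrow> g \<in> sf \<Longrightarrow> lift_degree (form_tensor (fdg M f g)) 0"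
  unfolding lift_degree_def
proof
  fix k assume f: "f \<in> sf" and g: "g \<in> sf" and k: "k \<in> {0..int r}"
  have "JD.homog (form_tensor (fdg JB (fun_lift M r m f) (fun_lift M r (k - m) g))) (of_int k + 0)" for m
  proof -
    have "JD.homog (form_tensor (fdg JB (fun_lift M r m f) (fun_lift M r (k - m) g))) (of_int m + of_int (k - m))"
      by (intro JD.homog_fdg fun_lift_smooth weight_fun_lift f g)
    then show ?thesis by simp
  qed
  then show "JD.homog (L k (form_tensor (fdg M f g))) (of_int k + 0)"
    unfolding lift_fdg[OF k f g]
    by (intro JD.homog_sum J.form_tensor_field J.fdg_form fun_lift_smooth f g) auto
qed

lemma fun_lift_const_near:
  assumes "f \<in> sf" "openin (mtop M) B" "\<And>x. x \<in> B \<Longrightarrow> f x = 1" "j \<in> jets M r" "jet_rep j 0 \<in> B" "k \<in> {0..int r}"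
  shows "fun_lift M r k f j = (if k = 0 then 1 else 0)"
proof -
  have "(deriv ^^ m) (\<lambda>t. f (jet_rep j t)) 0 = (deriv ^^ m) (\<lambda>t. 1) 0" for m
    by (rule deriv_pow_cong[OF curve_open[OF jets_rep(1)[OF assms(4)] assms(2)]]) (use assms in auto)
  moreover have "(deriv ^^ m) (\<lambda>t. 1) = (\<lambda>t::real. if m = 0 then 1 else 0 :: real)" for m
    by (induction m) auto
  ultimately show ?thesis using assms(4,6) by (simp add: fun_lift_def points_JB)
qed

text \<open>With \<open>E\<^sub>i = \<rho> \<partial>/\<partial>x\<^sup>i\<close> and \<open>g\<^sub>i = x\<^sup>i\<close> near the support of \<open>\<rho>\<close>, every vector field satisfies
  \<open>\<rho> X = \<Sum>\<^sub>i X(g\<^sub>i) E\<^sub>i\<close>, hence \<open>\<rho> \<alpha> = \<Sum>\<^sub>i \<alpha>(E\<^sub>i) dg\<^sub>i\<close>.\<close>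

lemma form_local_decomposition:
  assumes \<alpha>: "\<alpha> \<in> of1" and x0: "x0 \<in> points M"
  obtains \<rho> B f g where "\<rho> \<in> sf" "openin (mtop M) B" "x0 \<in> B" "\<And>x. x \<in> B \<Longrightarrow> \<rho> x = 1"
    "\<And>i. i < n \<Longrightarrow> f i \<in> sf" "\<And>i. i < n \<Longrightarrow> g i \<in> sf"
    "(\<lambda>X x. \<rho> x * \<alpha> X x) = (\<lambda>X x. \<Sum>i<n. fdg M (f i) (g i) X x)"
proof -
  obtain U \<phi> where U: "(U, \<phi>) \<in> matlas M" "x0 \<in> U" by (rule point_chart[OF x0])
  obtain W C B D \<rho> g where W: "openin (Euclidean_space n) W" "W \<subseteq> \<phi> ` U" "\<And>q. q \<in> W \<Longrightarrow> star_set q W"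
    and C: "C \<subseteq> U" "\<phi> ` C \<subseteq> W" "closedin (mtop M) C"
    and \<rho>: "\<rho> \<in> sf" "\<And>x. x \<notin> C \<Longrightarrow> \<rho> x = 0"
    and B: "openin (mtop M) B" "x0 \<in> B" "B \<subseteq> C" "\<And>x. x \<in> B \<Longrightarrow> \<rho> x = 1"
    and D: "openin (mtop M) D" "C \<subseteq> D" "D \<subseteq> U"
    and g: "\<And>i. i < n \<Longrightarrow> g i \<in> sf" "\<And>i x. i < n \<Longrightarrow> x \<in> D \<Longrightarrow> g i x = \<phi> x i"
    by (rule chart_bump[OF U]) (rule that)
  note C' = C(1,2) closedin_chart_closed[OF C(3)]
  have inv: "inv_into U \<phi> (\<phi> x) = x" if "x \<in> C" for x using inv_chart[OF U(1)] that C(1) by blast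
  have CU: "\<phi> x \<in> \<phi> ` U" if "x \<in> C" for x using that C(1) by blast
  define E where "E i F = (if F \<in> sf
    then cut_off C \<rho> (\<lambda>x. partial_deriv i (\<lambda>y. F (inv_into U \<phi> y)) (\<phi> x)) else (\<lambda>x. 0))" for i F
  have pd: "part_diff n (\<phi> ` U) (\<lambda>y. F (inv_into U \<phi> y))" if "F \<in> sf" for F
    by (rule smooth_on_part_diff[OF chart(2)[OF U(1)] sf_chart[OF that U(1)]])
  have E: "E i \<in> vf" if i: "i < n" for i
  proof (rule vfI)
    show "E i F \<in> sf" if F: "F \<in> sf" for F
    proof -
      have "smooth_on n W (partial_deriv i (\<lambda>y. F (inv_into U \<phi> y)))"
        by (rule smooth_on_subset[OF chart(2)[OF U(1)] W(1,2)
            smooth_on_partial_deriv[OF chart(2)[OF U(1)] sf_chart[OF F U(1)] i]])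
      from cut_off_smooth[OF U(1) W(1,2) C' \<rho> this] show ?thesis
        unfolding E_def if_P[OF F] .
    qed
    fix F G a b x assume F: "F \<in> sf" and G: "G \<in> sf"
    have FG: "(\<lambda>x. a * F x + b * G x) \<in> sf" "(\<lambda>x. F x * G x) \<in> sf" "(\<lambda>x. a * F x) \<in> sf" "(\<lambda>x. b * G x) \<in> sf"
      by (intro sf_add sf_cmult sf_mult F G)+
    show "E i (\<lambda>x. a * F x + b * G x) x = a * E i F x + b * E i G x"
    proof (cases "x \<in> C")
      case True
      note add = partial_deriv_add[OF pd[OF FG(3)] pd[OF FG(4)] CU[OF True] i]
      note m = partial_deriv_mult[OF part_diff_const pd CU[OF True] i]
      show ?thesis using True add m[OF F] m[OF G] F G FG
        by (simp add: E_def cut_off_def algebra_simps)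
    qed (simp add: E_def cut_off_def)
    show "E i (\<lambda>x. F x * G x) x = E i F x * G x + F x * E i G x"
    proof (cases "x \<in> C")
      case True
      show ?thesis using True partial_deriv_mult[OF pd[OF F] pd[OF G] CU[OF True] i] F G FG inv[OF True]
        by (simp add: E_def cut_off_def algebra_simps)
    qed (simp add: E_def cut_off_def)
  qed (simp add: E_def)
  have X: "(\<lambda>F x. \<rho> x * X F x) = (\<lambda>F x. \<Sum>i<n. X (g i) x * E i F x)" if X: "X \<in> vf" for X
  proof (intro ext)
    fix F x
    show "\<rho> x * X F x = (\<Sum>i<n. X (g i) x * E i F x)"
    \<comment> \<open>\<open>derivation_in_chart\<close> applies where \<open>\<rho>\<close> does
      not vanish; elsewhere both sides are zero.\<close>
    proof (cases "F \<in> sf \<and> x \<in> C \<and> \<rho> x \<noteq> 0")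
      case True
      have "X F x = (\<Sum>i<n. X (g i) x * partial_deriv i (\<lambda>y. F (inv_into U \<phi> y)) (\<phi> x))"
        by (rule derivation_in_chart[OF U(1) W C' \<rho> g(1) _ X]) (use True g(2) D(2) in auto)
      then show ?thesis using True by (simp add: E_def cut_off_def sum_distrib_left mult_ac)
    next
      case False
      then have "E i F x = 0" for i by (auto simp: E_def cut_off_def)
      moreover have "\<rho> x * X F x = 0" using False \<rho>(2) vf_nonsmooth[OF X, of F] by auto
      ultimately show ?thesis by simp
    qed
  qed
  have "\<rho> x * \<alpha> X x = (\<Sum>i<n. fdg M (\<alpha> (E i)) (g i) X x)" for X x
  proof (cases "X \<in> vf")
    case True
    have "\<alpha> (\<lambda>F x. \<rho> x * X F x) = \<alpha> (\<lambda>F x. \<Sum>i<n. X (g i) x * E i F x)"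
      using X[OF True] by simp
    also have "\<dots> = (\<lambda>x. \<Sum>i<n. X (g i) x * \<alpha> (E i) x)"
      by (rule form_sum_arg[OF finite_lessThan \<alpha>]) (use E vf_sf[OF True] in auto)
    finally show ?thesis
      using form_scale_arg[OF \<alpha> True \<rho>(1)] True by (simp add: fdg_def fun_eq_iff mult.commute)
  qed (simp add: fdg_def form_off[OF \<alpha>])
  then show ?thesis
    using that[of \<rho> B "\<lambda>i. \<alpha> (E i)" g] \<rho>(1) B(1,2,4) form_sf[OF \<alpha>] g(1) by (simp add: fun_eq_iff)
qed

text \<open>Brings \<open>\<rho> \<alpha>\<close> into the shape to which the product rule of
  \<open>is_lift\<close> applies.\<close>

lemma form_tensor_mult: "form_tensor (\<lambda>X x. f x * \<alpha> X x) = tensor_prod (fun_tensor f) (form_tensor \<alpha>)"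
  by (intro tensor.expand) (auto simp: form_tensor_def fun_tensor_def tensor_prod_def fun_eq_iff split: list.splits arg.splits)

lemma form_tensor_sum: "form_tensor (\<lambda>X x. \<Sum>i\<in>I. \<alpha> i X x) = tensor_sum [Cov] (\<lambda>i. form_tensor (\<alpha> i)) I"
  by (intro tensor.expand) (auto simp: form_tensor_def tensor_sum_def fun_eq_iff split: list.splits arg.splits)

text \<open>The lift is local: at \<open>j\<close>, only the term with \<open>\<rho>\<^sup>(\<^sup>0\<^sup>)\<close> survives in the product rule for \<open>\<rho> \<otimes> \<alpha>\<close>.\<close>

lemma lift_form_cut_off:
  assumes \<alpha>: "\<alpha> \<in> of1" and \<rho>: "\<rho> \<in> sf" and B: "openin (mtop M) B" "\<And>x. x \<in> B \<Longrightarrow> \<rho> x = 1"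
    and j: "j \<in> jets M r" "jet_rep j 0 \<in> B" and k: "k \<in> {0..int r}" and ok: "args_ok JB [Cov] as"
  defines "A \<equiv> form_tensor (\<lambda>X x. \<rho> x * \<alpha> X x)"
  shows "app (L k A) as j = app (L k (form_tensor \<alpha>)) as j"
    "app (JD.lie (L k A)) as j = app (JD.lie (L k (form_tensor \<alpha>))) as j"
proof -
  let ?F = "\<lambda>m. fun_tensor (fun_lift M r m \<rho>)" and ?S = "\<lambda>m. L m (form_tensor \<alpha>)"
  have fields: "?F m \<in> J.tf" "?S m \<in> J.tf" "sig (?S m) = [Cov]" for m
    using J.fun_tensor_field[OF fun_lift_smooth[OF \<rho>]] lift_field[OF form_tensor_field[OF \<alpha>]] by simp_all
  have eq: "L k A = tensor_sum [Cov] (\<lambda>m. tensor_prod (?F m) (?S (k - m))) {0..k}"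
    unfolding A_def form_tensor_mult
    using lift_prod[OF k fun_tensor_field[OF \<rho>] form_tensor_field[OF \<alpha>]] lift_fun[OF \<rho>] by simp
  have F: "fun_lift M r m \<rho> j = (if m = 0 then 1 else 0)" if "m \<in> {0..k}" for m
    using fun_lift_const_near[OF \<rho> B j] k that by simp
  have nil: "app (?F m) [] j = (if m = 0 then 1 else 0)" if "m \<in> {0..k}" for m
    using F[OF that] by (simp add: fun_tensor_def)
  \<comment> \<open>The Lie derivative multiplies \<open>fun_lift M r m \<rho>\<close> by
    \<open>m\<close>: for \<open>m = 0\<close> this factor is zero, for \<open>m > 0\<close> the
    value at \<open>j\<close> is.\<close>
  have nil': "app (JD.lie (?F m)) [] j = 0" if "m \<in> {0..k}" for m
    using nil[OF that] JD.homogD[OF homog_fun_lift[OF \<rho>], of m "[]" j] by simp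
  have z: "(\<Sum>m\<in>{0..k}. (if m = 0 then 1 else 0) * h m) = h 0" for h :: "int \<Rightarrow> real"
    using k by (subst sum.mono_neutral_right[of _ "{0}"]) auto
  have "app (L k A) as j = (\<Sum>m\<in>{0..k}. (if m = 0 then 1 else 0) * app (?S (k - m)) as j)"
    unfolding eq app_simps using nil by (intro sum.cong) (auto simp: app_simps)
  then show "app (L k A) as j = app (?S k) as j" unfolding z by simp
  have "app (JD.lie (L k A)) as j = (\<Sum>m\<in>{0..k}. app (JD.lie (tensor_prod (?F m) (?S (k - m)))) as j)"
    unfolding eq by (rule JD.lie_sum[OF _ _ _ ok]) (auto intro!: J.tensor_prod_field fields(1,2) simp: fields(3))
  also have "\<dots> = (\<Sum>m\<in>{0..k}. (if m = 0 then 1 else 0) * app (JD.lie (?S (k - m))) as j)"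
  proof (rule sum.cong[OF refl])
    fix m assume m: "m \<in> {0..k}"
    show "app (JD.lie (tensor_prod (?F m) (?S (k - m)))) as j = (if m = 0 then 1 else 0) * app (JD.lie (?S (k - m))) as j"
      using JD.lie_prod[OF fields(1) fields(2), of m "[]" "k - m" as j] ok nil[OF m] nil'[OF m]
      by (simp add: J.args_ok_Nil fields(3))
  qed
  finally show "app (JD.lie (L k A)) as j = app (JD.lie (?S k)) as j" unfolding z by simp
qed

lemma lift_degree_form:
  assumes \<alpha>: "\<alpha> \<in> of1"
  shows "lift_degree (form_tensor \<alpha>) 0"
  unfolding lift_degree_def
proof
  fix k assume k: "k \<in> {0..int r}"
  note S = lift_field[OF form_tensor_field[OF \<alpha>]]
  show "JD.homog (L k (form_tensor \<alpha>)) (of_int k + 0)"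
  proof (rule JD.homogI[OF S(1)])
    fix as j assume "args_ok JB (sig (L k (form_tensor \<alpha>))) as" and "j \<in> points JB"
    then have ok: "args_ok JB [Cov] as" and j: "j \<in> jets M r" using S(2) points_JB by auto
    obtain \<rho> B f g where \<rho>: "\<rho> \<in> sf" "openin (mtop M) B" "jet_rep j 0 \<in> B" "\<And>x. x \<in> B \<Longrightarrow> \<rho> x = 1"
      and fg: "\<And>i. i < n \<Longrightarrow> f i \<in> sf" "\<And>i. i < n \<Longrightarrow> g i \<in> sf"
      and eq: "(\<lambda>X x. \<rho> x * \<alpha> X x) = (\<lambda>X x. \<Sum>i<n. fdg M (f i) (g i) X x)"
      by (rule form_local_decomposition[OF \<alpha> curve_points[OF jets_rep(1)[OF j], of 0]]) (rule that)
    have "lift_degree (form_tensor (\<lambda>X x. \<rho> x * \<alpha> X x)) 0"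
      unfolding eq form_tensor_sum
      by (rule lift_degree_sum) (auto intro!: form_tensor_field fdg_form lift_degree_fdg fg)
    from JD.homogD[OF lift_degreeD[OF this k], of as j]
    show "app (JD.lie (L k (form_tensor \<alpha>))) as j = (of_int k + 0) * app (L k (form_tensor \<alpha>)) as j"
      using lift_form_cut_off[OF \<alpha> \<rho>(1,2,4) j \<rho>(3) k ok] by simp
  qed
qed

text \<open>The lifts of coordinate functions on the base are coordinates on the jet bundle.\<close>

lemma jet_derivation_zero:
  assumes Z: "Z \<in> J.vf" and 0: "\<And>f m. f \<in> sf \<Longrightarrow> m \<le> r \<Longrightarrow> Z (fun_lift M r (int m) f) = (\<lambda>j. 0)"
  shows "Z F j = 0"
proof (cases "F \<in> J.sf \<and> j \<in> jets M r")
  case True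
  then have F: "F \<in> J.sf" and j: "j \<in> jets M r" by auto
  obtain U \<phi> where U: "(U, \<phi>) \<in> matlas M" "jet_rep j 0 \<in> U"
    by (rule point_chart[OF curve_points[OF jets_rep(1)[OF j]]])
  obtain W C B D \<rho> g where W: "openin (Euclidean_space n) W" "W \<subseteq> \<phi> ` U" "\<And>q. q \<in> W \<Longrightarrow> star_set q W"
    and C: "C \<subseteq> U" "\<phi> ` C \<subseteq> W" "closedin (mtop M) C"
    and \<rho>: "\<rho> \<in> sf" "\<And>x. x \<notin> C \<Longrightarrow> \<rho> x = 0"
    and B: "openin (mtop M) B" "jet_rep j 0 \<in> B" "B \<subseteq> C" "\<And>x. x \<in> B \<Longrightarrow> \<rho> x = 1"
    and D: "openin (mtop M) D" "C \<subseteq> D" "D \<subseteq> U"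
    and g: "\<And>i. i < n \<Longrightarrow> g i \<in> sf" "\<And>i x. i < n \<Longrightarrow> x \<in> D \<Longrightarrow> g i x = \<phi> x i"
    by (rule chart_bump[OF U]) (rule that)
  \<comment> \<open>The cylinder over \<open>W\<close>. Star-shapedness passes from \<open>W\<close>
    to \<open>W'\<close> because the fibre directions are unrestricted, and for the same reason the
    bump may be pulled back from the base as \<open>\<rho>'\<close>.\<close>
  define W' where "W' = {y \<in> rvec (n * Suc r). base y \<in> W}"
  define \<rho>' where "\<rho>' = fun_lift M r 0 \<rho>"
  define g' where "g' k = fun_lift M r (int (k div n)) (g (k mod n))" for k
  have \<rho>'_eq: "\<rho>' i = (if i \<in> jets M r then \<rho> (jet_rep i 0) else 0)" for i
    by (simp add: \<rho>'_def fun_lift_def points_JB)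
  have "Z F j = (\<Sum>k<mdim JB. Z (g' k) j * partial_deriv k (\<lambda>y. F (inv_into (jdom U) (jcoord \<phi>) y)) (jcoord \<phi> j))"
  proof (rule J.derivation_in_chart[OF jet_chart_atlas[OF U(1)], where W = W' and C = "jdom C" and \<rho> = \<rho>'])
    show "openin (Euclidean_space (mdim JB)) W'"
      unfolding W'_def mdim_JB by (rule base_preimage_open[OF W(1)])
    show "W' \<subseteq> jcoord \<phi> ` jdom U"
      unfolding W'_def jcoord_image[OF U(1) order_refl] using W(2) by auto
    show "star_set p W'" if "p \<in> W'" for p
      unfolding star_set_def
    proof (intro ballI)
      fix x t assume x: "x \<in> W'" and t: "t \<in> {0..1::real}"
      have "(\<lambda>i. base p i + t * (base x i - base p i)) \<in> W"
        using W(3)[of "base p"] that x t unfolding star_set_def W'_def by blast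
      moreover have "base (\<lambda>i. p i + t * (x i - p i)) = (\<lambda>i. base p i + t * (base x i - base p i))"
        by (auto simp: base_def)
      ultimately show "(\<lambda>i. p i + t * (x i - p i)) \<in> W'"
        using that x by (simp add: W'_def rvec_def)
    qed
    show "jdom C \<subseteq> jdom U" using C(1) by (auto simp: jdom_def)
    then show "jcoord \<phi> ` jdom C \<subseteq> W'"
      using jcoord_rvec C(2) base_jcoord[OF U(1)] unfolding W'_def by (fastforce simp: jdom_def)
    show "J.chart_closed (jdom C)"
      unfolding J.chart_closed_def
    proof (intro allI impI)
      fix V \<Phi> assume "(V, \<Phi>) \<in> matlas JB"
      then obtain U' \<phi>' where U': "(U', \<phi>') \<in> matlas M" "V = jdom U'" "\<Phi> = jcoord \<phi>'"
        unfolding matlas_JB by (elim exE conjE)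
      have "jdom U' - jdom C = jdom (U' - C)" by (auto simp: jdom_def)
      moreover have "openin (Euclidean_space (n * Suc r)) (jcoord \<phi>' ` jdom (U' - C))"
        by (rule jcoord_image_open[OF U'(1) openin_diff[OF chart(1)[OF U'(1)] C(3)]]) auto
      ultimately show "openin (Euclidean_space (mdim JB)) (\<Phi> ` (V - jdom C))"
        by (simp add: U' mdim_JB)
    qed
    show "\<rho>' \<in> J.sf" unfolding \<rho>'_def by (rule fun_lift_smooth[OF \<rho>(1)])
    show "\<rho>' i = 0" if "i \<notin> jdom C" for i using that \<rho>(2) by (auto simp: \<rho>'_eq jdom_def)
    show "g' k \<in> J.sf" if "k < mdim JB" for k
      unfolding g'_def by (rule fun_lift_smooth[OF g(1)]) (use index_split(2) that mdim_JB in simp)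
    show "g' k i = jcoord \<phi> i k" if k: "k < mdim JB" and i: "i \<in> jdom C" for k i
      unfolding g'_def
    proof (rule fun_lift_coord[OF _ U(1) D(1,3)])
      show k': "k < n * Suc r" using k mdim_JB by simp
      show "g (k mod n) x = \<phi> x (k mod n)" if "x \<in> D" for x
        by (rule g(2)[OF index_split(2)[OF k'] that])
    qed (use i D(2) in \<open>auto simp: jdom_def\<close>)
    show "j \<in> jdom C" using j B by (auto simp: jdom_def)
    show "\<rho>' j \<noteq> 0" using j B by (simp add: \<rho>'_eq)
  qed (rule Z, rule F)
  also have "\<dots> = 0"
  proof (rule sum.neutral, intro ballI)
    fix k assume "k \<in> {..<mdim JB}"
    then have k: "k < n * Suc r" using mdim_JB by simp
    have "Z (g' k) = (\<lambda>j. 0)"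
      unfolding g'_def by (rule 0[OF g(1)[OF index_split(2)[OF k]] index_split(1)[OF k]])
    then show "Z (g' k) j * partial_deriv k (\<lambda>y. F (inv_into (jdom U) (jcoord \<phi>) y)) (jcoord \<phi> j) = 0" by simp
  qed
  finally show ?thesis .
next
  case False
  then show ?thesis using J.vf_nonsmooth[OF Z] J.vf_off[OF Z] points_JB by auto
qed

text \<open>On a lifted function of index \<open>m\<close>, the two terms of the bracket carry the
  factors \<open>k + m - r\<close> and \<open>m\<close>. Their difference \<open>k - r\<close> does
  not depend on \<open>m\<close>, so one scalar works for all lifted functions.\<close>

lemma lift_vec_bracket:
  assumes X: "X \<in> vf" and k: "k \<in> {0..int r}"
  shows "\<exists>Y\<in>J.vf. L k (vec_tensor M X) = vec_tensor JB Y \<and>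
    lie_bracket \<Delta> Y = (\<lambda>F j. (of_int k - real r) * Y F j)"
proof -
  obtain Y where Y: "Y \<in> J.vf" "L k (vec_tensor M X) = vec_tensor JB Y"
    "\<And>f m. f \<in> sf \<Longrightarrow> m \<in> {0..int r} \<Longrightarrow> Y (fun_lift M r m f) = fun_lift M r (k + m - int r) (X f)"
    using lift_vec[OF k X] by auto
  let ?c = "of_int k - real r"
  \<comment> \<open>The factors \<open>J.one\<close> only turn the real coefficients into smooth
    functions, as \<open>J.vf_comb\<close> expects; \<open>Z_eq\<close> removes them.\<close>
  define Z where "Z = (\<lambda>F j. J.one j * lie_bracket \<Delta> Y F j + ((- ?c) * J.one j) * Y F j)"
  have Z: "Z \<in> J.vf"
    unfolding Z_def by (intro J.vf_comb J.vf_bracket weight_field_vf Y(1) J.sf_one J.sf_const)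
  have Z_eq: "Z F j = lie_bracket \<Delta> Y F j - ?c * Y F j" for F j
    using J.vf_off[OF J.vf_bracket[OF weight_field_vf Y(1)], of j F] J.vf_off[OF Y(1), of j F]
    by (cases "j \<in> points JB") (simp_all add: Z_def algebra_simps)
  have "Z (fun_lift M r (int m) f) = (\<lambda>j. 0)" if f: "f \<in> sf" and m: "m \<le> r" for f m
  proof
    fix j
    let ?f = "fun_lift M r (int m) f" and ?g = "fun_lift M r (k + int m - int r) (X f)"
    have Yf: "Y ?f = ?g" using Y(3)[OF f] m by simp
    have "Y (\<Delta> ?f) = (\<lambda>j. real m * ?g j)"
      using weight_fun_lift[OF f, of "int m"] J.vf_cmult[OF Y(1) fun_lift_smooth[OF f]] Yf by simp
    moreover have "\<Delta> (Y ?f) = (\<lambda>j. of_int (k + int m - int r) * ?g j)"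
      unfolding Yf by (rule weight_fun_lift[OF vf_sf[OF X]])
    ultimately have "lie_bracket \<Delta> Y ?f j = of_int (k + int m - int r) * ?g j - real m * ?g j"
      by (simp add: lie_bracket_def)
    then show "Z ?f j = 0" using Yf by (simp add: Z_eq algebra_simps)
  qed
  from jet_derivation_zero[OF Z this] have "lie_bracket \<Delta> Y F j = ?c * Y F j" for F j
    using Z_eq[of F j] by simp
  then show ?thesis using Y(1,2) by (intro bexI[of _ Y]) (auto simp: fun_eq_iff)
qed

lemma lift_degree_vec:
  assumes X: "X \<in> vf"
  shows "lift_degree (vec_tensor M X) (- real r)"
  unfolding lift_degree_def
proof
  fix k assume k: "k \<in> {0..int r}"
  obtain Y where Y: "Y \<in> J.vf" "L k (vec_tensor M X) = vec_tensor JB Y"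
    "lie_bracket \<Delta> Y = (\<lambda>F j. (of_int k - real r) * Y F j)"
    using lift_vec_bracket[OF X k] by auto
  show "JD.homog (L k (vec_tensor M X)) (of_int k + - real r)"
    unfolding Y(2) using JD.homog_vec[OF Y(1,3)] by simp
qed

section \<open>Lifts of tensor products and wedge products\<close>

lemma lift_degree_prods:
  "list_all2 (\<lambda>T d. T \<in> tf \<and> lift_degree T d) Ts ds \<Longrightarrow> lift_degree (tensor_prods M Ts) (sum_list ds)"
proof (induction rule: list_all2_induct)
  case Nil
  then show ?case using lift_degree_fun[OF sf_one] by simp
next
  case (Cons T Ts d ds)
  have "set Ts \<subseteq> tf"
    using Cons.hyps(2) by (auto simp: list_all2_conv_all_nth in_set_conv_nth)
  then show ?case
    using Cons by (auto intro!: lift_degree_prod tensor_prods_field)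
qed

text \<open>The factors share the offset \<open>d\<close>, so the list of offsets is the same for
  every permuted product and all summands have equal degree.\<close>

lemma lift_degree_wedge:
  assumes Ts: "set Ts \<subseteq> tf" "\<And>T. T \<in> set Ts \<Longrightarrow> sig T = [s]" and d: "\<And>T. T \<in> set Ts \<Longrightarrow> lift_degree T d"
  shows "lift_degree (wedge M Ts) (real (length Ts) * d)"
  unfolding wedge_eq
proof (rule lift_degree_sum)
  fix \<pi> assume "\<pi> \<in> {\<pi>. \<pi> permutes {..<length Ts}}"
  then have \<pi>: "\<pi> permutes {..<length Ts}" by simp
  have f: "tensor_prods M (permute_list \<pi> Ts) \<in> tf"
    by (rule tensor_prods_field) (use Ts(1) \<pi> in simp)
  then show "tensor_scale (of_int (sign \<pi>)) (tensor_prods M (permute_list \<pi> Ts)) \<in> tf"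
    by (rule tensor_scale_field)
  show "sig (tensor_scale (of_int (sign \<pi>)) (tensor_prods M (permute_list \<pi> Ts))) = concat (map sig Ts)"
    using wedge_field(2)[OF Ts] wedge_field(3)[OF Ts \<pi>] by (simp add: wedge_def)
  have "lift_degree (tensor_prods M (permute_list \<pi> Ts)) (sum_list (replicate (length Ts) d))"
  proof (rule lift_degree_prods)
    show "list_all2 (\<lambda>T d. T \<in> tf \<and> lift_degree T d) (permute_list \<pi> Ts) (replicate (length Ts) d)"
      using list_all2_replicate[of "permute_list \<pi> Ts" "\<lambda>T d. T \<in> tf \<and> lift_degree T d" d] Ts(1) d \<pi> by auto
  qed
  then show "lift_degree (tensor_scale (of_int (sign \<pi>)) (tensor_prods M (permute_list \<pi> Ts))) (real (length Ts) * d)"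
    using lift_degree_scale[OF f] by (simp add: sum_list_replicate)
qed (simp add: finite_permutations)

definition lift_series :: "'a jet \<Rightarrow> 'a tensor \<times> 'a jet arg list \<Rightarrow> real fps \<times> real fps" where
  "lift_series j = (\<lambda>(T, b). (Abs_fps (\<lambda>m. app (L (int m) T) b j), Abs_fps (\<lambda>m. app (JD.lie (L (int m) T)) b j)))"

text \<open>The values of \<open>L 0 K, L 1 K, \<dots>\<close> at fixed arguments are the coefficients of a power
  series, which turns the product rule for the lift into a product of power series.\<close>

lemma eval_lift_tensor_prods:
  assumes "set Ts \<subseteq> tf" "list_all2 (\<lambda>T b. args_ok JB (sig T) b) Ts bs" "j \<in> jets M r" "k \<le> r"
  shows "(app (L (int k) (tensor_prods M Ts)) (concat bs) j, app (JD.lie (L (int k) (tensor_prods M Ts))) (concat bs) j) =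
    map_prod (\<lambda>a. fps_nth a k) (\<lambda>a. fps_nth a k)
      (dual_prod (map (lift_series j) (zip Ts bs)))"
  using assms(2,1,4)
proof (induction arbitrary: k rule: list_all2_induct)
  case Nil
  \<comment> \<open>The series of the unit function is the power series 1, because its lifts of
    positive index vanish.\<close>
  have *: "fun_lift M r (int k) one j = (if k = 0 then 1 else 0)"
    using fun_lift_const_near[OF sf_one openin_topspace, of j "int k"] Nil.prems curve_points[OF jets_rep(1)[OF assms(3)]] assms(3)
    by simp
  have "app (JD.lie (fun_tensor (fun_lift M r (int k) one))) [] j = 0"
    unfolding JD.homogD[OF homog_fun_lift[OF sf_one]] using * by (simp add: fun_tensor_def)
  moreover have "app (fun_tensor (fun_lift M r (int k) one)) [] j = (if k = 0 then 1 else 0)"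
    using * by (simp add: fun_tensor_def)
  ultimately show ?case by (simp add: lift_fun[OF sf_one])
next
  case (Cons T Ts b bs)
  let ?P = "tensor_prods M Ts"
  have T: "T \<in> tf" and P: "?P \<in> tf" using Cons.prems(1) by (auto intro: tensor_prods_field)
  have k: "int k \<in> {0..int r}" using Cons.prems by simp
  have okb: "args_ok JB (sig T) b" by (rule Cons.hyps(1))
  have okP: "args_ok JB (sig ?P) (concat bs)"
    unfolding sig_tensor_prods by (rule J.blocks_args_ok[OF Cons.hyps(2)])
  have okTP: "args_ok JB (sig T @ sig ?P) (b @ concat bs)"
    using okb okP J.args_ok_length[OF okb] by (simp add: J.args_ok_append)
  have eq: "L (int k) (tensor_prod T ?P) = tensor_sum (sig T @ sig ?P) (\<lambda>m. tensor_prod (L m T) (L (int k - m) ?P)) {0..int k}"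
    by (rule lift_prod[OF k T P])
  \<comment> \<open>Lifts are indexed by integers, coefficients of power series by naturals.\<close>
  have re: "(\<Sum>m\<in>{0..int k}. h m (int k - m)) = (\<Sum>m=0..k. h (int m) (int (k - m)))" for h :: "int \<Rightarrow> int \<Rightarrow> real"
  proof -
    have "{0..int k} = int ` {0..k}" by (simp add: image_int_atLeastAtMost)
    then show ?thesis by (simp add: sum.reindex of_nat_diff)
  qed
  have 1: "app (L (int k) (tensor_prod T ?P)) (b @ concat bs) j =
      (\<Sum>m=0..k. app (L (int m) T) b j * app (L (int (k - m)) ?P) (concat bs) j)"
    unfolding eq app_simps lift_field(2)[OF T] using J.args_ok_length[OF okb]
    by (simp add: re[of "\<lambda>m m'. app (L m T) b j * app (L m' ?P) (concat bs) j"])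
  have "app (JD.lie (L (int k) (tensor_prod T ?P))) (b @ concat bs) j =
      (\<Sum>m\<in>{0..int k}. app (JD.lie (tensor_prod (L m T) (L (int k - m) ?P))) (b @ concat bs) j)"
    unfolding eq
    by (rule JD.lie_sum[OF _ _ _ okTP]) (auto intro!: J.tensor_prod_field lift_field(1) T P simp: lift_field(2) T P)
  also have "\<dots> = (\<Sum>m\<in>{0..int k}. app (JD.lie (L m T)) b j * app (L (int k - m) ?P) (concat bs) j +
      app (L m T) b j * app (JD.lie (L (int k - m) ?P)) (concat bs) j)"
    by (intro sum.cong refl JD.lie_prod lift_field(1) T P) (simp_all add: lift_field(2) T P okb okP)
  also have "\<dots> = (\<Sum>m=0..k. app (JD.lie (L (int m) T)) b j * app (L (int (k - m)) ?P) (concat bs) j +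
      app (L (int m) T) b j * app (JD.lie (L (int (k - m)) ?P)) (concat bs) j)"
    by (rule re)
  finally have 2: "app (JD.lie (L (int k) (tensor_prod T ?P))) (b @ concat bs) j = \<dots>" .
  define Q where "Q = dual_prod (map (lift_series j) (zip Ts bs))"
  have IH: "app (L (int (k - m)) ?P) (concat bs) j = fps_nth (fst Q) (k - m)"
    "app (JD.lie (L (int (k - m)) ?P)) (concat bs) j = fps_nth (snd Q) (k - m)" for m
    using Cons.IH[of "k - m"] Cons.prems by (simp_all add: map_prod_def prod_eq_iff case_prod_unfold Q_def)
  have "app (L (int k) (tensor_prod T ?P)) (b @ concat bs) j = fps_nth (fst (dual_mult (lift_series j (T, b)) Q)) k"
    by (simp only: 1 IH) (simp add: lift_series_def dual_mult_def fps_mult_nth)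
  moreover have "app (JD.lie (L (int k) (tensor_prod T ?P))) (b @ concat bs) j =
      fps_nth (snd (dual_mult (lift_series j (T, b)) Q)) k"
    by (simp only: 2 IH) (simp add: lift_series_def dual_mult_def fps_mult_nth sum.distrib)
  ultimately show ?case
    by (simp add: Q_def[symmetric] map_prod_def case_prod_unfold)
qed

text \<open>The permutation argument once more, now with dual numbers over power series: the degree
  of \<open>L k\<close> of a product depends on the lifts of all lower indices of its
  factors.\<close>

lemma homog_lift_tensor_prods_perm:
  assumes Ts: "set Ts \<subseteq> tf" and perm: "mset Ts' = mset Ts" and k: "k \<le> r"
    and h: "JD.homog (L (int k) (tensor_prods M Ts)) w"
  shows "JD.homog (L (int k) (tensor_prods M Ts')) w"
proof (rule JD.homogI)
  have Ts': "set Ts' \<subseteq> tf" using Ts perm mset_eq_setD by blast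
  note P = lift_field[OF tensor_prods_field[OF Ts']]
  show "L (int k) (tensor_prods M Ts') \<in> J.tf" by (rule P(1))
  fix as j assume "args_ok JB (sig (L (int k) (tensor_prods M Ts'))) as" and "j \<in> points JB"
  then have "args_ok JB (concat (map sig Ts')) as" and j: "j \<in> jets M r"
    using P(2) points_JB by (simp_all add: sig_tensor_prods)
  \<comment> \<open>Lifting keeps signatures; \<open>L 0\<close> merely supplies tensors on the jet
    bundle with the signatures of \<open>Ts'\<close>, so that \<open>J.args_ok_blocks\<close> can be
    used.\<close>
  moreover have "map sig (map (L 0) Ts') = map sig Ts'"
    using lift_field(2)[of _ 0] Ts' by (simp add: subset_iff)
  ultimately have "args_ok JB (concat (map sig (map (L 0) Ts'))) as" by (simp only:)
  from J.args_ok_blocks[OF this]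
  obtain bs' where bs': "as = concat bs'" "list_all2 (\<lambda>T b. args_ok JB (sig T) b) (map (L 0) Ts') bs'"
    by (elim exE conjE) (rule that)
  have ok': "list_all2 (\<lambda>T b. args_ok JB (sig T) b) Ts' bs'"
    using bs'(2) Ts' lift_field(2) by (auto simp: list_all2_conv_all_nth subset_iff)
  obtain bs where bs: "length bs = length Ts" "mset (zip Ts bs) = mset (zip Ts' bs')"
    using ex_mset_zip_left[OF list_all2_lengthD[OF ok'] perm[symmetric]] by auto
  have ok: "list_all2 (\<lambda>T b. args_ok JB (sig T) b) Ts bs"
    using ok' mset_eq_setD[OF bs(2)] bs(1) by (auto simp: list_all2_iff)
  have "dual_prod (map (lift_series j) (zip Ts bs)) = dual_prod (map (lift_series j) (zip Ts' bs'))"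
    by (rule dual_prod_perm) (simp add: bs(2))
  then show "app (JD.lie (L (int k) (tensor_prods M Ts'))) as j = w * app (L (int k) (tensor_prods M Ts')) as j"
    using eval_lift_tensor_prods[OF Ts ok j k] eval_lift_tensor_prods[OF Ts' ok' j k] JD.homogD[OF h, of "concat bs" j]
    unfolding bs'(1) by (metis prod.inject)
qed

text \<open>The forms contribute 0 and each vector field \<open>- r\<close> to the sum of
  offsets.\<close>

lemma lift_degree_mixed_prods:
  assumes "set \<alpha>s \<subseteq> of1" "set Xs \<subseteq> vf"
  shows "lift_degree (tensor_prods M (map form_tensor \<alpha>s @ map (vec_tensor M) Xs)) (- (real (length Xs) * real r))"
proof -
  have "list_all2 (\<lambda>T d. T \<in> tf \<and> lift_degree T d) (map form_tensor \<alpha>s @ map (vec_tensor M) Xs)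
    (replicate (length (map form_tensor \<alpha>s)) 0 @ replicate (length (map (vec_tensor M) Xs)) (- real r))"
    using assms
    by (intro list_all2_appendI list_all2_replicate)
      (auto intro!: form_tensor_field vec_tensor_field lift_degree_form lift_degree_vec)
  from lift_degree_prods[OF this] show ?thesis by (simp add: sum_list_replicate)
qed

lemma lift_degree_form_wedge:
  assumes "set \<alpha>s \<subseteq> of1"
  shows "wedge M (map form_tensor \<alpha>s) \<in> tf" "lift_degree (wedge M (map form_tensor \<alpha>s)) 0"
proof -
  have *: "set (map form_tensor \<alpha>s) \<subseteq> tf" "\<And>T. T \<in> set (map form_tensor \<alpha>s) \<Longrightarrow> sig T = [Cov]"
    using assms by (auto intro!: form_tensor_field)
  show "wedge M (map form_tensor \<alpha>s) \<in> tf" by (rule wedge_field(1)[OF *])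
  have "lift_degree (wedge M (map form_tensor \<alpha>s)) (real (length (map form_tensor \<alpha>s)) * 0)"
    by (rule lift_degree_wedge[OF *]) (use assms in \<open>auto intro!: lift_degree_form\<close>)
  then show "lift_degree (wedge M (map form_tensor \<alpha>s)) 0" by simp
qed

lemma lift_degree_vec_wedge:
  assumes "set Xs \<subseteq> vf"
  shows "wedge M (map (vec_tensor M) Xs) \<in> tf"
    "lift_degree (wedge M (map (vec_tensor M) Xs)) (- (real (length Xs) * real r))"
proof -
  have *: "set (map (vec_tensor M) Xs) \<subseteq> tf" "\<And>T. T \<in> set (map (vec_tensor M) Xs) \<Longrightarrow> sig T = [Con]"
    using assms by (auto intro!: vec_tensor_field)
  show "wedge M (map (vec_tensor M) Xs) \<in> tf" by (rule wedge_field(1)[OF *])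
  have "lift_degree (wedge M (map (vec_tensor M) Xs)) (real (length (map (vec_tensor M) Xs)) * (- real r))"
    by (rule lift_degree_wedge[OF *]) (use assms in \<open>auto intro!: lift_degree_vec\<close>)
  then show "lift_degree (wedge M (map (vec_tensor M) Xs)) (- (real (length Xs) * real r))" by simp
qed

lemma has_degree_lift: "lift_degree K d \<Longrightarrow> k \<le> r \<Longrightarrow> w = real k + d \<Longrightarrow> has_degree M r (L (int k) K) w"
  unfolding has_degree_iff using lift_degreeD[of K d "int k"] by simp

end

theorem theorem4p18:
  fixes M :: "'a manifold" and r l :: nat
    and L :: "int \<Rightarrow> 'a tensor \<Rightarrow> 'a jet tensor"
  assumes "smooth_manifold M" and "l \<le> r" and "is_lift M r L"
  shows
    \<comment> \<open>(a)\<close>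
    "(\<forall>\<alpha>s. set \<alpha>s \<subseteq> one_forms M \<longrightarrow>
       has_degree M r (L (int l) (tensor_prods M (map form_tensor \<alpha>s))) (real l)) \<and>
    \<comment> \<open>(b)\<close>
     (\<forall>Xs. set Xs \<subseteq> vector_fields M \<longrightarrow>
       has_degree M r (L (int l) (tensor_prods M (map (vec_tensor M) Xs)))
         (real l - real (length Xs) * real r)) \<and>
    \<comment> \<open>(c)\<close>
     (\<forall>\<alpha>s Xs. set \<alpha>s \<subseteq> one_forms M \<and> set Xs \<subseteq> vector_fields M \<longrightarrow>
       has_degree M r
         (L (int l) (tensor_prods M (map form_tensor \<alpha>s @ map (vec_tensor M) Xs)))
         (real l - real (length Xs) * real r)) \<and>
    \<comment> \<open>(d): permuting the factors of a homogeneous tensor product on the jet bundle, or of a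
        tensor product on the base that is then lifted\<close>
     (\<forall>Ts Ts' w. set Ts \<subseteq> tensor_fields (jet_bundle M r) \<and> mset Ts' = mset Ts \<and>
         has_degree M r (tensor_prods (jet_bundle M r) Ts) w \<longrightarrow>
       has_degree M r (tensor_prods (jet_bundle M r) Ts') w) \<and>
     (\<forall>Ts Ts' w. set Ts \<subseteq> tensor_fields M \<and> mset Ts' = mset Ts \<and>
         has_degree M r (L (int l) (tensor_prods M Ts)) w \<longrightarrow>
       has_degree M r (L (int l) (tensor_prods M Ts')) w) \<and>
    \<comment> \<open>(d): wedge products on the jet bundle, and lifts of wedge products\<close>
     (\<forall>Ts w. (set Ts \<subseteq> form_tensor ` one_forms (jet_bundle M r) \<or>
          set Ts \<subseteq> vec_tensor (jet_bundle M r) ` vector_fields (jet_bundle M r)) \<and>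
         has_degree M r (tensor_prods (jet_bundle M r) Ts) w \<longrightarrow>
       has_degree M r (wedge (jet_bundle M r) Ts) w) \<and>
     (\<forall>\<alpha>s Xs. set \<alpha>s \<subseteq> one_forms M \<and> set Xs \<subseteq> vector_fields M \<longrightarrow>
       has_degree M r (L (int l) (wedge M (map form_tensor \<alpha>s))) (real l) \<and>
       has_degree M r (L (int l) (wedge M (map (vec_tensor M) Xs)))
         (real l - real (length Xs) * real r) \<and>
       has_degree M r
         (L (int l) (tensor_prod (wedge M (map form_tensor \<alpha>s)) (wedge M (map (vec_tensor M) Xs))))
         (real l - real (length Xs) * real r)) \<and>
    \<comment> \<open>complete lifts\<close>
     (\<forall>\<omega>s Xs. set \<omega>s \<subseteq> one_forms M \<and> set Xs \<subseteq> vector_fields M \<longrightarrow>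
       has_degree M r
         (L (int r) (tensor_prod (wedge M (map form_tensor \<omega>s)) (wedge M (map (vec_tensor M) Xs))))
         (- (real (length Xs) - 1) * real r)) \<and>
     (\<forall>X\<in>vector_fields M. \<exists>Y\<in>vector_fields (jet_bundle M r).
       L (int r) (vec_tensor M X) = vec_tensor (jet_bundle M r) Y \<and>
       lie_bracket (weight_field M r) Y = (\<lambda>F j. 0))"
proof -
  interpret jet_lift M r L
    by unfold_locales (rule assms(1), rule assms(3))
  have prods: "has_degree M r (L (int l) (tensor_prods M (map form_tensor \<alpha>s @ map (vec_tensor M) Xs)))
      (real l - real (length Xs) * real r)"
    if "set \<alpha>s \<subseteq> of1" "set Xs \<subseteq> vf" for \<alpha>s Xs
    by (rule has_degree_lift[OF lift_degree_mixed_prods[OF that] assms(2)]) simp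
  have wedges: "has_degree M r
      (L (int k) (tensor_prod (wedge M (map form_tensor \<alpha>s)) (wedge M (map (vec_tensor M) Xs)))) w"
    if "set \<alpha>s \<subseteq> of1" "set Xs \<subseteq> vf" "k \<le> r" "w = real k - real (length Xs) * real r" for \<alpha>s Xs k w
    by (rule has_degree_lift[OF lift_degree_prod[OF lift_degree_form_wedge[OF that(1)]
            lift_degree_vec_wedge[OF that(2)]] that(3)]) (simp add: that(4))
  have form_wedge: "has_degree M r (L (int l) (wedge M (map form_tensor \<alpha>s))) (real l)"
    if "set \<alpha>s \<subseteq> of1" for \<alpha>s
    by (rule has_degree_lift[OF lift_degree_form_wedge(2)[OF that] assms(2)]) simp
  have vec_wedge: "has_degree M r (L (int l) (wedge M (map (vec_tensor M) Xs)))
      (real l - real (length Xs) * real r)"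
    if "set Xs \<subseteq> vf" for Xs
    by (rule has_degree_lift[OF lift_degree_vec_wedge(2)[OF that] assms(2)]) simp
  have jet_wedge: "has_degree M r (wedge JB Ts) w"
    if "set Ts \<subseteq> form_tensor ` J.of1 \<or> set Ts \<subseteq> vec_tensor JB ` J.vf"
      "has_degree M r (tensor_prods JB Ts) w" for Ts w
    using that(1)
  proof
    assume Ts: "set Ts \<subseteq> form_tensor ` J.of1"
    have "sig T = [Cov]" if "T \<in> set Ts" for T using that Ts by auto
    moreover have "set Ts \<subseteq> J.tf" using Ts J.form_tensor_field by blast
    ultimately show ?thesis
      using JD.homog_wedge[of Ts Cov w] that(2) unfolding has_degree_iff by blast
  next
    assume Ts: "set Ts \<subseteq> vec_tensor JB ` J.vf"
    have "sig T = [Con]" if "T \<in> set Ts" for T using that Ts by auto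
    moreover have "set Ts \<subseteq> J.tf" using Ts J.vec_tensor_field by blast
    ultimately show ?thesis
      using JD.homog_wedge[of Ts Con w] that(2) unfolding has_degree_iff by blast
  qed
  have complete: "\<exists>Y\<in>J.vf. L (int r) (vec_tensor M X) = vec_tensor JB Y \<and> lie_bracket \<Delta> Y = (\<lambda>F j. 0)"
    if "X \<in> vf" for X
    \<comment> \<open>For \<open>k = r\<close> the factor \<open>k - r\<close> is zero.\<close>
    using lift_vec_bracket[OF that, of "int r"] by simp
  show ?thesis
  proof (intro conjI allI impI ballI)
    fix \<alpha>s assume "set \<alpha>s \<subseteq> of1"
    then show "has_degree M r (L (int l) (tensor_prods M (map form_tensor \<alpha>s))) (real l)"
      using prods[of \<alpha>s "[]"] by simp
  next
    fix Xs assume "set Xs \<subseteq> vf"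
    then show "has_degree M r (L (int l) (tensor_prods M (map (vec_tensor M) Xs)))
         (real l - real (length Xs) * real r)"
      using prods[of "[]" Xs] by simp
  next
    fix \<alpha>s Xs assume "set \<alpha>s \<subseteq> of1 \<and> set Xs \<subseteq> vf"
    then show "has_degree M r (L (int l) (tensor_prods M (map form_tensor \<alpha>s @ map (vec_tensor M) Xs)))
         (real l - real (length Xs) * real r)"
      using prods by blast
  next
    fix Ts Ts' w assume "set Ts \<subseteq> J.tf \<and> mset Ts' = mset Ts \<and> has_degree M r (tensor_prods JB Ts) w"
    then show "has_degree M r (tensor_prods JB Ts') w"
      unfolding has_degree_iff using JD.homog_tensor_prods_perm by blast
  next
    fix Ts Ts' w assume "set Ts \<subseteq> tf \<and> mset Ts' = mset Ts \<and> has_degree M r (L (int l) (tensor_prods M Ts)) w"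
    then show "has_degree M r (L (int l) (tensor_prods M Ts')) w"
      unfolding has_degree_iff using homog_lift_tensor_prods_perm assms(2) by blast
  next
    fix Ts w assume "(set Ts \<subseteq> form_tensor ` J.of1 \<or> set Ts \<subseteq> vec_tensor JB ` J.vf) \<and>
      has_degree M r (tensor_prods JB Ts) w"
    then show "has_degree M r (wedge JB Ts) w" using jet_wedge by blast
  next
    fix \<alpha>s Xs assume "set \<alpha>s \<subseteq> of1 \<and> set Xs \<subseteq> vf"
    then show "has_degree M r (L (int l) (wedge M (map form_tensor \<alpha>s))) (real l)"
      "has_degree M r (L (int l) (wedge M (map (vec_tensor M) Xs))) (real l - real (length Xs) * real r)"
      "has_degree M r (L (int l) (tensor_prod (wedge M (map form_tensor \<alpha>s)) (wedge M (map (vec_tensor M) Xs))))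
        (real l - real (length Xs) * real r)"
      using form_wedge vec_wedge wedges assms(2) by blast+
  next
    fix \<omega>s Xs assume "set \<omega>s \<subseteq> of1 \<and> set Xs \<subseteq> vf"
    then show "has_degree M r
         (L (int r) (tensor_prod (wedge M (map form_tensor \<omega>s)) (wedge M (map (vec_tensor M) Xs))))
         (- (real (length Xs) - 1) * real r)"
      \<comment> \<open>The complete lift is the case \<open>k = r\<close>, and
        \<open>r - q r = - (q - 1) r\<close>.\<close>
      by (intro wedges) (auto simp: algebra_simps)
  next
    fix X assume "X \<in> vf"
    then show "\<exists>Y\<in>J.vf. L (int r) (vec_tensor M X) = vec_tensor JB Y \<and> lie_bracket \<Delta> Y = (\<lambda>F j. 0)"
      by (rule complete)
  qed
qed

end
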